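(* Consider the two-user real Gaussian MIMO interference channel with channel matrices $H_1,H_2,H_3,H_4$ and power constraints $P_1,P_2$ (see context), where all four channel matrices are square and invertible. If $H_2^TH_2\succeq H_4^TH_4$ and $H_3^TH_3\succeq H_1^TH_1$, then the sum-rate capacity is $$C^*=\max_{S_1,S_2}\ \min\left\{\begin{array}{c}\tfrac12\log\left|I+H_1S_1H_1^T+H_2S_2H_2^T\right|,\\[2pt] \tfrac12\log\left|I+H_3S_1H_3^T+H_4S_2H_4^T\right|,\\[2pt] \tfrac12\log\left|I+H_1S_1H_1^T\right|+\tfrac12\log\left|I+H_4S_2H_4^T\right|\end{array}\right\},$$ where the maximum is over symmetric positive semidefinite $S_1,S_2$ with $\mathrm{tr}(S_1)\le P_1$ and $\mathrm{tr}(S_2)\le P_2$.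
   Context: Channel: at each use, $y_1=H_1x_1+H_2x_2+z_1$ and $y_2=H_3x_1+H_4x_2+z_2$, where $x_i$ is the real vector sent by transmitter $i$, $y_i$ is the vector seen by receiver $i$, the $H_j$ are fixed real matrices of compatible sizes known to all, and $z_1,z_2$ are Gaussian vectors with zero mean and identity covariance, independent of the inputs and i.i.d. over channel uses. A length-$n$ code with rates $(R_1,R_2)$: independent messages $m_i$ uniform on a set of size $\lceil e^{nR_i}\rceil$; transmitter $i$ maps $m_i$ to $(x_{i,1},\dots,x_{i,n})$ subject to the average power constraint $\frac1n\sum_{j=1}^nE\|x_{i,j}\|^2\le P_i$; receiver $i$ estimates $m_i$ from $(y_{i,1},\dots,y_{i,n})$ only. A pair of nonnegative rates is achievable if there are codes with error probabilities at both receivers tending to $0$ as $n\to\infty$; the capacity region is the closure of the set of achievable pairs; the sum-rate capacity is the supremum of $R_1+R_2$ over it. Notation: $|X|$ of a matrix is its determinant; $\log$ is natural; $A\succeq B$ means $A-B$ is positive semidefinite. *)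

theory Defs
  imports "HOL-Probability.Probability"
begin

text \<open>
  A real matrix with \<open>r\<close> rows and \<open>t\<close> columns has type \<open>real^'t^'r\<close>.  Channel use number \<open>j\<close> of a
  block of length \<open>n\<close> is indexed by \<open>j < n\<close>.
\<close>

definition psd :: "real^'n^'n \<Rightarrow> bool" where
  "psd A \<longleftrightarrow> transpose A = A \<and> (\<forall>x. 0 \<le> x \<bullet> (A *v x))"

definition loewner_ge :: "real^'n^'n \<Rightarrow> real^'n^'n \<Rightarrow> bool"  (infix "\<succeq>" 50) where
  "A \<succeq> B \<longleftrightarrow> psd (A - B)"

definition std_gaussian :: "(real^'r) measure" where
  "std_gaussian = density lborel (\<lambda>z. ennreal (\<Prod>i\<in>UNIV. std_normal_density (z $ i)))"

text \<open>
  The law of the noise pair \<open>(z\<^sub>1, z\<^sub>2)\<close> in one channel use.  Only the two marginals are prescribed;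
  the dependence between \<open>z\<^sub>1\<close> and \<open>z\<^sub>2\<close> is arbitrary.
\<close>

definition noise_law :: "((real^'r1) \<times> (real^'r2)) measure \<Rightarrow> bool" where
  "noise_law N \<longleftrightarrow> prob_space N \<and> sets N = sets borel \<and>
     distr N borel fst = std_gaussian \<and> distr N borel snd = std_gaussian"

definition messages :: "nat \<Rightarrow> real \<Rightarrow> nat set" where
  "messages n R = {..<nat \<lceil>exp (real n * R)\<rceil>}"

definition uniform_message :: "nat \<Rightarrow> real \<Rightarrow> nat pmf" where
  "uniform_message n R = pmf_of_set (messages n R)"

text \<open>\<open>f m j\<close> is the vector sent in channel use \<open>j\<close> when the message is \<open>m\<close>.\<close>

definition encoder :: "nat \<Rightarrow> real \<Rightarrow> real \<Rightarrow> (nat \<Rightarrow> nat \<Rightarrow> real^'t) \<Rightarrow> bool" where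
  "encoder n R P f \<longleftrightarrow>
     (1 / real n) * (\<Sum>j<n. measure_pmf.expectation (uniform_message n R) (\<lambda>m. (norm (f m j))\<^sup>2)) \<le> P"

definition decoder :: "nat \<Rightarrow> real \<Rightarrow> ((nat \<Rightarrow> real^'r) \<Rightarrow> nat) \<Rightarrow> bool" where
  "decoder n R g \<longleftrightarrow> g \<in> measurable (Pi\<^sub>M {..<n} (\<lambda>_. borel)) (count_space (messages n R))"

text \<open>
  The joint law of the two messages and the noise in \<open>n\<close> channel uses; an outcome is a triple
  \<open>(m\<^sub>1, m\<^sub>2, z)\<close> where \<open>z j\<close> is the pair of noise vectors in channel use \<open>j\<close>.
\<close>

definition block_space ::
  "((real^'r1) \<times> (real^'r2)) measure \<Rightarrow> nat \<Rightarrow> real \<Rightarrow> real \<Rightarrow>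
   (nat \<times> nat \<times> (nat \<Rightarrow> (real^'r1) \<times> (real^'r2))) measure" where
  "block_space N n R1 R2 =
     measure_pmf (uniform_message n R1) \<Otimes>\<^sub>M (measure_pmf (uniform_message n R2) \<Otimes>\<^sub>M Pi\<^sub>M {..<n} (\<lambda>_. N))"

text \<open>The block received over \<open>y = A x\<^sub>1 + B x\<^sub>2 + z\<close>.\<close>

definition received ::
  "real^'t1^'r \<Rightarrow> real^'t2^'r \<Rightarrow> nat \<Rightarrow> (nat \<Rightarrow> real^'t1) \<Rightarrow> (nat \<Rightarrow> real^'t2) \<Rightarrow>
   (nat \<Rightarrow> real^'r) \<Rightarrow> nat \<Rightarrow> real^'r" where
  "received A B n x1 x2 z = (\<lambda>j\<in>{..<n}. A *v x1 j + B *v x2 j + z j)"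

definition error_prob1 ::
  "real^'t1^'r1 \<Rightarrow> real^'t2^'r1 \<Rightarrow> ((real^'r1) \<times> (real^'r2)) measure \<Rightarrow> nat \<Rightarrow> real \<Rightarrow> real \<Rightarrow>
   (nat \<Rightarrow> nat \<Rightarrow> real^'t1) \<Rightarrow> (nat \<Rightarrow> nat \<Rightarrow> real^'t2) \<Rightarrow> ((nat \<Rightarrow> real^'r1) \<Rightarrow> nat) \<Rightarrow> real" where
  "error_prob1 H1 H2 N n R1 R2 f1 f2 g1 =
     measure (block_space N n R1 R2)
       {(m1, m2, z) \<in> space (block_space N n R1 R2).
          g1 (received H1 H2 n (f1 m1) (f2 m2) (\<lambda>j. fst (z j))) \<noteq> m1}"

definition error_prob2 ::
  "real^'t1^'r2 \<Rightarrow> real^'t2^'r2 \<Rightarrow> ((real^'r1) \<times> (real^'r2)) measure \<Rightarrow> nat \<Rightarrow> real \<Rightarrow> real \<Rightarrow>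
   (nat \<Rightarrow> nat \<Rightarrow> real^'t1) \<Rightarrow> (nat \<Rightarrow> nat \<Rightarrow> real^'t2) \<Rightarrow> ((nat \<Rightarrow> real^'r2) \<Rightarrow> nat) \<Rightarrow> real" where
  "error_prob2 H3 H4 N n R1 R2 f1 f2 g2 =
     measure (block_space N n R1 R2)
       {(m1, m2, z) \<in> space (block_space N n R1 R2).
          g2 (received H3 H4 n (f1 m1) (f2 m2) (\<lambda>j. snd (z j))) \<noteq> m2}"

definition achievable ::
  "real^'t1^'r1 \<Rightarrow> real^'t2^'r1 \<Rightarrow> real^'t1^'r2 \<Rightarrow> real^'t2^'r2 \<Rightarrow>
   ((real^'r1) \<times> (real^'r2)) measure \<Rightarrow> real \<Rightarrow> real \<Rightarrow> real \<Rightarrow> real \<Rightarrow> bool" where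
  "achievable H1 H2 H3 H4 N P1 P2 R1 R2 \<longleftrightarrow> 0 \<le> R1 \<and> 0 \<le> R2 \<and>
     (\<exists>f1 f2 g1 g2.
        (\<forall>n\<ge>1. encoder n R1 P1 (f1 n) \<and> encoder n R2 P2 (f2 n) \<and>
                decoder n R1 (g1 n) \<and> decoder n R2 (g2 n)) \<and>
        (\<lambda>n. error_prob1 H1 H2 N n R1 R2 (f1 n) (f2 n) (g1 n)) \<longlonglongrightarrow> 0 \<and>
        (\<lambda>n. error_prob2 H3 H4 N n R1 R2 (f1 n) (f2 n) (g2 n)) \<longlonglongrightarrow> 0)"

definition capacity_region ::
  "real^'t1^'r1 \<Rightarrow> real^'t2^'r1 \<Rightarrow> real^'t1^'r2 \<Rightarrow> real^'t2^'r2 \<Rightarrow>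
   ((real^'r1) \<times> (real^'r2)) measure \<Rightarrow> real \<Rightarrow> real \<Rightarrow> (real \<times> real) set" where
  "capacity_region H1 H2 H3 H4 N P1 P2 =
     closure {(R1, R2). achievable H1 H2 H3 H4 N P1 P2 R1 R2}"

text \<open>Extended reals, so that the supremum is meaningful even for an unbounded region.\<close>

definition sum_rate_capacity ::
  "real^'t1^'r1 \<Rightarrow> real^'t2^'r1 \<Rightarrow> real^'t1^'r2 \<Rightarrow> real^'t2^'r2 \<Rightarrow>
   ((real^'r1) \<times> (real^'r2)) measure \<Rightarrow> real \<Rightarrow> real \<Rightarrow> ereal" where
  "sum_rate_capacity H1 H2 H3 H4 N P1 P2 =
     (SUP (R1, R2) \<in> capacity_region H1 H2 H3 H4 N P1 P2. ereal (R1 + R2))"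

definition sum_rate_min ::
  "real^'t1^'r1 \<Rightarrow> real^'t2^'r1 \<Rightarrow> real^'t1^'r2 \<Rightarrow> real^'t2^'r2 \<Rightarrow> real^'t1^'t1 \<Rightarrow> real^'t2^'t2 \<Rightarrow> real" where
  "sum_rate_min H1 H2 H3 H4 S1 S2 = Min
     {1/2 * ln (det (mat 1 + H1 ** S1 ** transpose H1 + H2 ** S2 ** transpose H2)),
      1/2 * ln (det (mat 1 + H3 ** S1 ** transpose H3 + H4 ** S2 ** transpose H4)),
      1/2 * ln (det (mat 1 + H1 ** S1 ** transpose H1)) + 1/2 * ln (det (mat 1 + H4 ** S2 ** transpose H4))}"

end

theory Submission imports Defs begin

text \<open>
  Converse. Once receiver 1 has decoded \<open>m\<^sub>1\<close> it can subtract \<open>H\<^sub>1 x\<^sub>1\<close>. Since \<open>K = H\<^sub>4 H\<^sub>2\<^sup>-\<^sup>1\<close> is a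
  contraction, multiplying by \<open>K\<close>, adding independent Gaussian noise of covariance \<open>I - K K\<^sup>T\<close> and adding
  \<open>H\<^sub>3 x\<^sub>1\<close> reproduces the law of \<open>y\<^sub>2\<close>, so receiver 1 can decode \<open>m\<^sub>2\<close> as well; symmetrically for
  receiver 2. Each resulting bound on \<open>log M\<close> comes from comparing the output law with a memoryless
  Gaussian reference law: by \<open>ln x \<le> x/2 - 1 + ln 2\<close>, the logarithm of the number of messages times the
  success probability is at most the relative entropy plus \<open>ln 2\<close>. The reference law has the message-averaged
  means and the time-averaged covariance, for which the relative entropy is exactly \<open>n/2 log |S|\<close>; all
  bounds involve the same pair of covariances.

  Achievability. Codewords are independent Gaussian blocks, and receiver \<open>i\<close> looks for a message \<open>m\<^sub>i\<close> such that,
  with some message of the other user, the information densities of \<open>x\<^sub>i\<close> given the other codeword and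
  of the pair both exceed thresholds. Markov's inequality handles wrong codewords, Chernoff bounds
  handle the right ones and the power constraint.
\<close>

text \<open>The value is a maximum of a minimum, so bounding each of the three expressions by its
  own maximum would be too weak: one code has to yield three bounds at a common admissible pair. A
  single reference law for all channel uses gives this directly, because time averaging then happens
  inside the covariance, where one would otherwise invoke concavity of log det.

  The 2 in the logarithmic inequality is its point of tangency. It is also the total mean of the
  weighted likelihood ratios to which the inequality is applied: the ratio has mean 1, and M times
  the ratio on correct decisions has mean at most 1 after averaging over messages, because a law
  that ignores the messages to be decoded guesses right with probability at most 1/M. The loss ln 2
  per block disappears on division by n.

  The third expression is the sum of the two single-user terms. In the direct part it is what allows
  a target sum rate below the minimum to be split into two rates, each below its single-user
  term.\<close>

section \<open>Positive semidefinite matrices\<close>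

text \<open>The simp rules turn \<open>transpose A *v x\<close> into \<open>x v* A\<close>. They are
  switched off because adjoints are kept in the form \<open>transpose A *v x\<close>
  throughout.\<close>

declare transpose_matrix_vector [simp del] vector_transpose_matrix [simp del]

lemma inner_matrix_vector: "x \<bullet> (A *v y) = (transpose A *v x) \<bullet> (y :: real^'m)" for A :: "real^'m^'n"
  by (simp add: transpose_matrix_vector dot_lmul_matrix)

lemma transpose_add: "transpose (A + B) = transpose A + transpose (B :: real^'n^'m)"
  by (simp add: transpose_def vec_eq_iff)

lemma transpose_minus: "transpose (A - B) = transpose A - transpose (B :: real^'n^'m)"
  by (simp add: transpose_def vec_eq_iff)

lemma transpose_scaleR: "transpose (c *\<^sub>R A) = c *\<^sub>R transpose (A :: real^'n^'m)"
  by (simp add: transpose_def vec_eq_iff)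

lemma matrix_mult_scaleR_left: "(c *\<^sub>R A) ** B = c *\<^sub>R (A ** B)" for A :: "real^'n^'m"
  by (simp add: matrix_matrix_mult_def vec_eq_iff sum_distrib_left mult.assoc)

lemma matrix_mult_scaleR_right: "A ** (c *\<^sub>R B) = c *\<^sub>R (A ** B)" for A :: "real^'n^'m"
  by (simp add: matrix_matrix_mult_def vec_eq_iff sum_distrib_left mult_ac)

definition outer :: "real^'n \<Rightarrow> real^'n^'n" where
  "outer v = (\<chi> i j. v $ i * v $ j)"

lemma outer_0 [simp]: "outer 0 = 0"
  by (simp add: outer_def vec_eq_iff)

lemma outer_mult: "outer v *v x = (v \<bullet> x) *\<^sub>R v"
  by (simp add: outer_def matrix_vector_mult_def vec_eq_iff inner_vec_def sum_distrib_left mult_ac)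

lemma transpose_outer [simp]: "transpose (outer v) = outer v"
  by (simp add: outer_def transpose_def vec_eq_iff mult.commute)

lemma trace_outer: "trace (outer v) = (norm v)\<^sup>2"
  unfolding trace_def outer_def by (simp add: norm_eq_sqrt_inner inner_vec_def sum_nonneg)

lemma psd_outer: "psd (outer v)"
  by (simp add: psd_def outer_mult inner_commute)

lemma psd_0 [simp]: "psd 0"
  by (simp add: psd_def transpose_def vec_eq_iff)

lemma psd_add: "psd A \<Longrightarrow> psd B \<Longrightarrow> psd (A + B)"
  by (simp add: psd_def transpose_add matrix_vector_mult_add_rdistrib inner_add_right)

lemma psd_sum: "(\<And>k. k \<in> K \<Longrightarrow> psd (A k)) \<Longrightarrow> psd (\<Sum>k\<in>K. A k)"
  by (induction K rule: infinite_finite_induct) (auto intro: psd_add)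

lemma psd_scaleR: "0 \<le> c \<Longrightarrow> psd A \<Longrightarrow> psd (c *\<^sub>R A)"
  by (simp add: psd_def transpose_scaleR scaleR_matrix_vector_assoc[symmetric])

lemma psd_conj: "psd S \<Longrightarrow> psd (A ** S ** transpose A)"
proof -
  assume S: "psd S"
  have "x \<bullet> ((A ** S ** transpose A) *v x) = (transpose A *v x) \<bullet> (S *v (transpose A *v x))" for x
    by (simp add: matrix_vector_mul_assoc[symmetric] inner_matrix_vector[of x A])
  then show ?thesis
    using S by (simp add: psd_def matrix_transpose_mul matrix_mul_assoc)
qed

lemma psd_mat_1: "psd (mat 1)"
  by (simp add: psd_def)

lemma psd_gram: "psd (A ** transpose A)"
  using psd_conj[OF psd_mat_1, of A] by simp

text \<open>With zero diagonal the form at \<open>axis i 1 + c *\<^sub>R axis j 1\<close> is linear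
  in \<open>c\<close>, so nonnegativity at \<open>c = 1\<close> and at \<open>c = -1\<close> forces
  the entry to vanish.\<close>

lemma psd_zero_diag:
  fixes A :: "real^'n^'n"
  assumes "psd A" and d: "\<And>i. A $ i $ i = 0"
  shows "A = 0"
proof -
  have "A $ i $ j = 0" for i j
  proof -
    have sym: "A $ j $ i = A $ i $ j"
      using assms(1) unfolding psd_def transpose_def by (metis vec_lambda_beta)
    have e: "(axis i 1 + c *\<^sub>R axis j 1) \<bullet> (A *v (axis i 1 + c *\<^sub>R axis j 1)) = 2 * c * A $ i $ j" for c
      by (simp add: matrix_vector_right_distrib matrix_vector_mult_scaleR inner_add_left inner_add_right
          matrix_vector_mult_basis inner_axis' column_def d sym)
    have "0 \<le> 2 * 1 * A $ i $ j" "0 \<le> 2 * (-1) * A $ i $ j"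
      using assms(1) unfolding psd_def e[symmetric] by blast+
    then show ?thesis by simp
  qed
  then show ?thesis by (simp add: vec_eq_iff)
qed

lemma psd_diag_nonneg: "psd A \<Longrightarrow> 0 \<le> A $ i $ i"
proof -
  have "axis i 1 \<bullet> (A *v axis i 1) = A $ i $ i"
    by (simp add: matrix_vector_mult_basis inner_axis' column_def)
  then show "psd A \<Longrightarrow> 0 \<le> A $ i $ i" unfolding psd_def by metis
qed

text \<open>A Schur complement: its form at \<open>x\<close> is the minimum over \<open>t\<close> of
  the form of \<open>A\<close> at \<open>x - t *\<^sub>R axis k 1\<close>.\<close>

lemma psd_schur_step:
  fixes A :: "real^'n^'n"
  assumes A: "psd A" and pos: "A $ k $ k > 0"
  shows "psd (A - (1 / A $ k $ k) *\<^sub>R outer (column k A))"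
proof -
  have sym: "transpose A = A" using A by (simp add: psd_def)
  have ke: "column k A = A *v axis k 1" by (simp add: matrix_vector_mult_basis)
  have "0 \<le> x \<bullet> ((A - (1 / A $ k $ k) *\<^sub>R outer (column k A)) *v x)" for x
  proof -
    define a where "a = column k A"
    define t where "t = (a \<bullet> x) / A $ k $ k"
    have xa: "x \<bullet> (A *v axis k 1) = a \<bullet> x" by (simp add: a_def ke inner_commute)
    have ax: "axis k 1 \<bullet> (A *v x) = a \<bullet> x"
      by (simp add: inner_matrix_vector sym a_def ke)
    have kk: "axis k 1 \<bullet> (A *v axis k 1) = A $ k $ k"
      by (simp add: matrix_vector_mult_basis inner_axis' column_def)
    have "0 \<le> (x - t *\<^sub>R axis k 1) \<bullet> (A *v (x - t *\<^sub>R axis k 1))"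
      using A by (simp add: psd_def)
    also have "\<dots> = x \<bullet> (A *v x) - 2 * t * (a \<bullet> x) + t\<^sup>2 * A $ k $ k"
      by (simp add: matrix_vector_mult_diff_distrib matrix_vector_mult_scaleR inner_diff_left inner_diff_right
          xa ax kk power2_eq_square algebra_simps)
    also have "\<dots> = x \<bullet> (A *v x) - (a \<bullet> x)\<^sup>2 / A $ k $ k"
      using pos by (simp add: t_def power2_eq_square field_simps)
    also have "\<dots> = x \<bullet> ((A - (1 / A $ k $ k) *\<^sub>R outer a) *v x)"
      by (simp add: matrix_vector_mult_diff_rdistrib inner_diff_right outer_mult power2_eq_square inner_commute
          scaleR_matrix_vector_assoc[symmetric])
    finally show ?thesis by (simp add: a_def)
  qed
  then show ?thesis
    using sym by (simp add: psd_def transpose_minus transpose_scaleR)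
qed

text \<open>Elimination with one Schur step per index, in place of a spectral theorem.
  \<open>K\<close> holds the indices still to be treated. A step clears the diagonal entry
  \<open>k\<close> and cannot revive a cleared one, because diagonal entries only decrease and stay
  nonnegative.\<close>

lemma psd_sum_outer:
  fixes A :: "real^'n^'n"
  assumes "finite K" "psd A" "\<And>i. i \<notin> K \<Longrightarrow> A $ i $ i = 0"
  shows "\<exists>v. A = (\<Sum>k\<in>K. outer (v k))"
  using assms
proof (induction K arbitrary: A rule: finite_induct)
  case empty
  then show ?case using psd_zero_diag by auto
next
  case (insert k K)
  show ?case
  proof (cases "A $ k $ k = 0")
    case True
    have "A $ i $ i = 0" if "i \<notin> K" for i
      using that True insert.prems(2) by (cases "i = k") auto
    then obtain v where v: "A = (\<Sum>k\<in>K. outer (v k))"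
      using insert.IH[OF insert.prems(1)] insert.prems(2) by blast
    have "A = (\<Sum>k'\<in>insert k K. outer ((v(k := 0)) k'))"
    proof -
      have "(\<Sum>k'\<in>K. outer ((v(k := 0)) k')) = (\<Sum>k\<in>K. outer (v k))"
        using insert.hyps by (intro sum.cong) auto
      then show ?thesis using insert.hyps v by simp
    qed
    then show ?thesis by blast
  next
    case False
    then have pos: "A $ k $ k > 0" using psd_diag_nonneg[OF insert.prems(1), of k] by simp
    define A' where "A' = A - (1 / A $ k $ k) *\<^sub>R outer (column k A)"
    have p: "psd A'" unfolding A'_def by (rule psd_schur_step[OF insert.prems(1) pos])
    have "A' $ i $ i = 0" if "i \<notin> K" for i
    proof (cases "i = k")
      case True
      then show ?thesis using pos by (simp add: A'_def outer_def column_def field_simps)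
    next
      case False
      then have "A $ i $ i = 0" using that insert.prems by simp
      then have "A' $ i $ i \<le> 0"
        using pos by (simp add: A'_def outer_def column_def field_simps)
      then show ?thesis using psd_diag_nonneg[OF p, of i] by simp
    qed
    then obtain v where v: "A' = (\<Sum>k\<in>K. outer (v k))" using insert.IH[OF p] by blast
    define w where "w = v(k := (1 / sqrt (A $ k $ k)) *\<^sub>R column k A)"
    have "outer (w k) = (1 / A $ k $ k) *\<^sub>R outer (column k A)"
      using pos by (simp add: w_def outer_def vec_eq_iff field_simps)
    then have "A = outer (w k) + A'" by (simp add: A'_def)
    also have "A' = (\<Sum>k\<in>K. outer (w k))"
      using insert.hyps by (auto simp: v w_def intro!: sum.cong)
    finally have "A = (\<Sum>k\<in>insert k K. outer (w k))" using insert.hyps by simp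
    then show ?thesis by blast
  qed
qed

lemma psd_factor:
  fixes A :: "real^'n^'n"
  assumes "psd A"
  obtains B :: "real^'n^'n" where "A = B ** transpose B"
proof -
  obtain v :: "'n \<Rightarrow> real^'n" where v: "A = (\<Sum>k\<in>UNIV. outer (v k))"
    using psd_sum_outer[OF finite[of UNIV] assms] by fastforce
  define B :: "real^'n^'n" where "B = (\<chi> i k. v k $ i)"
  have "A = B ** transpose B"
    by (simp add: v B_def outer_def matrix_matrix_mult_def transpose_def vec_eq_iff)
  then show ?thesis by (rule that)
qed

section \<open>Positive definite matrices, inverses and determinants\<close>

definition pdef :: "real^'n^'n \<Rightarrow> bool" where
  "pdef A \<longleftrightarrow> transpose A = A \<and> (\<forall>x. x \<noteq> 0 \<longrightarrow> 0 < x \<bullet> (A *v x))"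

lemma pdef_imp_psd: "pdef A \<Longrightarrow> psd A"
  unfolding pdef_def psd_def by (metis inner_zero_left less_eq_real_def)

lemma pdef_mat_1 [simp]: "pdef (mat 1)"
  by (simp add: pdef_def)

lemma pdef_add_psd: "pdef A \<Longrightarrow> psd B \<Longrightarrow> pdef (A + B)"
  unfolding pdef_def psd_def
  by (simp add: transpose_add matrix_vector_mult_add_rdistrib inner_add_right add_pos_nonneg)

lemma pdef_invertible:
  assumes "pdef A" shows "invertible A"
  unfolding invertible_left_inverse matrix_left_invertible_ker
  using assms unfolding pdef_def by (metis (no_types, lifting) inner_zero_right less_irrefl)

lemma matrix_inv_cancel:
  fixes A :: "real^'n^'n"
  assumes "invertible A"
  shows "A ** matrix_inv A = mat 1" "matrix_inv A ** A = mat 1"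
proof -
  have "A ** matrix_inv A = mat 1 \<and> matrix_inv A ** A = mat 1"
    unfolding matrix_inv_def by (rule someI_ex) (use assms in \<open>simp add: invertible_def\<close>)
  then show "A ** matrix_inv A = mat 1" "matrix_inv A ** A = mat 1" by auto
qed

lemma matrix_inv_vector_cancel:
  fixes A :: "real^'n^'n"
  assumes "invertible A"
  shows "A *v (matrix_inv A *v x) = x" "matrix_inv A *v (A *v x) = x"
  using matrix_inv_cancel[OF assms] by (simp_all add: matrix_vector_mul_assoc)

lemma matrix_inv_unique:
  fixes A :: "real^'n^'n"
  assumes "invertible A" "A ** B = mat 1"
  shows "B = matrix_inv A"
  by (metis assms matrix_inv_cancel(2) matrix_mul_assoc matrix_mul_lid matrix_mul_rid)

lemma invertible_matrix_inv: "invertible A \<Longrightarrow> invertible (matrix_inv A)" for A :: "real^'n^'n"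
  using matrix_inv_cancel unfolding invertible_def by blast

lemma invertible_transpose: "invertible A \<Longrightarrow> invertible (transpose A)" for A :: "real^'n^'n"
  by (simp add: invertible_det_nz)

lemma transpose_matrix_inv: "invertible A \<Longrightarrow> transpose (matrix_inv A) = matrix_inv (transpose A)" for A :: "real^'n^'n"
  by (rule matrix_inv_unique)
     (simp_all add: matrix_transpose_mul[symmetric] matrix_inv_cancel transpose_mat invertible_transpose)

lemma pdef_factor:
  fixes A :: "real^'n^'n"
  assumes "pdef A"
  obtains L :: "real^'n^'n" where "A = L ** transpose L" "invertible L"
proof -
  obtain L :: "real^'n^'n" where L: "A = L ** transpose L" using psd_factor[OF pdef_imp_psd[OF assms]] .
  have "det A \<noteq> 0" using pdef_invertible[OF assms] by (simp add: invertible_det_nz)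
  then have "invertible L" by (simp add: L det_mul invertible_det_nz)
  with L show ?thesis by (rule that)
qed

lemma pdef_det_pos: "pdef A \<Longrightarrow> 0 < det A"
  by (erule pdef_factor) (auto simp: det_mul invertible_det_nz zero_less_mult_iff linorder_neq_iff)

section \<open>Gaussian measures\<close>

lemma borel_measurable_vec_nth_comp [measurable (raw)]:
  "f \<in> borel_measurable M \<Longrightarrow> (\<lambda>x. (f x :: real^'n) $ i) \<in> borel_measurable M"
  by (rule borel_measurable_continuous_on[where f = "\<lambda>x. x $ i"]) (intro continuous_intros)

lemma borel_measurable_matrix_vector_mult [measurable (raw)]:
  "f \<in> borel_measurable M \<Longrightarrow> (\<lambda>x. A *v (f x :: real^'n)) \<in> borel_measurable M" for A :: "real^'n^'m"
  by (rule borel_measurable_continuous_on[where f = "\<lambda>x. A *v x"])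
     (intro linear_continuous_on matrix_vector_mul_bounded_linear)

lemma prod_indicator_PiE:
  assumes "finite I" "x \<in> extensional I"
  shows "indicator (Pi\<^sub>E I A) x = (\<Prod>i\<in>I. indicator (A i) (x i) :: ennreal)"
proof (cases "x \<in> Pi\<^sub>E I A")
  case True
  then have "(\<Prod>i\<in>I. indicator (A i) (x i) :: ennreal) = 1"
    by (intro prod.neutral) (auto simp: indicator_def PiE_iff)
  then show ?thesis using True by simp
next
  case False
  then obtain i where "i \<in> I" "x i \<notin> A i" using assms by (auto simp: PiE_def)
  then have "(\<Prod>i\<in>I. indicator (A i) (x i) :: ennreal) = 0"
    using assms by (intro prod_zero) (auto intro!: bexI[of _ i])
  then show ?thesis using False by simp
qed

lemma PiM_density:
  assumes [simp]: "finite I"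
    and M: "\<And>i. sigma_finite_measure (M i)"
    and D: "\<And>i. sigma_finite_measure (density (M i) (f i))"
    and [measurable]: "\<And>i. f i \<in> borel_measurable (M i)"
  shows "PiM I (\<lambda>i. density (M i) (f i)) = density (PiM I M) (\<lambda>x. \<Prod>i\<in>I. f i (x i))"
proof (rule sym, rule product_sigma_finite.PiM_eqI)
  show "product_sigma_finite (\<lambda>i. density (M i) (f i))"
    using D by (simp add: product_sigma_finite_def)
  show "sets (density (PiM I M) (\<lambda>x. \<Prod>i\<in>I. f i (x i))) = sets (PiM I (\<lambda>i. density (M i) (f i)))"
    by (simp cong: sets_PiM_cong)
  fix A assume "\<And>i. i \<in> I \<Longrightarrow> A i \<in> sets (density (M i) (f i))"
  then have [measurable]: "\<And>i. i \<in> I \<Longrightarrow> A i \<in> sets (M i)" by simp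
  interpret product_sigma_finite M
    using M by (simp add: product_sigma_finite_def)
  have [measurable]: "(\<lambda>x. \<Prod>i\<in>I. f i (x i)) \<in> borel_measurable (PiM I M)"
    by measurable
  have "emeasure (density (PiM I M) (\<lambda>x. \<Prod>i\<in>I. f i (x i))) (Pi\<^sub>E I A) =
      (\<integral>\<^sup>+x. (\<Prod>i\<in>I. f i (x i)) * indicator (Pi\<^sub>E I A) x \<partial>PiM I M)"
    by (subst emeasure_density) (auto intro!: sets_PiM_I_finite)
  also have "\<dots> = (\<integral>\<^sup>+x. (\<Prod>i\<in>I. f i (x i) * indicator (A i) (x i)) \<partial>PiM I M)"
  proof (rule nn_integral_cong)
    fix x assume "x \<in> space (PiM I M)"
    then have x: "x \<in> extensional I" by (auto simp: space_PiM PiE_def)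
    then have "indicator (Pi\<^sub>E I A) x = (\<Prod>i\<in>I. indicator (A i) (x i) :: ennreal)"
      by (intro prod_indicator_PiE) auto
    then show "(\<Prod>i\<in>I. f i (x i)) * indicator (Pi\<^sub>E I A) x = (\<Prod>i\<in>I. f i (x i) * indicator (A i) (x i))"
      by (simp add: prod.distrib)
  qed
  also have "\<dots> = (\<Prod>i\<in>I. \<integral>\<^sup>+x. f i x * indicator (A i) x \<partial>M i)"
    by (rule product_nn_integral_prod) auto
  also have "\<dots> = (\<Prod>i\<in>I. emeasure (density (M i) (f i)) (A i))"
    by (intro prod.cong) (auto simp: emeasure_density)
  finally show "emeasure (density (PiM I M) (\<lambda>x. \<Prod>i\<in>I. f i (x i))) (Pi\<^sub>E I A) = \<dots>" .
qed simp

lemma Basis_vec_real: "(Basis :: (real^'n) set) = range (\<lambda>i. axis i 1)"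
  by (auto simp: Basis_vec_def)

lemma prod_Basis_vec: "(\<Prod>b\<in>(Basis :: (real^'n) set). f b) = (\<Prod>i\<in>UNIV. f (axis i 1))"
  unfolding Basis_vec_real by (subst prod.reindex) (auto simp: inj_on_def axis_eq_axis)

lemma measurable_vec_lambda [measurable]:
  "vec_lambda \<in> measurable (PiM UNIV (\<lambda>_. lborel)) (borel :: (real^'n) measure)"
proof (subst borel_measurable_euclidean_space, intro ballI)
  fix b :: "real^'n" assume "b \<in> Basis"
  then obtain i where b: "b = axis i 1" by (auto simp: Basis_vec_real)
  have "(\<lambda>x. x i) \<in> borel_measurable (PiM UNIV (\<lambda>_. lborel :: real measure))"
    by measurable
  then show "(\<lambda>x. vec_lambda x \<bullet> b) \<in> borel_measurable (PiM UNIV (\<lambda>_. lborel))"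
    by (simp add: b inner_axis)
qed

text \<open>Links Lebesgue measure on vectors to a product measure on functions, where integrals of
  products factor over the coordinates.\<close>

lemma lborel_eq_distr_PiM:
  "lborel = distr (PiM UNIV (\<lambda>_::'n::finite. lborel)) borel (vec_lambda :: _ \<Rightarrow> real^'n)"
proof (rule lborel_eqI)
  fix l u :: "real^'n" assume lu: "\<And>b. b \<in> Basis \<Longrightarrow> l \<bullet> b \<le> u \<bullet> b"
  interpret product_sigma_finite "\<lambda>_::'n. lborel :: real measure" ..
  have "l $ i \<le> u $ i" for i using lu[of "axis i 1"] by (simp add: inner_axis Basis_vec_real)
  moreover have "vec_lambda -` box l u \<inter> space (PiM UNIV (\<lambda>_::'n. lborel)) = (\<Pi>\<^sub>E i\<in>UNIV. {l $ i <..< u $ i})"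
    by (auto simp: mem_box_cart space_PiM PiE_iff)
  ultimately show "emeasure (distr (PiM UNIV (\<lambda>_. lborel)) borel vec_lambda) (box l u) = (\<Prod>b\<in>Basis. (u - l) \<bullet> b)"
    by (simp add: emeasure_distr emeasure_PiM prod_ennreal[symmetric] prod_Basis_vec inner_axis)
qed simp

section \<open>The standard Gaussian law and its moments\<close>

definition phi :: "real^'n \<Rightarrow> real" where
  "phi z = (\<Prod>i\<in>UNIV. std_normal_density (z $ i))"

lemma phi_pos: "0 < phi z"
  by (simp add: phi_def prod_pos normal_density_def)

lemma phi_measurable [measurable]: "phi \<in> borel_measurable borel"
  unfolding phi_def by measurable

lemma std_gaussian_phi: "std_gaussian = density lborel phi"
  by (simp add: std_gaussian_def phi_def)

lemma phi_eq: "phi (z :: real^'n) = (1 / sqrt (2 * pi)) ^ CARD('n) * exp (- (z \<bullet> z) / 2)"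
  by (simp add: phi_def normal_density_def prod.distrib power_one_over inner_vec_def
      exp_sum[symmetric] sum_negf sum_divide_distrib power2_eq_square prod_dividef)

lemma sets_std_gaussian [simp, measurable_cong]: "sets std_gaussian = sets borel"
  by (simp add: std_gaussian_def)

lemma space_std_gaussian [simp]: "space std_gaussian = UNIV"
  by (simp add: std_gaussian_def)

abbreviation snorm :: "real measure" where
  "snorm \<equiv> density lborel std_normal_density"

lemma prob_space_snorm: "prob_space snorm"
  by (rule prob_space_normal_density) simp

lemma std_gaussian_eq_distr_PiM:
  "std_gaussian = distr (PiM UNIV (\<lambda>_::'n::finite. snorm)) borel (vec_lambda :: _ \<Rightarrow> real^'n)"
proof -
  have "PiM UNIV (\<lambda>_::'n. snorm) = density (PiM UNIV (\<lambda>_::'n. lborel)) (\<lambda>x. \<Prod>i\<in>UNIV. ennreal (std_normal_density (x i)))"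
    by (rule PiM_density)
       (auto simp: sigma_finite_lborel prob_space_snorm prob_space_imp_sigma_finite)
  moreover have "std_gaussian = density (distr (PiM UNIV (\<lambda>_::'n. lborel)) borel (vec_lambda :: _ \<Rightarrow> real^'n)) phi"
    by (simp add: std_gaussian_phi lborel_eq_distr_PiM[symmetric])
  ultimately show ?thesis
    by (simp add: density_distr phi_def prod_ennreal)
qed

lemma prob_space_std_gaussian [simp]: "prob_space (std_gaussian :: (real^'n) measure)"
  unfolding std_gaussian_eq_distr_PiM
proof (rule prob_space.prob_space_distr)
  show "prob_space (PiM UNIV (\<lambda>_::'n. snorm))" by (intro prob_space_PiM prob_space_snorm)
  have "sets (PiM UNIV (\<lambda>_::'n. snorm)) = sets (PiM UNIV (\<lambda>_::'n. lborel))" by (intro sets_PiM_cong) auto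
  then show "vec_lambda \<in> measurable (PiM UNIV (\<lambda>_::'n. snorm)) borel"
    using measurable_vec_lambda measurable_cong_sets by blast
qed

lemma nn_integral_phi: "(\<integral>\<^sup>+z. phi z \<partial>lborel) = 1"
  using prob_space.emeasure_space_1[OF prob_space_std_gaussian] 
  by (simp add: std_gaussian_phi emeasure_density)

lemma has_bochner_integral_std_gaussian_prod:
  fixes g :: "'n::finite \<Rightarrow> real \<Rightarrow> real"
  assumes g: "\<And>i. has_bochner_integral snorm (g i) (m i)"
  shows "has_bochner_integral (std_gaussian :: (real^'n) measure) (\<lambda>z. \<Prod>i\<in>UNIV. g i (z $ i)) (\<Prod>i\<in>UNIV. m i)"
proof -
  interpret product_sigma_finite "\<lambda>_::'n. snorm"
    using prob_space_snorm by (simp add: product_sigma_finite_def prob_space_imp_sigma_finite)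
  have [measurable]: "g i \<in> borel_measurable borel" for i
    using borel_measurable_has_bochner_integral[OF g[of i]] by simp
  have sets: "sets (PiM UNIV (\<lambda>_::'n. snorm)) = sets (PiM UNIV (\<lambda>_::'n. lborel))" by (intro sets_PiM_cong) auto
  then have [measurable]: "vec_lambda \<in> measurable (PiM UNIV (\<lambda>_::'n. snorm)) (borel :: (real^'n) measure)"
    using measurable_vec_lambda measurable_cong_sets by blast
  have I: "integrable snorm (g i)" "(\<integral>x. g i x \<partial>snorm) = m i" for i
    using g by (auto simp: has_bochner_integral_iff)
  have "integrable (PiM UNIV (\<lambda>_::'n. snorm)) (\<lambda>x. \<Prod>i\<in>UNIV. g i (x i))"
    by (rule product_integrable_prod) (auto simp: I)
  moreover have "(\<integral>x. (\<Prod>i\<in>UNIV. g i (x i)) \<partial>PiM UNIV (\<lambda>_::'n. snorm)) = (\<Prod>i\<in>UNIV. m i)"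
    by (subst product_integral_prod) (auto simp: I)
  ultimately show ?thesis
    unfolding std_gaussian_eq_distr_PiM
    by (simp add: has_bochner_integral_iff integrable_distr_eq integral_distr)
qed

lemma snorm_moments:
  "has_bochner_integral snorm (\<lambda>_. 1 :: real) 1"
  "has_bochner_integral snorm (\<lambda>x. x) 0"
  "has_bochner_integral snorm (\<lambda>x. x * x) 1"
proof -
  have *: "has_bochner_integral snorm f c \<longleftrightarrow> has_bochner_integral lborel (\<lambda>x. std_normal_density x * f x) c"
    if [measurable]: "f \<in> borel_measurable borel" for f :: "real \<Rightarrow> real" and c
    by (simp add: has_bochner_integral_iff integrable_density integral_density)
  show "has_bochner_integral snorm (\<lambda>_. 1 :: real) 1"
    by (subst *) (use std_normal_moment_even[of 0] in simp_all)
  show "has_bochner_integral snorm (\<lambda>x. x) 0"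
    using std_normal_moment_odd[of 0] by (simp add: *)
  show "has_bochner_integral snorm (\<lambda>x. x * x) 1"
    using std_normal_moment_even[of 1] by (simp add: * power2_eq_square fact_numeral numeral_2_eq_2)
qed

lemma has_bochner_integral_std_gaussian_nth:
  "has_bochner_integral (std_gaussian :: (real^'n) measure) (\<lambda>z. z $ i) 0"
proof -
  have "has_bochner_integral (std_gaussian :: (real^'n) measure)
    (\<lambda>z. \<Prod>j\<in>UNIV. (if j = i then z $ j else 1)) (\<Prod>j\<in>UNIV. if j = i then 0 else 1)"
    by (rule has_bochner_integral_std_gaussian_prod[where g = "\<lambda>j x. if j = i then x else 1"])
       (auto simp: snorm_moments)
  then show ?thesis by (simp add: prod.delta)
qed

lemma has_bochner_integral_std_gaussian_nth_mult:
  "has_bochner_integral (std_gaussian :: (real^'n) measure) (\<lambda>z. z $ i * z $ k) (if i = k then 1 else 0)"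
proof -
  \<comment> \<open>Two separate conditionals, so that for \<open>i = k\<close> both factors fall on
    the same coordinate and give \<open>x * x\<close>.\<close>
  define g :: "'n \<Rightarrow> real \<Rightarrow> real" where "g = (\<lambda>j x. (if j = i then x else 1) * (if j = k then x else 1))"
  define m :: "'n \<Rightarrow> real" where "m = (\<lambda>j. if i = k then 1 else if j = i \<or> j = k then 0 else 1)"
  have "has_bochner_integral (std_gaussian :: (real^'n) measure) (\<lambda>z. \<Prod>j\<in>UNIV. g j (z $ j)) (\<Prod>j\<in>UNIV. m j)"
    by (rule has_bochner_integral_std_gaussian_prod) (auto simp: g_def m_def snorm_moments)
  moreover have "(\<Prod>j\<in>UNIV. g j (z $ j)) = z $ i * z $ k" for z
    by (simp add: g_def prod.distrib prod.delta)
  moreover have "(\<Prod>j\<in>UNIV. m j) = (if i = k then 1 else 0)"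
    by (auto simp: m_def intro: prod_zero)
  ultimately show ?thesis by simp
qed

lemma has_bochner_integral_std_gaussian_linear:
  "has_bochner_integral (std_gaussian :: (real^'n) measure) (\<lambda>z. v \<bullet> z) 0"
proof -
  have "has_bochner_integral (std_gaussian :: (real^'n) measure) (\<lambda>z. \<Sum>i\<in>UNIV. v $ i * z $ i) (\<Sum>i\<in>UNIV. v $ i * 0)"
    by (intro has_bochner_integral_sum has_bochner_integral_mult_right has_bochner_integral_std_gaussian_nth)
  then show ?thesis by (simp add: inner_vec_def)
qed

lemma has_bochner_integral_std_gaussian_quadratic:
  fixes A :: "real^'n^'n"
  shows "has_bochner_integral std_gaussian (\<lambda>z. z \<bullet> (A *v z)) (trace A)"
proof -
  have "has_bochner_integral (std_gaussian :: (real^'n) measure)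
      (\<lambda>z. \<Sum>i\<in>UNIV. \<Sum>k\<in>UNIV. A $ i $ k * (z $ i * z $ k)) (\<Sum>i\<in>UNIV. \<Sum>k\<in>UNIV. A $ i $ k * (if i = k then 1 else 0))"
    by (intro has_bochner_integral_sum has_bochner_integral_mult_right has_bochner_integral_std_gaussian_nth_mult)
  then show ?thesis
    by (simp add: inner_vec_def matrix_vector_mult_def trace_def sum_distrib_left mult_ac sum.delta if_distrib cong: if_cong)
qed

text \<open>The source of the exponential moments used later. The rate 1/4 lies below the critical
  value 1/2: in each coordinate the weighted density is \<open>sqrt 2\<close> times a normal density
  of variance 2.\<close>

lemma nn_integral_std_gaussian_exp_norm:
  "(\<integral>\<^sup>+z. ennreal (exp (1/4 * (z \<bullet> z))) \<partial>(std_gaussian :: (real^'n::finite) measure)) < \<infinity>"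
proof -
  have i: "integrable snorm (\<lambda>x. exp (1/4 * (x * x)))"
  proof -
    have "integrable lborel (\<lambda>x. sqrt 2 * normal_density 0 (sqrt 2) x)" by simp
    moreover have "std_normal_density x * exp (1/4 * (x * x)) = sqrt 2 * normal_density 0 (sqrt 2) x" for x
      by (simp add: normal_density_def exp_add[symmetric] power2_eq_square real_sqrt_mult field_simps)
    ultimately show ?thesis by (simp add: integrable_density)
  qed
  have "integrable (std_gaussian :: (real^'n) measure) (\<lambda>z. \<Prod>i\<in>UNIV. exp (1/4 * (z $ i * z $ i)))"
    using has_bochner_integral_std_gaussian_prod[where 'n='n, OF has_bochner_integral_integrable[OF i]]
    unfolding has_bochner_integral_iff by blast
  also have "(\<lambda>z :: real^'n. \<Prod>i\<in>UNIV. exp (1/4 * (z $ i * z $ i))) = (\<lambda>z. exp (1/4 * (z \<bullet> z)))"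
    by (simp add: exp_sum[symmetric] inner_vec_def sum_distrib_left)
  finally have "integrable (std_gaussian :: (real^'n) measure) (\<lambda>z. exp (1/4 * (z \<bullet> z)))" .
  then show ?thesis by (simp add: integrable_iff_bounded)
qed

section \<open>Determinants of rank-one perturbations\<close>

lemma det_I_plus_rank_one:
  fixes u v :: "real^'n"
  shows "det (mat 1 + (\<chi> i j. u $ i * v $ j)) = 1 + v \<bullet> u"
proof (cases "v = 0")
  case True
  then have "(\<chi> i j. u $ i * v $ j) = (0 :: real^'n^'n)" by (simp add: vec_eq_iff)
  then show ?thesis using True by simp
next
  case False
  then obtain k where k: "v $ k \<noteq> 0" by (auto simp: vec_eq_iff)
  \<comment> \<open>\<open>P\<close> is the identity with row \<open>k\<close> replaced by
    \<open>v\<close>. Conjugation by \<open>P\<close> turns the perturbation u v^T into (P u) e_k^T,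
    because row \<open>k\<close> of \<open>P\<close> is \<open>v\<close>. This touches column
    \<open>k\<close> only, so Cramer's rule gives both determinants; \<open>k\<close> is chosen with
    \<open>v $ k \<noteq> 0\<close> to make \<open>det P\<close> cancel.\<close>
  define P :: "real^'n^'n" where "P = (\<chi> i. if i = k then v else axis i 1)"
  have "P = (\<chi> i. if i = k then (\<Sum>i\<in>UNIV. v $ i *s row i (mat 1 :: real^'n^'n)) else row i (mat 1))"
    by (simp add: P_def vec_eq_iff row_def mat_def axis_def sum.delta if_distrib cong: if_cong)
  then have "det P = v $ k"
    using cramer_lemma_transpose[where x = v and A = "mat 1 :: real^'n^'n" and k = k] by simp
  define R :: "real^'n^'n" where "R = (\<chi> i j. if j = k then (mat 1 *v (axis k 1 + P *v u)) $ i else mat 1 $ i $ j)"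
  have R: "det R = 1 + v \<bullet> u"
    unfolding R_def cramer_lemma by (simp add: P_def matrix_vector_mul_component)
  have Px: "(P ** A) $ i = (if i = k then v v* A else A $ i)" for A :: "real^'n^'n" and i
    by (simp add: P_def vec_eq_iff matrix_matrix_mult_def vector_matrix_mult_def axis_def if_distrib
        sum.delta mult.commute cong: if_cong)
  have Rx: "R $ i $ l = (if l = k then axis k 1 $ i + (P *v u) $ i else mat 1 $ i $ l)" for i l
    by (simp add: R_def)
  have "P ** (mat 1 + (\<chi> i j. u $ i * v $ j)) = R ** P"
  proof -
    have "(P ** (mat 1 + (\<chi> i j. u $ i * v $ j))) $ i $ j = (R ** P) $ i $ j" for i j
    proof -
      have Pu: "(P *v u) $ i = (if i = k then v \<bullet> u else u $ i)"
        by (simp add: P_def matrix_vector_mul_component inner_axis')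
      have "(R ** P) $ i $ j = (\<Sum>l\<in>UNIV. R $ i $ l * P $ l $ j)"
        by (simp add: matrix_matrix_mult_def)
      also have "\<dots> = (\<Sum>l\<in>UNIV. (if l = k then (P *v u) $ i * v $ j else 0) + (if l = i then P $ l $ j else 0))"
        by (intro sum.cong refl) (auto simp: Rx mat_def axis_def P_def[THEN arg_cong[where f = "\<lambda>P. P $ k $ j"]] algebra_simps)
      also have "\<dots> = (P *v u) $ i * v $ j + P $ i $ j"
        by (simp add: sum.distrib sum.delta)
      also have "\<dots> = (P ** (mat 1 + (\<chi> i j. u $ i * v $ j))) $ i $ j"
      proof (cases "i = k")
        case True
        have "(v v* (mat 1 + (\<chi> i j. u $ i * v $ j))) $ j = (\<Sum>l\<in>UNIV. (if l = j then v $ l else 0) + v $ l * u $ l * v $ j)"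
          unfolding vector_matrix_mult_def by (auto intro!: sum.cong simp: mat_def algebra_simps)
        then show ?thesis
          using True unfolding Px Pu
          by (simp add: sum.distrib sum.delta inner_vec_def P_def sum_distrib_right)
      next
        case False
        then show ?thesis unfolding Px Pu by (simp add: P_def mat_def axis_def)
      qed
      finally show ?thesis by simp
    qed
    then show ?thesis by (simp add: vec_eq_iff)
  qed
  then have "det P * det (mat 1 + (\<chi> i j. u $ i * v $ j)) = det R * det P"
    by (metis det_mul)
  then show ?thesis using \<open>det P = v $ k\<close> k R by simp
qed

lemma det_plus_outer:
  fixes S :: "real^'n^'n"
  assumes "invertible S"
  shows "det (S + outer v) = det S * (1 + v \<bullet> (matrix_inv S *v v))"
proof -
  have "S ** (\<chi> i j. (matrix_inv S *v v) $ i * v $ j) = (\<chi> i j. (S *v (matrix_inv S *v v)) $ i * v $ j)"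
    by (simp add: vec_eq_iff matrix_matrix_mult_def matrix_vector_mult_def[of S] sum_distrib_left sum_distrib_right mult_ac)
  then have "S ** (mat 1 + (\<chi> i j. (matrix_inv S *v v) $ i * v $ j)) = S + outer v"
    by (simp add: matrix_add_ldistrib matrix_inv_vector_cancel[OF assms] outer_def)
  then have "det (S + outer v) = det S * det (mat 1 + (\<chi> i j. (matrix_inv S *v v) $ i * v $ j))"
    by (metis det_mul)
  then show ?thesis by (simp add: det_I_plus_rank_one)
qed

section \<open>Completing the square and Gaussian integrals\<close>

definition qform :: "real^'n^'n \<Rightarrow> real^'n \<Rightarrow> real" where
  "qform S y = y \<bullet> (matrix_inv S *v y)"

lemma qform_measurable [measurable]: "qform S \<in> borel_measurable borel"
  unfolding qform_def by measurable

lemma qform_mat_1 [simp]: "qform (mat 1) y = y \<bullet> y" for y :: "real^'n"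
proof -
  have "matrix_inv (mat 1 :: real^'n^'n) = mat 1" 
    by (rule matrix_inv_unique[symmetric]) (simp_all add: invertible_det_nz)
  then show ?thesis by (simp add: qform_def)
qed

lemma pdef_matrix_inv_sym: "pdef S \<Longrightarrow> transpose (matrix_inv S) = matrix_inv S"
  using transpose_matrix_inv[OF pdef_invertible, of S] by (simp add: pdef_def)

text \<open>Read in Gaussian exponents: if \<open>w\<close> is standard and
  \<open>y - A *v w\<close> is independent of it with covariance \<open>S\<close>, then
  \<open>y\<close> has covariance \<open>S + A ** transpose A\<close>, and
  \<open>transpose A *v u\<close> is the conditional mean of \<open>w\<close> given
  \<open>y\<close>. The remainder depends on \<open>w\<close> and \<open>y\<close> only through the
  deviation \<open>v\<close>.\<close>

lemma complete_square:
  fixes A S :: "real^'n^'n" and w y :: "real^'n"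
  assumes S: "pdef S" and S': "pdef (S + A ** transpose A)"
  defines "u \<equiv> matrix_inv (S + A ** transpose A) *v y"
  defines "v \<equiv> w - transpose A *v u"
  shows "w \<bullet> w + qform S (y - A *v w) = qform (S + A ** transpose A) y + (v \<bullet> v + qform S (A *v v))"
proof -
  have sym: "transpose S = S" and isym: "transpose (matrix_inv S) = matrix_inv S"
    using S by (auto simp: pdef_def pdef_matrix_inv_sym)
  have y: "y = S *v u + A *v (transpose A *v u)"
  proof -
    have "(S + A ** transpose A) *v u = y"
      unfolding u_def by (rule matrix_inv_vector_cancel(1)[OF pdef_invertible[OF S']])
    then show ?thesis by (simp add: matrix_vector_mult_add_rdistrib matrix_vector_mul_assoc[symmetric])
  qed
  have w: "w = transpose A *v u + v" by (simp add: v_def)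
  have e: "y - A *v w = S *v u - A *v v"
    by (simp add: w matrix_vector_right_distrib) (subst (1) y, simp)
  have c: "matrix_inv S *v (S *v u) = u"
    by (rule matrix_inv_vector_cancel(2)[OF pdef_invertible[OF S]])
  have d: "(S *v u) \<bullet> (matrix_inv S *v (A *v v)) = u \<bullet> (A *v v)"
    by (metis c inner_matrix_vector isym)
  have f: "(A *v v) \<bullet> u = (transpose A *v u) \<bullet> v" "u \<bullet> (A *v v) = (transpose A *v u) \<bullet> v"
    using inner_matrix_vector[of u A v] by (simp_all only: inner_commute[of "A *v v" u])
  have "qform S (y - A *v w) = (S *v u) \<bullet> u - 2 * ((transpose A *v u) \<bullet> v) + qform S (A *v v)"
    by (simp add: e qform_def matrix_vector_mult_diff_distrib inner_diff_left inner_diff_right c d f)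
  moreover have "w \<bullet> w = (transpose A *v u) \<bullet> (transpose A *v u) + 2 * ((transpose A *v u) \<bullet> v) + v \<bullet> v"
    by (simp add: w inner_add_left inner_add_right inner_commute)
  moreover have "qform (S + A ** transpose A) y = (S *v u) \<bullet> u + (transpose A *v u) \<bullet> (transpose A *v u)"
  proof -
    have "qform (S + A ** transpose A) y = y \<bullet> u" by (simp add: qform_def u_def)
    also have "\<dots> = (S *v u) \<bullet> u + (A *v (transpose A *v u)) \<bullet> u"
      by (subst y) (simp add: inner_add_left)
    also have "(A *v (transpose A *v u)) \<bullet> u = (transpose A *v u) \<bullet> (transpose A *v u)"
      by (simp only: inner_commute[of "A *v (transpose A *v u)" u] inner_matrix_vector[of u A])
    finally show ?thesis .
  qed
  ultimately show ?thesis by simp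
qed

text \<open>The case of a scalar signal \<open>w\<close>. Here the coefficient
  \<open>1 + qform S v\<close> of the remaining square is explicit, and it is the factor by which
  the determinant grows in \<open>det_plus_outer\<close>.\<close>

lemma complete_square_rank_one:
  fixes S :: "real^'n^'n" and v y :: "real^'n" and w :: real
  assumes S: "pdef S"
  defines "k \<equiv> v \<bullet> (matrix_inv (S + outer v) *v y)"
  shows "w\<^sup>2 + qform S (y - w *\<^sub>R v) = qform (S + outer v) y + (1 + qform S v) * (w - k)\<^sup>2"
proof -
  define u where "u = matrix_inv (S + outer v) *v y"
  have sym: "transpose S = S" and isym: "transpose (matrix_inv S) = matrix_inv S"
    using S by (auto simp: pdef_def pdef_matrix_inv_sym)
  have S': "pdef (S + outer v)" by (rule pdef_add_psd[OF S psd_outer])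
  have y: "y = S *v u + k *\<^sub>R v"
    using matrix_inv_vector_cancel(1)[OF pdef_invertible[OF S'], of y]
    by (simp add: u_def k_def matrix_vector_mult_add_rdistrib outer_mult)
  have c: "matrix_inv S *v (S *v u) = u"
    by (rule matrix_inv_vector_cancel(2)[OF pdef_invertible[OF S]])
  have d: "(S *v u) \<bullet> (matrix_inv S *v v) = u \<bullet> v"
    by (metis c inner_matrix_vector isym)
  have k: "u \<bullet> v = k" by (simp add: k_def u_def inner_commute)
  have e: "y - w *\<^sub>R v = S *v u - (w - k) *\<^sub>R v"
    by (subst y) (simp add: scaleR_left_diff_distrib)
  have "qform S (y - w *\<^sub>R v) = (S *v u) \<bullet> u - 2 * (w - k) * k + (w - k)\<^sup>2 * qform S v"
    using k by (simp add: e qform_def matrix_vector_mult_diff_distrib matrix_vector_mult_scaleR inner_diff_left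
        inner_diff_right c d power2_eq_square inner_commute[of v u] algebra_simps)
  moreover have "qform (S + outer v) y = (S *v u) \<bullet> u + k\<^sup>2"
  proof -
    have "qform (S + outer v) y = y \<bullet> u" by (simp add: qform_def u_def)
    also have "\<dots> = (S *v u) \<bullet> u + k * (v \<bullet> u)" by (subst y) (simp add: inner_add_left)
    finally show ?thesis using k by (simp add: inner_commute power2_eq_square)
  qed
  ultimately show ?thesis by (simp add: power2_eq_square algebra_simps)
qed

lemma nn_integral_lborel_shift:
  fixes c :: "'a::euclidean_space"
  assumes [measurable]: "f \<in> borel_measurable borel"
  shows "(\<integral>\<^sup>+y. f (y + c) \<partial>lborel) = (\<integral>\<^sup>+y. f y \<partial>lborel)"
proof -
  have "(\<integral>\<^sup>+y. f y \<partial>lborel) = (\<integral>\<^sup>+y. f y \<partial>distr lborel borel ((+) c))" by (simp add: lborel_distr_plus)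
  then show ?thesis by (simp add: nn_integral_distr add.commute)
qed

lemma nn_integral_lborel_reflect:
  fixes c :: "'a::euclidean_space"
  assumes [measurable]: "f \<in> borel_measurable borel"
  shows "(\<integral>\<^sup>+y. f (c - y) \<partial>lborel) = (\<integral>\<^sup>+y. f y \<partial>lborel)"
proof -
  have "(\<integral>\<^sup>+y. f y \<partial>lborel) = (\<integral>\<^sup>+y. f y \<partial>density (distr lborel borel (\<lambda>x. c + (-1) *\<^sub>R x)) (\<lambda>_. \<bar>-1::real\<bar>^DIM('a)))"
    by (subst lborel_affine[of "-1" c]) simp_all
  then show ?thesis by (simp add: nn_integral_distr density_1)
qed

lemma nn_integral_gauss_1d:
  assumes "s > 0"
  shows "(\<integral>\<^sup>+w. ennreal (exp (- (s * (w - k)\<^sup>2) / 2)) \<partial>lborel) = ennreal (sqrt (2 * pi / s))"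
proof -
  have "exp (- (s * (w - k)\<^sup>2) / 2) = sqrt (2 * pi / s) * normal_density k (1 / sqrt s) w" for w
    using assms by (simp add: normal_density_def real_sqrt_divide real_sqrt_mult power_divide field_simps)
  then have "(\<integral>\<^sup>+w. ennreal (exp (- (s * (w - k)\<^sup>2) / 2)) \<partial>lborel) =
      ennreal (sqrt (2 * pi / s)) * (\<integral>\<^sup>+w. ennreal (normal_density k (1 / sqrt s) w) \<partial>lborel)"
    using assms by (simp add: ennreal_mult normal_density_nonneg nn_integral_cmult)
  also have "(\<integral>\<^sup>+w. ennreal (normal_density k (1 / sqrt s) w) \<partial>lborel) = 1"
    using assms by (subst nn_integral_eq_integral) (auto simp: normal_density_nonneg)
  finally show ?thesis by simp
qed

text \<open>The double integral of exp(-(w^2 + qform S (y - w v))/2) is evaluated in both orders.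
  Integrating over \<open>y\<close> before \<open>w\<close> gives a product by translation
  invariance; integrating over \<open>w\<close> before \<open>y\<close> leaves a one-dimensional
  Gaussian after completing the square.\<close>

lemma nn_integral_qform_outer:
  fixes S :: "real^'n^'n"
  assumes S: "pdef S"
  shows "(\<integral>\<^sup>+y. ennreal (exp (- qform (S + outer v) y / 2)) \<partial>lborel) =
    ennreal (sqrt (1 + qform S v)) * (\<integral>\<^sup>+y. ennreal (exp (- qform S y / 2)) \<partial>lborel)"
proof -
  define s where "s = 1 + qform S v"
  have "0 \<le> qform S v"
  proof -
    define x where "x = matrix_inv S *v v"
    have "qform S v = x \<bullet> (S *v x)"
      by (simp add: qform_def x_def matrix_inv_vector_cancel[OF pdef_invertible[OF S]] inner_commute)
    then show ?thesis using pdef_imp_psd[OF S] by (simp add: psd_def)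
  qed
  then have s: "s > 0" by (simp add: s_def)
  let ?N = "\<lambda>S :: real^'n^'n. \<integral>\<^sup>+y. ennreal (exp (- qform S y / 2)) \<partial>lborel"
  have "ennreal (sqrt (2 * pi)) * ?N S = (\<integral>\<^sup>+w. ennreal (exp (- (w\<^sup>2) / 2)) * ?N S \<partial>lborel)"
    using nn_integral_gauss_1d[of 1 0] by (simp add: nn_integral_multc)
  also have "\<dots> = (\<integral>\<^sup>+w. ennreal (exp (- (w\<^sup>2) / 2)) * (\<integral>\<^sup>+y. ennreal (exp (- qform S (y + (- w *\<^sub>R v)) / 2)) \<partial>lborel) \<partial>lborel)"
    by (subst nn_integral_lborel_shift) auto
  also have "\<dots> = (\<integral>\<^sup>+w. \<integral>\<^sup>+y. ennreal (exp (- (w\<^sup>2) / 2)) * ennreal (exp (- qform S (y + (- w *\<^sub>R v)) / 2)) \<partial>lborel \<partial>lborel)"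
    by (subst nn_integral_cmult) auto
  also have "\<dots> = (\<integral>\<^sup>+y. \<integral>\<^sup>+w. ennreal (exp (- (w\<^sup>2) / 2)) * ennreal (exp (- qform S (y + (- w *\<^sub>R v)) / 2)) \<partial>lborel \<partial>lborel)"
    by (rule lborel_pair.Fubini') measurable
  also have "\<dots> = (\<integral>\<^sup>+y. \<integral>\<^sup>+w. ennreal (exp (- qform (S + outer v) y / 2)) *
      ennreal (exp (- (s * (w - v \<bullet> (matrix_inv (S + outer v) *v y))\<^sup>2) / 2)) \<partial>lborel \<partial>lborel)"
  proof (intro nn_integral_cong)
    fix y w
    have "exp (- (w\<^sup>2) / 2) * exp (- qform S (y + (- w *\<^sub>R v)) / 2) =
      exp (- qform (S + outer v) y / 2) * exp (- (s * (w - v \<bullet> (matrix_inv (S + outer v) *v y))\<^sup>2) / 2)"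
      using complete_square_rank_one[OF S, of w y v] by (simp add: exp_add[symmetric] s_def field_simps)
    then show "ennreal (exp (- (w\<^sup>2) / 2)) * ennreal (exp (- qform S (y + (- w *\<^sub>R v)) / 2)) =
      ennreal (exp (- qform (S + outer v) y / 2)) * ennreal (exp (- (s * (w - v \<bullet> (matrix_inv (S + outer v) *v y))\<^sup>2) / 2))"
      by (simp only: ennreal_mult[symmetric] exp_ge_zero)
  qed
  also have "\<dots> = (\<integral>\<^sup>+y. ennreal (exp (- qform (S + outer v) y / 2)) * ennreal (sqrt (2 * pi / s)) \<partial>lborel)"
    by (subst nn_integral_cmult, measurable) (simp only: nn_integral_gauss_1d[OF s])
  also have "\<dots> = ennreal (sqrt (2 * pi / s)) * ?N (S + outer v)"
    by (subst nn_integral_multc) (auto simp: mult.commute)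
  finally have e: "ennreal (sqrt (2 * pi)) * ?N S = ennreal (sqrt (2 * pi / s)) * ?N (S + outer v)" .
  have "ennreal (sqrt s / sqrt (2 * pi)) * (ennreal (sqrt (2 * pi)) * ?N S) =
      ennreal (sqrt s / sqrt (2 * pi)) * (ennreal (sqrt (2 * pi / s)) * ?N (S + outer v))"
    by (simp only: e)
  then show ?thesis
    using s by (simp add: mult.assoc[symmetric] ennreal_mult[symmetric] real_sqrt_divide s_def)
qed

section \<open>Gaussian densities: normalisation and convolution\<close>

definition gdens :: "real^'n^'n \<Rightarrow> real^'n \<Rightarrow> real" where
  "gdens S y = (1 / sqrt (2 * pi)) ^ CARD('n) * (1 / sqrt (det S)) * exp (- qform S y / 2)"

lemma gdens_measurable [measurable]: "gdens S \<in> borel_measurable borel"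
  unfolding gdens_def by measurable

lemma gdens_mat_1: "gdens (mat 1) = phi"
  by (rule ext) (simp add: gdens_def phi_eq)

lemma gdens_pos: "pdef S \<Longrightarrow> 0 < gdens S y"
  by (simp add: gdens_def pdef_det_pos)

text \<open>Induction over the rank-one terms of \<open>T\<close>, starting from \<open>phi\<close>.
  Each term multiplies the integral of the exponential and the square root of the determinant by the
  same factor \<open>sqrt q\<close>.\<close>

lemma nn_integral_gdens:
  fixes S :: "real^'n^'n"
  assumes "psd T" and S: "S = mat 1 + T"
  shows "(\<integral>\<^sup>+y. gdens S y \<partial>lborel) = 1"
proof -
  obtain v :: "'n \<Rightarrow> real^'n" where v: "T = (\<Sum>k\<in>UNIV. outer (v k))"
    using psd_sum_outer[OF finite[of UNIV] \<open>psd T\<close>] by fastforce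
  have "pdef (mat 1 + (\<Sum>k\<in>K. outer (v k))) \<and> (\<integral>\<^sup>+y. gdens (mat 1 + (\<Sum>k\<in>K. outer (v k))) y \<partial>lborel) = 1" for K
  proof (induction K rule: infinite_finite_induct)
    case (insert k K)
    define S where "S = mat 1 + (\<Sum>k\<in>K. outer (v k))"
    have p: "pdef S" and i: "(\<integral>\<^sup>+y. gdens S y \<partial>lborel) = 1" using insert.IH by (auto simp: S_def)
    have p': "pdef (S + outer (v k))" by (rule pdef_add_psd[OF p psd_outer])
    define q where "q = 1 + qform S (v k)"
    have d: "det (S + outer (v k)) = det S * q"
      by (simp add: det_plus_outer[OF pdef_invertible[OF p]] q_def qform_def)
    have q: "q > 0" using pdef_det_pos[OF p'] pdef_det_pos[OF p] by (simp add: d zero_less_mult_iff)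
    let ?c = "(1 / sqrt (2 * pi)) ^ CARD('n)"
    have g: "(\<integral>\<^sup>+y. gdens S y \<partial>lborel) = ennreal (?c * (1 / sqrt (det S))) * (\<integral>\<^sup>+y. ennreal (exp (- qform S y / 2)) \<partial>lborel)"
      if "pdef S" for S :: "real^'n^'n"
    proof -
      have "ennreal (gdens S y) = ennreal (?c * (1 / sqrt (det S))) * ennreal (exp (- qform S y / 2))" for y
        unfolding gdens_def by (rule ennreal_mult) (use pdef_det_pos[OF that] in auto)
      then show ?thesis by (simp only:) (rule nn_integral_cmult, measurable)
    qed
    have "(\<integral>\<^sup>+y. gdens (S + outer (v k)) y \<partial>lborel) = 
        ennreal (?c * (1 / sqrt (det S * q))) * (ennreal (sqrt q) * (\<integral>\<^sup>+y. ennreal (exp (- qform S y / 2)) \<partial>lborel))"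
      unfolding g[OF p'] nn_integral_qform_outer[OF p] by (simp add: d q_def)
    also have "\<dots> = (\<integral>\<^sup>+y. gdens S y \<partial>lborel)"
      unfolding g[OF p] using q pdef_det_pos[OF p]
      by (simp add: mult.assoc[symmetric] ennreal_mult[symmetric] real_sqrt_mult)
    also have "S + outer (v k) = mat 1 + (\<Sum>k\<in>insert k K. outer (v k))"
      using insert.hyps by (simp add: S_def add_ac)
    finally show ?case using i p' insert.hyps by (simp add: S_def add_ac)
  qed (auto simp: gdens_mat_1 nn_integral_phi)
  from this[of UNIV] show ?thesis by (simp add: S v)
qed

text \<open>After completing the square the integral over \<open>w\<close> is a constant \<open>c\<close> by translation invariance.
  Integrating over \<open>y\<close> identifies \<open>c\<close> without the identity \<open>det (I + X Y) = det (I + Y X)\<close>.\<close>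

lemma gdens_convolution:
  fixes S A :: "real^'n^'n"
  assumes "psd T" and S: "S = mat 1 + T"
  shows "(\<integral>\<^sup>+w. ennreal (gdens S (y - A *v w)) \<partial>std_gaussian) = ennreal (gdens (S + A ** transpose A) y)"
proof -
  define S' where "S' = S + A ** transpose A"
  have p: "pdef S" unfolding S by (rule pdef_add_psd[OF pdef_mat_1 assms(1)])
  have p': "pdef S'" unfolding S'_def by (rule pdef_add_psd[OF p psd_gram])
  define F where "F v = ennreal ((1 / sqrt (2 * pi)) ^ CARD('n) * ((1 / sqrt (2 * pi)) ^ CARD('n) * (1 / sqrt (det S))) * 
     exp (- (v \<bullet> v + qform S (A *v v)) / 2))" for v
  have [measurable]: "F \<in> borel_measurable borel" unfolding F_def by measurable
  define c where "c = (\<integral>\<^sup>+v. F v \<partial>lborel)"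
  have conv: "(\<integral>\<^sup>+w. ennreal (gdens S (y - A *v w)) \<partial>std_gaussian) = c * ennreal (exp (- qform S' y / 2))" for y
  proof -
    have "(\<integral>\<^sup>+w. ennreal (gdens S (y - A *v w)) \<partial>std_gaussian) = (\<integral>\<^sup>+w. phi w * ennreal (gdens S (y - A *v w)) \<partial>lborel)"
      unfolding std_gaussian_phi by (subst nn_integral_density) auto
    also have "\<dots> = (\<integral>\<^sup>+w. F (w + (- (transpose A *v (matrix_inv S' *v y)))) * ennreal (exp (- qform S' y / 2)) \<partial>lborel)"
    proof (rule nn_integral_cong)
      fix w
      define v where "v = w - transpose A *v (matrix_inv S' *v y)"
      have e: "w \<bullet> w + qform S (y - A *v w) = qform S' y + (v \<bullet> v + qform S (A *v v))"
        using complete_square[OF p p'[unfolded S'_def], of w y] unfolding v_def S'_def by simp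
      have "exp (- (w \<bullet> w) / 2) * exp (- qform S (y - A *v w) / 2) =
          exp (- (v \<bullet> v + qform S (A *v v)) / 2) * exp (- qform S' y / 2)"
        using e by (simp add: exp_add[symmetric] field_simps)
      then have "phi w * gdens S (y - A *v w) = (1 / sqrt (2 * pi)) ^ CARD('n) * ((1 / sqrt (2 * pi)) ^ CARD('n) * (1 / sqrt (det S))) * 
         exp (- (v \<bullet> v + qform S (A *v v)) / 2) * exp (- qform S' y / 2)"
        by (simp add: phi_eq gdens_def mult_ac) 
      then show "phi w * ennreal (gdens S (y - A *v w)) = F (w + (- (transpose A *v (matrix_inv S' *v y)))) * ennreal (exp (- qform S' y / 2))"
        using gdens_pos[OF p, of "y - A *v w"] phi_pos[of w] pdef_det_pos[OF p]
        unfolding F_def v_def[symmetric, unfolded diff_conv_add_uminus]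
        by (simp only: ennreal_mult[symmetric] less_imp_le) (subst ennreal_mult[symmetric]; simp)
    qed
    also have "\<dots> = (\<integral>\<^sup>+w. F (w + (- (transpose A *v (matrix_inv S' *v y)))) \<partial>lborel) * ennreal (exp (- qform S' y / 2))"
      by (rule nn_integral_multc) measurable
    also have "(\<integral>\<^sup>+w. F (w + (- (transpose A *v (matrix_inv S' *v y)))) \<partial>lborel) = c"
      unfolding c_def by (rule nn_integral_lborel_shift) measurable
    finally show ?thesis .
  qed
  let ?k = "(1 / sqrt (2 * pi)) ^ CARD('n) * (1 / sqrt (det S'))"
  have k: "?k > 0" using pdef_det_pos[OF p'] by simp
  have one: "ennreal ?k * (\<integral>\<^sup>+y. ennreal (exp (- qform S' y / 2)) \<partial>lborel) = 1"
  proof -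
    have "S' = mat 1 + (T + A ** transpose A)" by (simp add: S'_def S add_ac)
    then have "(\<integral>\<^sup>+y. gdens S' y \<partial>lborel) = 1"
      using nn_integral_gdens psd_add[OF assms(1) psd_gram[of A]] by blast
    then show ?thesis
    proof -
      assume i: "(\<integral>\<^sup>+y. gdens S' y \<partial>lborel) = 1"
      have "ennreal (gdens S' y) = ennreal ?k * ennreal (exp (- qform S' y / 2))" for y
        unfolding gdens_def by (rule ennreal_mult) (use k in auto)
      then have "(\<integral>\<^sup>+y. gdens S' y \<partial>lborel) = (\<integral>\<^sup>+y. ennreal ?k * ennreal (exp (- qform S' y / 2)) \<partial>lborel)"
        by (simp only:)
      also have "\<dots> = ennreal ?k * (\<integral>\<^sup>+y. ennreal (exp (- qform S' y / 2)) \<partial>lborel)"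
        by (rule nn_integral_cmult) measurable
      finally show ?thesis using i by simp
    qed
  qed
  have "c * (\<integral>\<^sup>+y. ennreal (exp (- qform S' y / 2)) \<partial>lborel) = (\<integral>\<^sup>+y. \<integral>\<^sup>+w. ennreal (gdens S (y - A *v w)) \<partial>std_gaussian \<partial>lborel)"
    unfolding conv by (subst nn_integral_cmult) auto
  also have "\<dots> = (\<integral>\<^sup>+w. \<integral>\<^sup>+y. ennreal (gdens S (y - A *v w)) \<partial>lborel \<partial>std_gaussian)"
    by (intro pair_sigma_finite.Fubini' pair_sigma_finite.intro sigma_finite_lborel prob_space_imp_sigma_finite
        prob_space_std_gaussian) measurable
  also have "\<dots> = (\<integral>\<^sup>+w. 1 \<partial>(std_gaussian :: (real^'n) measure))"
  proof (rule nn_integral_cong)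
    fix w
    have "(\<integral>\<^sup>+y. ennreal (gdens S (y + - (A *v w))) \<partial>lborel) = (\<integral>\<^sup>+y. ennreal (gdens S y) \<partial>lborel)"
      by (rule nn_integral_lborel_shift) measurable
    then show "(\<integral>\<^sup>+y. ennreal (gdens S (y - A *v w)) \<partial>lborel) = 1" using nn_integral_gdens[OF assms] by simp
  qed
  also have "\<dots> = 1" using prob_space.emeasure_space_1[OF prob_space_std_gaussian] by simp
  finally have "c * (\<integral>\<^sup>+y. ennreal (exp (- qform S' y / 2)) \<partial>lborel) = 1" .
  then have "ennreal ?k = ennreal ?k * (c * (\<integral>\<^sup>+y. ennreal (exp (- qform S' y / 2)) \<partial>lborel))"
    by simp
  also have "\<dots> = c * (ennreal ?k * (\<integral>\<^sup>+y. ennreal (exp (- qform S' y / 2)) \<partial>lborel))"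
    by (simp only: mult_ac)
  also have "\<dots> = c" by (simp only: one mult_1_right)
  finally have "c = ennreal ?k" by (rule sym)
  then have "(\<integral>\<^sup>+w. ennreal (gdens S (y - A *v w)) \<partial>std_gaussian) = ennreal ?k * ennreal (exp (- qform S' y / 2))"
    by (simp only: conv)
  also have "\<dots> = ennreal (gdens S' y)"
    unfolding gdens_def by (rule ennreal_mult[symmetric]) (use k in auto)
  finally show ?thesis by (simp only: S'_def)
qed

section \<open>Images of product measures and linear mixing of Gaussian vectors\<close>

lemma emeasure_distr_indicator:
  assumes "f \<in> measurable M N" "A \<in> sets N"
  shows "emeasure (distr M N f) A = (\<integral>\<^sup>+x. indicator A (f x) \<partial>M)"
  using assms by (subst nn_integral_indicator[symmetric], simp, subst nn_integral_distr) auto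

lemma distr_PiM_map:
  assumes I [simp]: "finite I" and M: "\<And>i. prob_space (M i)"
    and h [measurable]: "\<And>i. h i \<in> measurable (M i) (R i)"
  shows "distr (PiM I M) (PiM I R) (\<lambda>z. \<lambda>j\<in>I. h j (z j)) = PiM I (\<lambda>j. distr (M j) (R j) (h j))"
proof (rule product_sigma_finite.PiM_eqI)
  have P: "prob_space (distr (M j) (R j) (h j))" for j
    by (rule prob_space.prob_space_distr[OF M h])
  then show "product_sigma_finite (\<lambda>j. distr (M j) (R j) (h j))"
    by (simp add: product_sigma_finite_def prob_space_imp_sigma_finite)
  show "sets (distr (PiM I M) (PiM I R) (\<lambda>z. \<lambda>j\<in>I. h j (z j))) = sets (PiM I (\<lambda>j. distr (M j) (R j) (h j)))"
    by (simp cong: sets_PiM_cong)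
  fix A assume A: "\<And>i. i \<in> I \<Longrightarrow> A i \<in> sets (distr (M i) (R i) (h i))"
  then have [measurable]: "\<And>i. i \<in> I \<Longrightarrow> A i \<in> sets (R i)" by simp
  interpret product_sigma_finite M
    using M by (simp add: product_sigma_finite_def prob_space_imp_sigma_finite)
  have "emeasure (distr (PiM I M) (PiM I R) (\<lambda>z. \<lambda>j\<in>I. h j (z j))) (Pi\<^sub>E I A) =
      (\<integral>\<^sup>+z. indicator (Pi\<^sub>E I A) (\<lambda>j\<in>I. h j (z j)) \<partial>PiM I M)"
    by (rule emeasure_distr_indicator) (auto intro!: sets_PiM_I_finite)
  also have "\<dots> = (\<integral>\<^sup>+z. (\<Prod>j\<in>I. indicator (A j) (h j (z j))) \<partial>PiM I M)"
    by (intro nn_integral_cong, subst prod_indicator_PiE) auto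
  also have "\<dots> = (\<Prod>j\<in>I. \<integral>\<^sup>+z. indicator (A j) (h j z) \<partial>M j)"
    by (rule product_nn_integral_prod) auto
  also have "\<dots> = (\<Prod>j\<in>I. emeasure (distr (M j) (R j) (h j)) (A j))"
    by (intro prod.cong refl, subst emeasure_distr_indicator) auto
  finally show "emeasure (distr (PiM I M) (PiM I R) (\<lambda>z. \<lambda>j\<in>I. h j (z j))) (Pi\<^sub>E I A) = \<dots>" .
qed simp

text \<open>Carries the law of a combination of two independent variables over to blocks. It serves
  to mix channel noise with auxiliary noise in every channel use.\<close>

lemma distr_PiM_map2:
  assumes I [simp]: "finite I" and M: "\<And>i. prob_space (M i)" and N: "\<And>i. prob_space (N i)"
    and h [measurable]: "\<And>i. (\<lambda>(z, w). h i z w) \<in> measurable (M i \<Otimes>\<^sub>M N i) (R i)"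
  shows "distr (PiM I M \<Otimes>\<^sub>M PiM I N) (PiM I R) (\<lambda>(z, w). \<lambda>j\<in>I. h j (z j) (w j)) =
    PiM I (\<lambda>j. distr (M j \<Otimes>\<^sub>M N j) (R j) (\<lambda>(z, w). h j z w))"
proof (rule product_sigma_finite.PiM_eqI)
  have MN: "prob_space (M j \<Otimes>\<^sub>M N j)" for j
    using M N by (simp add: prob_space_pair)
  have P: "prob_space (distr (M j \<Otimes>\<^sub>M N j) (R j) (\<lambda>(z, w). h j z w))" for j
    by (rule prob_space.prob_space_distr[OF MN h])
  then show "product_sigma_finite (\<lambda>j. distr (M j \<Otimes>\<^sub>M N j) (R j) (\<lambda>(z, w). h j z w))"
    by (simp add: product_sigma_finite_def prob_space_imp_sigma_finite)
  show "sets (distr (PiM I M \<Otimes>\<^sub>M PiM I N) (PiM I R) (\<lambda>(z, w). \<lambda>j\<in>I. h j (z j) (w j))) =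
      sets (PiM I (\<lambda>j. distr (M j \<Otimes>\<^sub>M N j) (R j) (\<lambda>(z, w). h j z w)))"
    by (simp cong: sets_PiM_cong)
  fix A assume A: "\<And>i. i \<in> I \<Longrightarrow> A i \<in> sets (distr (M i \<Otimes>\<^sub>M N i) (R i) (\<lambda>(z, w). h i z w))"
  then have A' [measurable]: "\<And>i. i \<in> I \<Longrightarrow> A i \<in> sets (R i)" by simp
  interpret M: product_sigma_finite M
    using M by (simp add: product_sigma_finite_def prob_space_imp_sigma_finite)
  interpret N: product_sigma_finite N
    using N by (simp add: product_sigma_finite_def prob_space_imp_sigma_finite)
  interpret PN: sigma_finite_measure "PiM I N" by (rule N.sigma_finite) simp
  have [measurable]: "(\<lambda>(z, w). \<lambda>j\<in>I. h j (z j) (w j)) \<in> measurable (PiM I M \<Otimes>\<^sub>M PiM I N) (PiM I R)"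
    unfolding case_prod_beta
  proof (rule measurable_restrict)
    fix i assume [measurable]: "i \<in> I"
    have "(\<lambda>x. (fst x i, snd x i)) \<in> measurable (PiM I M \<Otimes>\<^sub>M PiM I N) (M i \<Otimes>\<^sub>M N i)"
      by measurable
    from measurable_compose[OF this h]
    show "(\<lambda>x. h i (fst x i) (snd x i)) \<in> measurable (PiM I M \<Otimes>\<^sub>M PiM I N) (R i)" by simp
  qed
  have PA: "Pi\<^sub>E I A \<in> sets (PiM I R)" by (rule sets_PiM_I_finite) (use A' in auto)
  have "emeasure (distr (PiM I M \<Otimes>\<^sub>M PiM I N) (PiM I R) (\<lambda>(z, w). \<lambda>j\<in>I. h j (z j) (w j))) (Pi\<^sub>E I A) =
      (\<integral>\<^sup>+x. indicator (Pi\<^sub>E I A) (\<lambda>j\<in>I. h j (fst x j) (snd x j)) \<partial>(PiM I M \<Otimes>\<^sub>M PiM I N))"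
    using PA by (subst emeasure_distr_indicator) (auto simp: case_prod_beta)
  also have "\<dots> = (\<integral>\<^sup>+z. \<integral>\<^sup>+w. indicator (Pi\<^sub>E I A) (\<lambda>j\<in>I. h j (z j) (w j)) \<partial>PiM I N \<partial>PiM I M)"
  proof -
    have "(\<lambda>x. indicator (Pi\<^sub>E I A) (\<lambda>j\<in>I. h j (fst x j) (snd x j)) :: ennreal) \<in> borel_measurable (PiM I M \<Otimes>\<^sub>M PiM I N)"
      using measurable_compose[OF \<open>(\<lambda>(z, w). \<lambda>j\<in>I. h j (z j) (w j)) \<in> _\<close> borel_measurable_indicator[OF PA]]
      by (simp add: case_prod_beta)
    from PN.nn_integral_fst[OF this] show ?thesis by simp
  qed
  also have "\<dots> = (\<integral>\<^sup>+z. \<integral>\<^sup>+w. (\<Prod>j\<in>I. indicator (A j) (h j (z j) (w j))) \<partial>PiM I N \<partial>PiM I M)"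
    by (intro nn_integral_cong, subst prod_indicator_PiE) auto
  also have "\<dots> = (\<integral>\<^sup>+z. (\<Prod>j\<in>I. \<integral>\<^sup>+w. indicator (A j) (h j (z j) w) \<partial>N j) \<partial>PiM I M)"
  proof (rule nn_integral_cong)
    fix z assume z: "z \<in> space (PiM I M)"
    have "(\<lambda>w. indicator (A j) (h j (z j) w) :: ennreal) \<in> borel_measurable (N j)" if "j \<in> I" for j
    proof -
      have "z j \<in> space (M j)" using z that by (auto simp: space_PiM)
      from measurable_compose[OF measurable_Pair1'[OF this] h]
      have "(\<lambda>w. h j (z j) w) \<in> measurable (N j) (R j)" by simp
      then show ?thesis using that by measurable
    qed
    then show "(\<integral>\<^sup>+w. (\<Prod>j\<in>I. indicator (A j) (h j (z j) (w j))) \<partial>PiM I N) = (\<Prod>j\<in>I. \<integral>\<^sup>+w. indicator (A j) (h j (z j) w) \<partial>N j)"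
      by (intro N.product_nn_integral_prod) auto
  qed
  also have "\<dots> = (\<Prod>j\<in>I. \<integral>\<^sup>+z. \<integral>\<^sup>+w. indicator (A j) (h j z w) \<partial>N j \<partial>M j)"
  proof (rule M.product_nn_integral_prod)
    fix j assume [measurable]: "j \<in> I"
    have m: "(\<lambda>x. indicator (A j) (h j (fst x) (snd x)) :: ennreal) \<in> borel_measurable (M j \<Otimes>\<^sub>M N j)"
      using measurable_compose[OF h[of j] borel_measurable_indicator[OF A'[OF \<open>j \<in> I\<close>]]] by (simp add: case_prod_beta)
    show "(\<lambda>z. \<integral>\<^sup>+w. indicator (A j) (h j z w) \<partial>N j) \<in> borel_measurable (M j)"
      using sigma_finite_measure.borel_measurable_nn_integral[OF N.sigma_finite_measures[of j], of "\<lambda>z w. indicator (A j) (h j z w)" "M j"] m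
      by (simp add: case_prod_beta')
  qed simp
  also have "\<dots> = (\<Prod>j\<in>I. emeasure (distr (M j \<Otimes>\<^sub>M N j) (R j) (\<lambda>(z, w). h j z w)) (A j))"
  proof (intro prod.cong refl)
    fix j assume [measurable]: "j \<in> I"
    have m: "(\<lambda>x. indicator (A j) (h j (fst x) (snd x)) :: ennreal) \<in> borel_measurable (M j \<Otimes>\<^sub>M N j)"
      using measurable_compose[OF h[of j] borel_measurable_indicator[OF A'[OF \<open>j \<in> I\<close>]]] by (simp add: case_prod_beta)
    have "emeasure (distr (M j \<Otimes>\<^sub>M N j) (R j) (\<lambda>(z, w). h j z w)) (A j) = 
      (\<integral>\<^sup>+x. indicator (A j) (h j (fst x) (snd x)) \<partial>(M j \<Otimes>\<^sub>M N j))"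
      using A'[OF \<open>j \<in> I\<close>] by (subst emeasure_distr_indicator) (auto simp: case_prod_beta)
    then show "(\<integral>\<^sup>+z. \<integral>\<^sup>+w. indicator (A j) (h j z w) \<partial>N j \<partial>M j) = emeasure (distr (M j \<Otimes>\<^sub>M N j) (R j) (\<lambda>(z, w). h j z w)) (A j)"
      using sigma_finite_measure.nn_integral_fst[OF N.sigma_finite_measures[of j] m] by simp
  qed
  finally show "emeasure (distr (PiM I M \<Otimes>\<^sub>M PiM I N) (PiM I R) (\<lambda>(z, w). \<lambda>j\<in>I. h j (z j) (w j))) (Pi\<^sub>E I A) = \<dots>" .
qed simp

lemma matrix_add_rdistrib: "(A + B) ** C = A ** C + B ** (C :: real^'n^'m)"
  by (simp add: matrix_matrix_mult_def vec_eq_iff sum.distrib distrib_right)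

text \<open>The Jacobian of \<open>K\<close> is never needed, only that some constant exists, so this follows from Fubini and
  translation invariance; \<^theory>\<open>HOL-Analysis.Change_Of_Vars\<close> covers only well-ordered index types.\<close>

lemma nn_integral_lborel_linear:
  fixes K :: "real^'n^'n"
  assumes K: "invertible K" and [measurable]: "g \<in> borel_measurable borel"
  shows "(\<integral>\<^sup>+z. g (K *v z) \<partial>lborel) = (\<integral>\<^sup>+z. ennreal (phi (K *v z)) \<partial>lborel) * (\<integral>\<^sup>+u. g u \<partial>lborel)"
proof -
  have "(\<integral>\<^sup>+z. g (K *v z) \<partial>lborel) = (\<integral>\<^sup>+x. ennreal (phi x) * (\<integral>\<^sup>+z. g (K *v z) \<partial>lborel) \<partial>(lborel :: (real^'n) measure))"
    by (subst nn_integral_multc) (auto simp: nn_integral_phi)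
  also have "\<dots> = (\<integral>\<^sup>+x. ennreal (phi x) * (\<integral>\<^sup>+z. g (K *v z + x) \<partial>lborel) \<partial>lborel)"
  proof (rule nn_integral_cong)
    fix x
    have "(\<integral>\<^sup>+z. g (K *v z) \<partial>lborel) = (\<integral>\<^sup>+z. g (K *v (z + matrix_inv K *v x)) \<partial>lborel)"
      by (rule nn_integral_lborel_shift[symmetric]) measurable
    also have "\<dots> = (\<integral>\<^sup>+z. g (K *v z + x) \<partial>lborel)"
      by (simp add: matrix_vector_right_distrib matrix_inv_vector_cancel[OF K])
    finally show "ennreal (phi x) * (\<integral>\<^sup>+z. g (K *v z) \<partial>lborel) = ennreal (phi x) * (\<integral>\<^sup>+z. g (K *v z + x) \<partial>lborel)" 
      by (simp only:)
  qed
  also have "\<dots> = (\<integral>\<^sup>+x. \<integral>\<^sup>+z. ennreal (phi x) * g (K *v z + x) \<partial>lborel \<partial>lborel)"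
    by (subst nn_integral_cmult) auto
  also have "\<dots> = (\<integral>\<^sup>+z. \<integral>\<^sup>+x. ennreal (phi x) * g (K *v z + x) \<partial>lborel \<partial>lborel)"
    by (rule lborel_pair.Fubini') measurable
  also have "\<dots> = (\<integral>\<^sup>+z. \<integral>\<^sup>+x. ennreal (phi (x - K *v z)) * g x \<partial>lborel \<partial>lborel)"
  proof (rule nn_integral_cong)
    fix z
    have "(\<integral>\<^sup>+x. ennreal (phi (x - K *v z)) * g x \<partial>lborel) = (\<integral>\<^sup>+x. ennreal (phi ((x + K *v z) - K *v z)) * g (x + K *v z) \<partial>lborel)"
      by (rule nn_integral_lborel_shift[symmetric]) measurable
    then show "(\<integral>\<^sup>+x. ennreal (phi x) * g (K *v z + x) \<partial>lborel) = (\<integral>\<^sup>+x. ennreal (phi (x - K *v z)) * g x \<partial>lborel)"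
      by (simp add: add.commute)
  qed
  also have "\<dots> = (\<integral>\<^sup>+x. \<integral>\<^sup>+z. ennreal (phi (x - K *v z)) * g x \<partial>lborel \<partial>lborel)"
    by (rule lborel_pair.Fubini') measurable
  also have "\<dots> = (\<integral>\<^sup>+x. (\<integral>\<^sup>+z. ennreal (phi (K *v z)) \<partial>lborel) * g x \<partial>lborel)"
  proof (rule nn_integral_cong)
    fix x
    have "(\<integral>\<^sup>+z. ennreal (phi (K *v (matrix_inv K *v x - z))) \<partial>lborel) = (\<integral>\<^sup>+z. ennreal (phi (K *v z)) \<partial>lborel)"
      by (rule nn_integral_lborel_reflect) measurable
    then have "(\<integral>\<^sup>+z. ennreal (phi (x - K *v z)) \<partial>lborel) = (\<integral>\<^sup>+z. ennreal (phi (K *v z)) \<partial>lborel)"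
      by (simp add: matrix_vector_mult_diff_distrib matrix_inv_vector_cancel[OF K])
    then show "(\<integral>\<^sup>+z. ennreal (phi (x - K *v z)) * g x \<partial>lborel) = (\<integral>\<^sup>+z. ennreal (phi (K *v z)) \<partial>lborel) * g x"
      by (subst nn_integral_multc) auto
  qed
  also have "\<dots> = (\<integral>\<^sup>+z. ennreal (phi (K *v z)) \<partial>lborel) * (\<integral>\<^sup>+u. g u \<partial>lborel)"
    by (rule nn_integral_cmult) measurable
  finally show ?thesis .
qed

lemma nn_integral_std_gaussian:
  "f \<in> borel_measurable borel \<Longrightarrow> (\<integral>\<^sup>+z. f z \<partial>std_gaussian) = (\<integral>\<^sup>+z. ennreal (phi z) * f z \<partial>lborel)"
  unfolding std_gaussian_phi by (rule nn_integral_density) measurable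

text \<open>With \<open>z\<close> and \<open>w\<close> independent and standard,
  \<open>K *v z + L *v w\<close> has covariance \<open>K ** transpose K + L ** transpose L\<close>,
  the identity. Substituting u = K z + L w for \<open>z\<close> leaves an average over
  \<open>w\<close> of \<open>phi (Ki *v u - A *v w)\<close>, which \<open>gdens_convolution\<close>
  evaluates. The resulting covariance \<open>S\<close> is the inverse of
  \<open>transpose K ** K\<close>, so the density at \<open>Ki *v u\<close> is a multiple of
  \<open>phi u\<close>.\<close>

lemma nn_integral_std_gaussian_mix:
  fixes K L :: "real^'n^'n"
  assumes K: "invertible K" and KL: "K ** transpose K + L ** transpose L = mat 1"
    and [measurable]: "f \<in> borel_measurable borel"
  shows "(\<integral>\<^sup>+w. \<integral>\<^sup>+z. f (K *v z + L *v w) \<partial>std_gaussian \<partial>std_gaussian) = (\<integral>\<^sup>+u. f u \<partial>std_gaussian)"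
proof -
  define Ki where "Ki = matrix_inv K"
  define A where "A = Ki ** L"
  define c where "c = (\<integral>\<^sup>+z. ennreal (phi (K *v z)) \<partial>lborel)"
  have KKi: "K *v (Ki *v x) = x" "Ki *v (K *v x) = x" for x
    unfolding Ki_def by (simp_all add: matrix_inv_vector_cancel[OF K])
  define S where "S = mat 1 + A ** transpose A"
  have S: "S ** (transpose K ** K) = mat 1"
  proof -
    have "mat 1 = Ki ** (K ** transpose K) ** transpose Ki"
      by (metis Ki_def K matrix_inv_cancel(2) matrix_mul_assoc matrix_mul_lid matrix_transpose_mul transpose_mat)
    then have "S = Ki ** (K ** transpose K + L ** transpose L) ** transpose Ki"
      by (simp add: S_def A_def matrix_transpose_mul matrix_add_ldistrib matrix_add_rdistrib matrix_mul_assoc)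
    then have "S = Ki ** transpose Ki" by (simp add: KL)
    then show ?thesis
      by (metis Ki_def K matrix_inv_cancel(2) matrix_mul_assoc matrix_mul_lid matrix_transpose_mul transpose_mat
          matrix_inv_cancel(1) matrix_mul_rid)
  qed
  have "pdef S" unfolding S_def by (intro pdef_add_psd pdef_mat_1 psd_gram)
  then have inv: "matrix_inv S = transpose K ** K"
    by (intro matrix_inv_unique[symmetric] S pdef_invertible)
  have q: "qform S (Ki *v u) = u \<bullet> u" for u
    by (simp add: qform_def inv matrix_vector_mul_assoc[symmetric] KKi inner_matrix_vector[of _ "transpose K"])
  define D where "D = 1 / sqrt (det S)"
  have D: "gdens S (Ki *v u) = D * phi u" for u
    by (simp add: gdens_def q D_def phi_eq)
  have Dpos: "D > 0" using pdef_det_pos[OF \<open>pdef S\<close>] by (simp add: D_def)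
  have mix: "(\<integral>\<^sup>+w. \<integral>\<^sup>+z. f (K *v z + L *v w) \<partial>std_gaussian \<partial>std_gaussian) = c * ennreal D * (\<integral>\<^sup>+u. f u \<partial>std_gaussian)"
    if [measurable]: "f \<in> borel_measurable borel" for f
  proof -
    have "(\<integral>\<^sup>+w. \<integral>\<^sup>+z. f (K *v z + L *v w) \<partial>std_gaussian \<partial>std_gaussian) =
       (\<integral>\<^sup>+w. (c * (\<integral>\<^sup>+u. ennreal (phi (Ki *v u - A *v w)) * f u \<partial>lborel)) \<partial>std_gaussian)"
    proof (rule nn_integral_cong)
      fix w
      have "(\<integral>\<^sup>+z. f (K *v z + L *v w) \<partial>std_gaussian) = (\<integral>\<^sup>+z. ennreal (phi (Ki *v (K *v z))) * f (K *v z + L *v w) \<partial>lborel)"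
        by (simp add: nn_integral_std_gaussian KKi)
      also have "\<dots> = c * (\<integral>\<^sup>+u. ennreal (phi (Ki *v u)) * f (u + L *v w) \<partial>lborel)"
        unfolding c_def by (rule nn_integral_lborel_linear[OF K]) measurable
      also have "(\<integral>\<^sup>+u. ennreal (phi (Ki *v u)) * f (u + L *v w) \<partial>lborel) =
          (\<integral>\<^sup>+u. ennreal (phi (Ki *v (u + L *v w) - A *v w)) * f (u + L *v w) \<partial>lborel)"
        by (simp add: A_def matrix_vector_right_distrib matrix_vector_mul_assoc)
      also have "\<dots> = (\<integral>\<^sup>+u. ennreal (phi (Ki *v u - A *v w)) * f u \<partial>lborel)"
        by (rule nn_integral_lborel_shift) measurable
      finally show "(\<integral>\<^sup>+z. f (K *v z + L *v w) \<partial>std_gaussian) = c * (\<integral>\<^sup>+u. ennreal (phi (Ki *v u - A *v w)) * f u \<partial>lborel)" .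
    qed
    also have "\<dots> = c * (\<integral>\<^sup>+w. (\<integral>\<^sup>+u. ennreal (phi (Ki *v u - A *v w)) * f u \<partial>lborel) \<partial>std_gaussian)"
      by (rule nn_integral_cmult) measurable
    also have "(\<integral>\<^sup>+w. (\<integral>\<^sup>+u. ennreal (phi (Ki *v u - A *v w)) * f u \<partial>lborel) \<partial>std_gaussian) =
       (\<integral>\<^sup>+u. (\<integral>\<^sup>+w. ennreal (phi (Ki *v u - A *v w)) * f u \<partial>std_gaussian) \<partial>lborel)"
      by (intro pair_sigma_finite.Fubini' pair_sigma_finite.intro sigma_finite_lborel prob_space_imp_sigma_finite
        prob_space_std_gaussian) measurable
    also have "\<dots> = (\<integral>\<^sup>+u. ennreal D * (ennreal (phi u) * f u) \<partial>lborel)"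
    proof (rule nn_integral_cong)
      fix u
      have "(\<integral>\<^sup>+w. ennreal (phi (Ki *v u - A *v w)) * f u \<partial>std_gaussian) = (\<integral>\<^sup>+w. ennreal (gdens (mat 1) (Ki *v u - A *v w)) \<partial>std_gaussian) * f u"
        unfolding gdens_mat_1 by (rule nn_integral_multc) measurable
      also have "\<dots> = ennreal (gdens S (Ki *v u)) * f u"
        using gdens_convolution[of 0 "mat 1" "Ki *v u" A] by (simp add: S_def)
      also have "\<dots> = ennreal D * (ennreal (phi u) * f u)"
        using Dpos phi_pos[of u] by (simp add: D ennreal_mult mult.assoc)
      finally show "(\<integral>\<^sup>+w. ennreal (phi (Ki *v u - A *v w)) * f u \<partial>std_gaussian) = ennreal D * (ennreal (phi u) * f u)" .
    qed
    also have "\<dots> = ennreal D * (\<integral>\<^sup>+u. f u \<partial>std_gaussian)"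
      by (subst nn_integral_cmult) (auto simp: nn_integral_std_gaussian)
    finally show ?thesis by (simp add: mult.assoc)
  qed
  have 1: "(\<integral>\<^sup>+z. 1 \<partial>(std_gaussian :: (real^'n) measure)) = 1"
    using prob_space.emeasure_space_1[OF prob_space_std_gaussian] by simp
  \<comment> \<open>The Jacobian \<open>c\<close> and the determinant factor \<open>D\<close> are
    identified together by testing the formula on the constant function 1.\<close>
  have "c * ennreal D = 1"
    using mix[of "\<lambda>_. 1"] by (simp only: 1) simp
  then show ?thesis using mix[of f] by simp
qed

lemma distr_std_gaussian_mix:
  fixes K L :: "real^'n^'n"
  assumes K: "invertible K" and KL: "K ** transpose K + L ** transpose L = mat 1"
  shows "distr (std_gaussian \<Otimes>\<^sub>M std_gaussian) borel (\<lambda>(z, w). K *v z + L *v w) = std_gaussian"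
proof (rule measure_eqI)
  fix X assume "X \<in> sets (distr (std_gaussian \<Otimes>\<^sub>M std_gaussian) borel (\<lambda>(z, w). K *v z + L *v w))"
  then have [measurable]: "X \<in> sets borel" by simp
  interpret G: pair_sigma_finite "std_gaussian :: (real^'n) measure" "std_gaussian :: (real^'n) measure"
    by (intro pair_sigma_finite.intro prob_space_imp_sigma_finite prob_space_std_gaussian)
  have "emeasure (distr (std_gaussian \<Otimes>\<^sub>M std_gaussian) borel (\<lambda>(z, w). K *v z + L *v w)) X =
      (\<integral>\<^sup>+x. indicator X (K *v fst x + L *v snd x) \<partial>(std_gaussian \<Otimes>\<^sub>M std_gaussian))"
    by (subst emeasure_distr_indicator) (auto simp: case_prod_beta)
  also have "\<dots> = (\<integral>\<^sup>+w. \<integral>\<^sup>+z. indicator X (K *v z + L *v w) \<partial>std_gaussian \<partial>std_gaussian)"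
    by (subst G.nn_integral_snd[symmetric]) auto
  also have "\<dots> = emeasure std_gaussian X"
    by (subst nn_integral_std_gaussian_mix[OF assms]) auto
  finally show "emeasure (distr (std_gaussian \<Otimes>\<^sub>M std_gaussian) borel (\<lambda>(z, w). K *v z + L *v w)) X = emeasure std_gaussian X" .
qed simp

section \<open>Converse\<close>

abbreviation gblock :: "nat \<Rightarrow> (nat \<Rightarrow> real^'n) measure" where
  "gblock n \<equiv> PiM {..<n} (\<lambda>_. std_gaussian)"

lemma prob_space_gblock: "prob_space (gblock n :: (nat \<Rightarrow> real^'n) measure)"
  by (intro prob_space_PiM) simp

lemma sets_gblock [measurable_cong]: "sets (gblock n) = sets (PiM {..<n} (\<lambda>_. borel))"
  by (intro sets_PiM_cong) auto

lemma has_bochner_integral_PiM_component: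
  fixes f :: "'a \<Rightarrow> real"
  assumes "prob_space M" "j \<in> I" and f: "has_bochner_integral M f c"
  shows "has_bochner_integral (PiM I (\<lambda>_. M)) (\<lambda>z. f (z j)) c"
proof -
  have [measurable]: "f \<in> borel_measurable M" using f by (rule borel_measurable_has_bochner_integral)
  have D: "distr (PiM I (\<lambda>_. M)) M (\<lambda>z. z j) = M"
    using distr_PiM_component[of I "\<lambda>_. M" j] assms by simp
  have m: "(\<lambda>z. z j) \<in> measurable (PiM I (\<lambda>_. M)) M" using assms(2) by measurable
  have "integrable (distr (PiM I (\<lambda>_. M)) M (\<lambda>z. z j)) f" "(\<integral>x. f x \<partial>distr (PiM I (\<lambda>_. M)) M (\<lambda>z. z j)) = c"
    unfolding D using f by (auto simp: has_bochner_integral_iff)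
  then show ?thesis
    using m by (simp add: has_bochner_integral_iff integrable_distr_eq integral_distr)
qed

section \<open>Change of measure to a Gaussian reference law\<close>

lemma trace_mult_outer: "trace (A ** outer v) = v \<bullet> (A *v v)" for A :: "real^'n^'n"
  by (simp add: trace_def outer_def matrix_matrix_mult_def matrix_vector_mult_def inner_vec_def sum_distrib_left mult_ac)

lemma trace_scaleR: "trace (c *\<^sub>R A) = c * trace A" for A :: "real^'n^'n"
  by (simp add: trace_def sum_distrib_left)

lemma trace_sum: "trace (\<Sum>k\<in>K. A k) = (\<Sum>k\<in>K. trace (A k))" for A :: "'k \<Rightarrow> real^'n^'n"
  by (induction K rule: infinite_finite_induct) (auto simp: trace_add trace_def sum.distrib)

lemma matrix_mult_sum_right: "A ** (\<Sum>k\<in>K. B k) = (\<Sum>k\<in>K. A ** B k)" for B :: "'k \<Rightarrow> real^'n^'n"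
  by (induction K rule: infinite_finite_induct) (auto simp: matrix_add_ldistrib)

text \<open>The likelihood ratio of the reference law N(0, S) against the true output law N(d, I) at
  the output \<open>z + d\<close>, as a function of the noise \<open>z\<close>.\<close>

definition tilt :: "real^'n^'n \<Rightarrow> real^'n \<Rightarrow> real^'n \<Rightarrow> real" where
  "tilt S d z = gdens S (z + d) / phi z"

lemma tilt_measurable [measurable]: "tilt S d \<in> borel_measurable borel"
  unfolding tilt_def by measurable

lemma tilt_pos: "pdef S \<Longrightarrow> 0 < tilt S d z"
  by (simp add: tilt_def gdens_pos phi_pos)

lemma ln_tilt:
  fixes S :: "real^'n^'n"
  assumes "pdef S"
  shows "ln (tilt S d z) = (z \<bullet> z - qform S (z + d) - ln (det S)) / 2"
  using pdef_det_pos[OF assms]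
  by (simp add: tilt_def gdens_def phi_eq ln_div ln_mult ln_sqrt field_simps)

lemma distr_tilt:
  fixes S :: "real^'n^'n"
  assumes S: "pdef S"
  shows "distr (density std_gaussian (tilt S d)) borel (\<lambda>z. z + d) = density lborel (gdens S)"
proof (rule measure_eqI)
  fix X assume "X \<in> sets (distr (density std_gaussian (tilt S d)) borel (\<lambda>z. z + d))"
  then have [measurable]: "X \<in> sets borel" by simp
  have "emeasure (distr (density std_gaussian (tilt S d)) borel (\<lambda>z. z + d)) X =
      (\<integral>\<^sup>+z. indicator X (z + d) \<partial>density std_gaussian (tilt S d))"
    by (rule emeasure_distr_indicator) auto
  also have "\<dots> = (\<integral>\<^sup>+z. ennreal (tilt S d z) * indicator X (z + d) \<partial>std_gaussian)"
    by (subst nn_integral_density) auto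
  also have "\<dots> = (\<integral>\<^sup>+z. ennreal (phi z) * (ennreal (tilt S d z) * indicator X (z + d)) \<partial>lborel)"
    by (rule nn_integral_std_gaussian) measurable
  also have "\<dots> = (\<integral>\<^sup>+z. ennreal (gdens S (z + d)) * indicator X (z + d) \<partial>lborel)"
  proof (rule nn_integral_cong)
    fix z
    have "ennreal (phi z) * ennreal (tilt S d z) = ennreal (gdens S (z + d))"
      using phi_pos[of z] tilt_pos[OF S, of d z]
      by (subst ennreal_mult[symmetric]) (simp_all add: tilt_def)
    then show "ennreal (phi z) * (ennreal (tilt S d z) * indicator X (z + d)) = ennreal (gdens S (z + d)) * indicator X (z + d)"
      by (simp add: mult.assoc[symmetric])
  qed
  also have "\<dots> = (\<integral>\<^sup>+z. ennreal (gdens S z) * indicator X z \<partial>lborel)"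
    by (rule nn_integral_lborel_shift) measurable
  also have "\<dots> = emeasure (density lborel (gdens S)) X"
    by (rule emeasure_density[symmetric]) auto
  finally show "emeasure (distr (density std_gaussian (tilt S d)) borel (\<lambda>z. z + d)) X = emeasure (density lborel (gdens S)) X" .
qed simp

lemma prob_space_gdens: "psd T \<Longrightarrow> prob_space (density lborel (gdens (mat 1 + T)))"
  by (rule prob_spaceI) (simp add: emeasure_density nn_integral_gdens)

lemma prob_space_tilt:
  fixes T :: "real^'n^'n"
  assumes "psd T"
  shows "prob_space (density std_gaussian (tilt (mat 1 + T) d))"
proof (rule prob_spaceI)
  have "emeasure (distr (density std_gaussian (tilt (mat 1 + T) d)) borel (\<lambda>z. z + d)) UNIV = 1"
    using distr_tilt[OF pdef_add_psd[OF pdef_mat_1 assms], of d] prob_space.emeasure_space_1[OF prob_space_gdens[OF assms]]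
    by simp
  then show "emeasure (density std_gaussian (tilt (mat 1 + T) d)) (space (density std_gaussian (tilt (mat 1 + T) d))) = 1"
    by (simp add: emeasure_distr)
qed

text \<open>The right side is free of the shifts \<open>d\<close>: whatever was sent, reweighting by
  the likelihood ratio leads to one and the same reference law.\<close>

lemma nn_integral_gblock_tilt:
  fixes T :: "real^'n^'n"
  assumes T: "psd T" and k [measurable]: "k \<in> borel_measurable (PiM {..<n} (\<lambda>_. borel))"
  shows "(\<integral>\<^sup>+z. (\<Prod>j<n. ennreal (tilt (mat 1 + T) (d j) (z j))) * k (\<lambda>j\<in>{..<n}. z j + d j) \<partial>gblock n) =
    (\<integral>\<^sup>+y. k y \<partial>PiM {..<n} (\<lambda>_. density lborel (gdens (mat 1 + T))))"
proof -
  let ?S = "mat 1 + T"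
  have S: "pdef ?S" by (rule pdef_add_psd[OF pdef_mat_1 T])
  have [measurable_cong]: "sets (PiM {..<n} (\<lambda>j. density std_gaussian (tilt ?S (d j)))) = sets (PiM {..<n} (\<lambda>_. borel))"
    by (intro sets_PiM_cong) auto
  have "PiM {..<n} (\<lambda>_. density lborel (gdens ?S)) =
      PiM {..<n} (\<lambda>j. distr (density std_gaussian (tilt ?S (d j))) borel (\<lambda>z. z + d j))"
    by (simp add: distr_tilt[OF S])
  also have "\<dots> = distr (PiM {..<n} (\<lambda>j. density std_gaussian (tilt ?S (d j)))) (PiM {..<n} (\<lambda>_. borel)) (\<lambda>z. \<lambda>j\<in>{..<n}. z j + d j)"
    by (rule distr_PiM_map[symmetric]) (auto simp: prob_space_tilt[OF T])
  finally have "(\<integral>\<^sup>+y. k y \<partial>PiM {..<n} (\<lambda>_. density lborel (gdens ?S))) =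
      (\<integral>\<^sup>+z. k (\<lambda>j\<in>{..<n}. z j + d j) \<partial>PiM {..<n} (\<lambda>j. density std_gaussian (tilt ?S (d j))))"
    by (simp add: nn_integral_distr)
  also have "PiM {..<n} (\<lambda>j. density std_gaussian (tilt ?S (d j))) =
      density (gblock n) (\<lambda>z. \<Prod>j<n. ennreal (tilt ?S (d j) (z j)))"
    by (rule PiM_density)
       (auto simp: prob_space_imp_sigma_finite prob_space_tilt[OF T])
  also have "(\<integral>\<^sup>+z. k (\<lambda>j\<in>{..<n}. z j + d j) \<partial>\<dots>) = (\<integral>\<^sup>+z. (\<Prod>j<n. ennreal (tilt ?S (d j) (z j))) * k (\<lambda>j\<in>{..<n}. z j + d j) \<partial>gblock n)"
    by (rule nn_integral_density) measurable
  finally show ?thesis by simp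
qed

text \<open>The value is minus the relative entropy of N(d, I) with respect to N(0, S).\<close>

lemma has_bochner_integral_ln_tilt:
  fixes S :: "real^'n^'n"
  assumes "pdef S"
  shows "has_bochner_integral std_gaussian (\<lambda>z. ln (tilt S d z))
    ((real CARD('n) - trace (matrix_inv S) - qform S d - ln (det S)) / 2)"
proof -
  interpret prob_space "std_gaussian :: (real^'n) measure" by simp
  let ?I = "matrix_inv S"
  have q: "qform S (z + d) = z \<bullet> (?I *v z) + 2 * ((?I *v d) \<bullet> z) + qform S d" for z
  proof -
    have "d \<bullet> (?I *v z) = (?I *v d) \<bullet> z"
      by (simp add: inner_matrix_vector[of d] pdef_matrix_inv_sym[OF assms])
    then show ?thesis
      by (simp add: qform_def matrix_vector_right_distrib inner_add_left inner_add_right inner_commute)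
  qed
  have c: "has_bochner_integral (std_gaussian :: (real^'n) measure) (\<lambda>_. a) a" for a :: real
    using prob_space by (simp add: has_bochner_integral_iff)
  have 1: "has_bochner_integral (std_gaussian :: (real^'n) measure) (\<lambda>z. z \<bullet> z) (real CARD('n))"
    using has_bochner_integral_std_gaussian_quadratic[of "mat 1 :: real^'n^'n"] by (simp add: trace_I)
  have "has_bochner_integral std_gaussian
     (\<lambda>z. (z \<bullet> z - (z \<bullet> (?I *v z) + 2 * ((?I *v d) \<bullet> z) + qform S d) - ln (det S)) / 2)
     ((real CARD('n) - (trace ?I + 2 * 0 + qform S d) - ln (det S)) / 2)"
    by (intro has_bochner_integral_divide_zero has_bochner_integral_diff has_bochner_integral_add has_bochner_integral_mult_right c 1
       has_bochner_integral_std_gaussian_quadratic has_bochner_integral_std_gaussian_linear)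
  then show ?thesis
    by (simp add: ln_tilt[OF assms] q algebra_simps)
qed

text \<open>The sum over \<open>j\<close> is minus the relative entropy of the true block law with
  respect to the reference law. The estimate thus trades the success probability under the true law,
  weighted by \<open>ln M\<close>, for the one under the reference law.\<close>

lemma gblock_change_of_measure:
  fixes T :: "real^'n^'n" and d :: "nat \<Rightarrow> real^'n"
  assumes T: "psd T" and k [measurable]: "k \<in> borel_measurable (PiM {..<n} (\<lambda>_. borel))"
    and k0: "\<And>y. 0 \<le> k y" and k1: "\<And>y. k y \<le> 1" and M: "1 \<le> M"
  defines "S \<equiv> mat 1 + T"
  shows "(\<integral>z. k (\<lambda>j\<in>{..<n}. z j + d j) \<partial>gblock n) * ln M
    + (\<Sum>j<n. (real CARD('n) - trace (matrix_inv S) - qform S (d j) - ln (det S)) / 2)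
    \<le> (1 + M * (\<integral>y. k y \<partial>PiM {..<n} (\<lambda>_. density lborel (gdens S)))) / 2 - 1 + ln 2"
proof -
  interpret G: prob_space "gblock n :: (nat \<Rightarrow> real^'n) measure" by (rule prob_space_gblock)
  let ?Q = "PiM {..<n} (\<lambda>_. density lborel (gdens S))"
  have Q: "prob_space ?Q" unfolding S_def by (intro prob_space_PiM prob_space_gdens T)
  interpret Q: prob_space ?Q by (rule Q)
  have [measurable_cong]: "sets ?Q = sets (PiM {..<n} (\<lambda>_. borel))"
    by (intro sets_PiM_cong) auto
  have S: "pdef S" unfolding S_def by (rule pdef_add_psd[OF pdef_mat_1 T])
  define R where "R z = (\<Prod>j<n. tilt S (d j) (z j))" for z
  define K where "K z = k (\<lambda>j\<in>{..<n}. z j + d j)" for z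
  have [measurable]: "R \<in> borel_measurable (gblock n)" "K \<in> borel_measurable (gblock n)"
    unfolding R_def K_def by measurable
  have R: "0 < R z" for z unfolding R_def by (intro prod_pos ballI tilt_pos S)
  have K: "0 \<le> K z" "K z \<le> 1" for z using k0 k1 by (auto simp: K_def)
  have RK: "integrable (gblock n) (\<lambda>z. R z * f (\<lambda>j\<in>{..<n}. z j + d j)) \<and>
      (\<integral>z. R z * f (\<lambda>j\<in>{..<n}. z j + d j) \<partial>gblock n) = (\<integral>y. f y \<partial>?Q)"
    if [measurable]: "f \<in> borel_measurable (PiM {..<n} (\<lambda>_. borel))" and f: "\<And>y. 0 \<le> f y" "\<And>y. f y \<le> 1" for f
  proof -
    have fi: "integrable ?Q f"
      by (rule Q.integrable_const_bound[where B = 1]) (use f in auto)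
    have "(\<integral>\<^sup>+z. ennreal (R z * f (\<lambda>j\<in>{..<n}. z j + d j)) \<partial>gblock n) =
       (\<integral>\<^sup>+z. (\<Prod>j<n. ennreal (tilt S (d j) (z j))) * ennreal (f (\<lambda>j\<in>{..<n}. z j + d j)) \<partial>gblock n)"
      using R f tilt_pos[OF S] by (simp add: R_def ennreal_mult prod_ennreal less_imp_le prod_nonneg)
    also have "\<dots> = (\<integral>\<^sup>+y. ennreal (f y) \<partial>?Q)"
      unfolding S_def by (rule nn_integral_gblock_tilt[OF T]) measurable
    also have "\<dots> = ennreal (\<integral>y. f y \<partial>?Q)"
      by (rule nn_integral_eq_integral[OF fi]) (use f in auto)
    finally have "has_bochner_integral (gblock n) (\<lambda>z. R z * f (\<lambda>j\<in>{..<n}. z j + d j)) (\<integral>y. f y \<partial>?Q)"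
      using R f by (intro has_bochner_integral_nn_integral) (auto simp: less_imp_le)
    then show ?thesis by (simp add: has_bochner_integral_iff)
  qed
  have R1: "integrable (gblock n) R" "(\<integral>z. R z \<partial>gblock n) = 1"
    using RK[of "\<lambda>_. 1"] by (auto simp: Q.prob_space)
  have RKi: "integrable (gblock n) (\<lambda>z. R z * K z)" "(\<integral>z. R z * K z \<partial>gblock n) = (\<integral>y. k y \<partial>?Q)"
    using RK[OF k k0 k1] by (auto simp: K_def)
  have Ki: "integrable (gblock n) K"
    by (rule G.integrable_const_bound[where B = 1]) (use K in auto)
  have L: "has_bochner_integral (gblock n) (\<lambda>z. \<Sum>j<n. ln (tilt S (d j) (z j)))
      (\<Sum>j<n. (real CARD('n) - trace (matrix_inv S) - qform S (d j) - ln (det S)) / 2)"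
    by (intro has_bochner_integral_sum has_bochner_integral_PiM_component has_bochner_integral_ln_tilt S) auto
  have "(\<integral>z. K z * ln M + (\<Sum>j<n. ln (tilt S (d j) (z j))) \<partial>gblock n) \<le>
      (\<integral>z. (R z + M * (R z * K z)) / 2 + (ln 2 - 1) \<partial>gblock n)"
  proof (rule integral_mono)
    show "integrable (gblock n) (\<lambda>z. K z * ln M + (\<Sum>j<n. ln (tilt S (d j) (z j))))"
      using L Ki by (auto simp: has_bochner_integral_iff)
    show "integrable (gblock n) (\<lambda>z. (R z + M * (R z * K z)) / 2 + (ln 2 - 1))"
      using R1 RKi by auto
    fix z
    \<comment> \<open>Data processing in variational form: this bound is mixed with weights \<open>K z\<close> and \<open>1 - K z\<close>
      at the points \<open>M R z\<close> and \<open>R z\<close>.\<close>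
    have l: "ln x \<le> x / 2 - 1 + ln 2" if "x > 0" for x :: real
      using ln_le_minus_one[of "x / 2"] that by (simp add: ln_div)
    have lnR: "(\<Sum>j<n. ln (tilt S (d j) (z j))) = ln (R z)"
      unfolding R_def by (rule ln_prod[symmetric]) (auto simp: less_imp_neq[OF tilt_pos[OF S], symmetric])
    have a: "K z * ln (M * R z) \<le> K z * (M * R z / 2 - 1 + ln 2)"
      using K[of z] R[of z] M by (intro mult_left_mono l) auto
    have b: "(1 - K z) * ln (R z) \<le> (1 - K z) * (R z / 2 - 1 + ln 2)"
      using K[of z] R[of z] by (intro mult_left_mono l) auto
    have "K z * ln M + ln (R z) = K z * ln (M * R z) + (1 - K z) * ln (R z)"
      using R[of z] M by (simp add: ln_mult algebra_simps)
    also have "\<dots> \<le> K z * (M * R z / 2 - 1 + ln 2) + (1 - K z) * (R z / 2 - 1 + ln 2)"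
      using a b by simp
    also have "\<dots> = (R z + M * (R z * K z)) / 2 + (ln 2 - 1) - K z * R z / 2"
      by (simp add: field_simps)
    also have "\<dots> \<le> (R z + M * (R z * K z)) / 2 + (ln 2 - 1)"
      using K[of z] R[of z] by simp
    finally show "K z * ln M + (\<Sum>j<n. ln (tilt S (d j) (z j))) \<le> (R z + M * (R z * K z)) / 2 + (ln 2 - 1)"
      by (simp add: lnR)
  qed
  then show ?thesis
    using L Ki R1 RKi by (simp add: has_bochner_integral_iff K_def[symmetric] G.prob_space add_divide_distrib diff_divide_distrib)
qed

text \<open>\<open>W\<close> indexes the message tuples, \<open>k w\<close> is the probability that a randomised decision is correct, and
  outputs are recentred so that the reference law is \<open>N(0, S)\<close>. With \<open>S\<close> built from the average of
  the \<open>outer (d w j)\<close>, the quadratic terms of the relative entropy cancel the trace terms exactly.\<close>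

lemma gaussian_code_converse:
  fixes d :: "'w \<Rightarrow> nat \<Rightarrow> real^'n"
  assumes W: "finite W" "W \<noteq> {}" and n: "n > 0" and M: "1 \<le> M"
    and k: "\<And>w. w \<in> W \<Longrightarrow> k w \<in> borel_measurable (PiM {..<n} (\<lambda>_. borel))"
    and k0: "\<And>w y. 0 \<le> k w y" and k1: "\<And>w y. k w y \<le> 1"
    and kM: "\<And>y. y \<in> space (PiM {..<n} (\<lambda>_. borel)) \<Longrightarrow> (\<Sum>w\<in>W. k w y) \<le> card W / M"
  defines "S \<equiv> mat 1 + (1 / (real n * real (card W))) *\<^sub>R (\<Sum>w\<in>W. \<Sum>j<n. outer (d w j))"
  shows "(1 / card W) * (\<Sum>w\<in>W. \<integral>z. k w (\<lambda>j\<in>{..<n}. z j + d w j) \<partial>gblock n) * ln M \<le> real n / 2 * ln (det S) + ln 2"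
proof -
  define c where "c = real (card W)"
  have c: "c > 0" using W by (simp add: c_def card_gt_0_iff)
  define T where "T = (1 / (real n * c)) *\<^sub>R (\<Sum>w\<in>W. \<Sum>j<n. outer (d w j))"
  have T: "psd T" unfolding T_def using c by (intro psd_scaleR psd_sum psd_outer) auto
  have ST: "S = mat 1 + T" by (simp add: S_def T_def c_def)
  have S: "pdef S" unfolding ST by (rule pdef_add_psd[OF pdef_mat_1 T])
  let ?Q = "PiM {..<n} (\<lambda>_. density lborel (gdens S))"
  interpret Q: prob_space ?Q unfolding ST by (intro prob_space_PiM prob_space_gdens T)
  have sQ [measurable_cong]: "sets ?Q = sets (PiM {..<n} (\<lambda>_. borel))"
    by (intro sets_PiM_cong) auto
  define E where "E w = (\<integral>z. k w (\<lambda>j\<in>{..<n}. z j + d w j) \<partial>gblock n)" for w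
  define q where "q w = (\<integral>y. k w y \<partial>?Q)" for w
  have ki: "integrable ?Q (k w)" if "w \<in> W" for w
    by (rule Q.integrable_const_bound[where B = 1]) (use k[OF that] k0 k1 in auto)
  have "(\<Sum>w\<in>W. q w) = (\<integral>y. (\<Sum>w\<in>W. k w y) \<partial>?Q)"
    unfolding q_def by (rule Bochner_Integration.integral_sum[symmetric]) (rule ki)
  also have "\<dots> \<le> (\<integral>y. c / M \<partial>?Q)"
  proof (rule integral_mono)
    fix y assume "y \<in> space ?Q"
    then have "y \<in> space (PiM {..<n} (\<lambda>_. borel))" using sets_eq_imp_space_eq[OF sQ] by simp
    then show "(\<Sum>w\<in>W. k w y) \<le> c / M" unfolding c_def by (rule kM)
  qed (auto intro: ki)
  finally have q: "(\<Sum>w\<in>W. q w) \<le> c / M" by (simp add: Q.prob_space)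
  have tr: "(\<Sum>w\<in>W. \<Sum>j<n. qform S (d w j)) = real n * c * (real CARD('n) - trace (matrix_inv S))"
  proof -
    have "(\<Sum>w\<in>W. \<Sum>j<n. qform S (d w j)) = trace (matrix_inv S ** (\<Sum>w\<in>W. \<Sum>j<n. outer (d w j)))"
      by (simp add: qform_def trace_mult_outer matrix_mult_sum_right trace_sum)
    also have "(\<Sum>w\<in>W. \<Sum>j<n. outer (d w j)) = (real n * c) *\<^sub>R T"
      using n c by (simp add: T_def)
    also have "T = S - mat 1" by (simp add: ST)
    also have "trace (matrix_inv S ** ((real n * c) *\<^sub>R (S - mat 1))) = real n * c * (trace (matrix_inv S ** S) - trace (matrix_inv S))"
    proof -
      have "matrix_inv S ** (S - mat 1) = matrix_inv S ** S - matrix_inv S"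
        using matrix_add_ldistrib[of "matrix_inv S" "S - mat 1" "mat 1"] by (simp add: algebra_simps)
      then show ?thesis by (simp add: matrix_mult_scaleR_right trace_scaleR trace_sub)
    qed
    finally show ?thesis by (simp add: matrix_inv_cancel[OF pdef_invertible[OF S]] trace_I)
  qed
  have "(\<Sum>w\<in>W. E w * ln M + (\<Sum>j<n. (real CARD('n) - trace (matrix_inv S) - qform S (d w j) - ln (det S)) / 2))
     \<le> (\<Sum>w\<in>W. (1 + M * q w) / 2 - 1 + ln 2)"
    unfolding E_def q_def ST
    by (intro sum_mono gblock_change_of_measure[OF T k k0 k1 M])
  also have "\<dots> = c * (ln 2 - 1 / 2) + M * (\<Sum>w\<in>W. q w) / 2"
    by (simp add: c_def sum.distrib sum_subtractf sum_divide_distrib[symmetric] sum_distrib_left[symmetric] field_simps)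
  also have "\<dots> \<le> c * (ln 2 - 1 / 2) + M * (c / M) / 2"
    using q M by (intro add_left_mono divide_right_mono mult_left_mono) auto
  also have "\<dots> = c * ln 2" using M by (simp add: algebra_simps)
  also have "(\<Sum>w\<in>W. E w * ln M + (\<Sum>j<n. (real CARD('n) - trace (matrix_inv S) - qform S (d w j) - ln (det S)) / 2))
     = (\<Sum>w\<in>W. E w) * ln M - c * (real n / 2 * ln (det S))"
  proof -
    have "(\<Sum>w\<in>W. \<Sum>j<n. (real CARD('n) - trace (matrix_inv S) - qform S (d w j) - ln (det S)) / 2) =
       (c * (real n * (real CARD('n) - trace (matrix_inv S) - ln (det S))) - (\<Sum>w\<in>W. \<Sum>j<n. qform S (d w j))) / 2"
      by (simp add: sum_subtractf sum.distrib diff_divide_distrib sum_divide_distrib[symmetric] c_def algebra_simps)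
    then show ?thesis by (simp add: sum.distrib sum_distrib_right[symmetric] tr algebra_simps)
  qed
  finally have "(\<Sum>w\<in>W. E w) * ln M \<le> c * (real n / 2 * ln (det S) + ln 2)" by (simp add: algebra_simps)
  then show ?thesis using c by (simp add: E_def[symmetric] c_def[symmetric] field_simps)
qed

section \<open>Outer products of codewords, and error probabilities under Gaussian noise\<close>

lemma outer_matrix_vector: "outer (A *v x) = A ** outer x ** transpose A" for A :: "real^'n^'n"
proof -
  have "(outer (A *v x)) *v y = (A ** outer x ** transpose A) *v y" for y
    by (simp add: matrix_vector_mul_assoc[symmetric] outer_mult matrix_vector_mult_scaleR
        inner_commute[of "A *v x"] inner_matrix_vector[of y A] inner_commute[of x])
  then show ?thesis by (simp add: matrix_eq)
qed

lemma matrix_mult_sum_left: "(\<Sum>k\<in>K. B k) ** A = (\<Sum>k\<in>K. B k ** A)" for B :: "'k \<Rightarrow> real^'n^'n"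
  by (induction K rule: infinite_finite_induct) (auto simp: matrix_add_rdistrib)

text \<open>The cross terms factor into a product of two sums that vanish: covariances of
  independent centred inputs add.\<close>

lemma sum_outer_add:
  fixes u :: "'a \<Rightarrow> real^'n" and v :: "'b \<Rightarrow> real^'n"
  assumes "(\<Sum>a\<in>I. u a) = 0" "(\<Sum>b\<in>J. v b) = 0"
  shows "(\<Sum>(a, b)\<in>I \<times> J. outer (u a + v b)) =
    real (card J) *\<^sub>R (\<Sum>a\<in>I. outer (u a)) + real (card I) *\<^sub>R (\<Sum>b\<in>J. outer (v b))"
proof -
  have u: "(\<Sum>a\<in>I. u a $ i) = 0" and v: "(\<Sum>b\<in>J. v b $ i) = 0" for i
    using arg_cong[OF assms(1), of "\<lambda>x. x $ i"] arg_cong[OF assms(2), of "\<lambda>x. x $ i"] by simp_all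
  have "(\<Sum>a\<in>I. \<Sum>b\<in>J. (u a $ i + v b $ i) * (u a $ k + v b $ k)) =
      real (card J) * (\<Sum>a\<in>I. u a $ i * u a $ k) + real (card I) * (\<Sum>b\<in>J. v b $ i * v b $ k)" for i k
  proof -
    have "(\<Sum>a\<in>I. \<Sum>b\<in>J. (u a $ i + v b $ i) * (u a $ k + v b $ k)) =
      (\<Sum>a\<in>I. \<Sum>b\<in>J. u a $ i * u a $ k) + (\<Sum>a\<in>I. \<Sum>b\<in>J. v b $ i * v b $ k)
      + ((\<Sum>a\<in>I. \<Sum>b\<in>J. u a $ i * v b $ k) + (\<Sum>a\<in>I. \<Sum>b\<in>J. u a $ k * v b $ i))"
      by (simp add: sum.distrib algebra_simps)
    also have "(\<Sum>a\<in>I. \<Sum>b\<in>J. u a $ i * v b $ k) = 0" by (simp add: sum_product[symmetric] u)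
    also have "(\<Sum>a\<in>I. \<Sum>b\<in>J. u a $ k * v b $ i) = 0" by (simp add: sum_product[symmetric] u)
    finally show ?thesis by (simp add: sum_distrib_left)
  qed
  then show ?thesis
    by (simp add: vec_eq_iff outer_def sum.cartesian_product[symmetric])
qed

text \<open>The decoded user comes before the interfering one, in the matrices as well as in the
  codebooks, so receiver 2 is the instance with the users exchanged. The noise is a single Gaussian
  block: the joint law of the noise pair has been eliminated.\<close>

definition err :: "real^'n^'n \<Rightarrow> real^'n^'n \<Rightarrow> nat \<Rightarrow> nat set \<Rightarrow> nat set \<Rightarrow> (nat \<Rightarrow> nat \<Rightarrow> real^'n) \<Rightarrow>
    (nat \<Rightarrow> nat \<Rightarrow> real^'n) \<Rightarrow> ((nat \<Rightarrow> real^'n) \<Rightarrow> nat) \<Rightarrow> real" where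
  "err A B n W1 W2 f1 f2 g = (1 / (real (card W1) * real (card W2))) *
     (\<Sum>(m1, m2)\<in>W1 \<times> W2. measure (gblock n) {z \<in> space (gblock n). g (received A B n (f1 m1) (f2 m2) z) \<noteq> m1})"

lemma err_nonneg: "0 \<le> err A B n W1 W2 f1 f2 g"
  unfolding err_def by (intro mult_nonneg_nonneg sum_nonneg) auto

lemma messages_finite [simp]: "finite (messages n R)"
  by (simp add: messages_def)

lemma messages_nonempty [simp]: "messages n R \<noteq> {}"
proof -
  have "0 < nat \<lceil>exp (real n * R)\<rceil>" by simp
  then show ?thesis unfolding messages_def by (metis lessThan_iff empty_iff)
qed

lemma card_messages_ge: "exp (real n * R) \<le> card (messages n R)"
  by (simp add: messages_def real_nat_ceiling_ge)

text \<open>The messages are discrete, so the event is a countable union of rectangles, and taking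
  sections in both messages leaves a double average over the message sets.\<close>

lemma measure_block_space:
  fixes N :: "((real^'n) \<times> (real^'n)) measure"
  assumes N: "prob_space N"
    and Q: "\<And>m1 m2. {z \<in> space (PiM {..<n} (\<lambda>_. N)). Q m1 m2 z} \<in> sets (PiM {..<n} (\<lambda>_. N))"
  shows "measure (block_space N n R1 R2) {(m1, m2, z) \<in> space (block_space N n R1 R2). Q m1 m2 z} =
    (1 / (real (card (messages n R1)) * real (card (messages n R2)))) *
      (\<Sum>(m1, m2)\<in>messages n R1 \<times> messages n R2. measure (PiM {..<n} (\<lambda>_. N)) {z \<in> space (PiM {..<n} (\<lambda>_. N)). Q m1 m2 z})"
proof -
  let ?P = "PiM {..<n} (\<lambda>_. N)" and ?U1 = "measure_pmf (uniform_message n R1)" and ?U2 = "measure_pmf (uniform_message n R2)"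
  define X where "X = {(m1, m2, z) \<in> space (block_space N n R1 R2). Q m1 m2 z}"
  interpret P: prob_space ?P using N by (intro prob_space_PiM)
  interpret UP: pair_prob_space ?U2 ?P ..
  have s: "space (block_space N n R1 R2) = UNIV \<times> UNIV \<times> space ?P"
    by (simp add: block_space_def space_pair_measure)
  have "X = (\<Union>m1. \<Union>m2. {m1} \<times> ({m2} \<times> {z \<in> space ?P. Q m1 m2 z}))"
    by (auto simp: X_def s)
  moreover have "{m1} \<times> ({m2} \<times> {z \<in> space ?P. Q m1 m2 z}) \<in> sets (block_space N n R1 R2)" for m1 m2
    unfolding block_space_def by (intro pair_measureI Q) auto
  ultimately have X: "X \<in> sets (?U1 \<Otimes>\<^sub>M (?U2 \<Otimes>\<^sub>M ?P))"
    unfolding block_space_def by (simp add: sets.countable_UN)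
  have "emeasure (block_space N n R1 R2) X = (\<integral>\<^sup>+m1. emeasure (?U2 \<Otimes>\<^sub>M ?P) (Pair m1 -` X) \<partial>?U1)"
    unfolding block_space_def by (rule UP.emeasure_pair_measure_alt[OF X])
  also have "\<dots> = (\<integral>\<^sup>+m1. \<integral>\<^sup>+m2. emeasure ?P (Pair m2 -` (Pair m1 -` X)) \<partial>?U2 \<partial>?U1)"
    by (intro nn_integral_cong P.emeasure_pair_measure_alt sets_Pair1[OF X])
  also have "\<dots> = (\<integral>\<^sup>+m1. \<integral>\<^sup>+m2. ennreal (measure ?P {z \<in> space ?P. Q m1 m2 z}) \<partial>?U2 \<partial>?U1)"
    by (auto intro!: nn_integral_cong arg_cong[where f = "emeasure ?P"] simp: P.emeasure_eq_measure[symmetric] X_def s)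
  also have "\<dots> = ennreal ((1 / (real (card (messages n R1)) * real (card (messages n R2)))) *
      (\<Sum>(m1, m2)\<in>messages n R1 \<times> messages n R2. measure ?P {z \<in> space ?P. Q m1 m2 z}))"
    by (simp add: uniform_message_def nn_integral_pmf_of_set sum_nonneg ennreal_of_nat_eq_real_of_nat
        divide_ennreal card_gt_0_iff sum_divide_distrib[symmetric] sum.cartesian_product[symmetric] field_simps)
  finally have "emeasure (block_space N n R1 R2) X = \<dots>" .
  then show ?thesis
    unfolding X_def[symmetric] measure_def[of "block_space N n R1 R2"]
    by (simp add: sum_nonneg case_prod_beta)
qed

lemma received_measurable:
  "(\<lambda>z. received A B n x1 x2 z) \<in> measurable (PiM {..<n} (\<lambda>_. borel)) (PiM {..<n} (\<lambda>_. borel))"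
  unfolding received_def by measurable

lemma error_event_measurable:
  assumes "g \<in> measurable (PiM {..<n} (\<lambda>_. borel)) (count_space W)"
  shows "{z \<in> space (gblock n). P (g (received A B n x1 x2 z))} \<in> sets (gblock n)"
proof -
  have "(\<lambda>z. g (received A B n x1 x2 z)) \<in> measurable (gblock n) (count_space W)"
    using measurable_compose[OF received_measurable assms] by (simp add: measurable_cong_sets[OF sets_gblock refl])
  note m = this
  have "{z \<in> space (gblock n). P (g (received A B n x1 x2 z))} =
      (\<lambda>z. g (received A B n x1 x2 z)) -` {m \<in> W. P m} \<inter> space (gblock n)"
    using measurable_space[OF m] by auto
  then show ?thesis using measurable_sets[OF m, of "{m \<in> W. P m}"] by simp
qed

text \<open>A receiver sees the noise through one projection \<open>pr\<close>, and the projected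
  block is an i.i.d. standard Gaussian block whatever the dependence between the two noise
  vectors.\<close>

lemma measure_noise_block:
  fixes N :: "((real^'n) \<times> (real^'n)) measure" and pr :: "((real^'n) \<times> (real^'n)) \<Rightarrow> real^'n"
  assumes N: "prob_space N" "distr N borel pr = std_gaussian" and pr [measurable]: "pr \<in> measurable N borel"
    and g: "g \<in> measurable (PiM {..<n} (\<lambda>_. borel)) (count_space W)"
  shows "{z \<in> space (PiM {..<n} (\<lambda>_. N)). P (g (received A B n x1 x2 (\<lambda>j. pr (z j))))} \<in> sets (PiM {..<n} (\<lambda>_. N))"
    and "measure (PiM {..<n} (\<lambda>_. N)) {z \<in> space (PiM {..<n} (\<lambda>_. N)). P (g (received A B n x1 x2 (\<lambda>j. pr (z j))))} =
      measure (gblock n) {z \<in> space (gblock n). P (g (received A B n x1 x2 z))}"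
proof -
  let ?P = "PiM {..<n} (\<lambda>_. N)"
  define t where "t z = (\<lambda>j\<in>{..<n}. pr (z j))" for z
  have t: "t \<in> measurable ?P (PiM {..<n} (\<lambda>_. borel))" unfolding t_def by measurable
  have D: "gblock n = distr ?P (PiM {..<n} (\<lambda>_. borel)) t"
    unfolding t_def N(2)[symmetric] by (rule distr_PiM_map[symmetric]) (auto simp: N(1))
  have r: "received A B n x1 x2 (\<lambda>j. pr (z j)) = received A B n x1 x2 (t z)" for z
    by (auto simp: received_def t_def)
  have E: "{z \<in> space (gblock n). P (g (received A B n x1 x2 z))} \<in> sets (gblock n)"
    by (rule error_event_measurable[OF g])
  have eq: "{z \<in> space ?P. P (g (received A B n x1 x2 (\<lambda>j. pr (z j))))} =
      t -` {z \<in> space (gblock n). P (g (received A B n x1 x2 z))} \<inter> space ?P"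
    using measurable_space[OF t] by (auto simp: r sets_eq_imp_space_eq[OF sets_gblock])
  show "{z \<in> space ?P. P (g (received A B n x1 x2 (\<lambda>j. pr (z j))))} \<in> sets ?P"
    unfolding eq by (rule measurable_sets[OF t]) (use E sets_gblock in blast)
  show "measure ?P {z \<in> space ?P. P (g (received A B n x1 x2 (\<lambda>j. pr (z j))))} =
      measure (gblock n) {z \<in> space (gblock n). P (g (received A B n x1 x2 z))}"
    unfolding eq by (subst (2) D, rule measure_distr[symmetric, OF t]) (use E sets_gblock in blast)
qed

lemma error_prob1_eq:
  fixes N :: "((real^'n) \<times> (real^'n)) measure"
  assumes "noise_law N" "decoder n R1 g"
  shows "error_prob1 H1 H2 N n R1 R2 f1 f2 g = err H1 H2 n (messages n R1) (messages n R2) f1 f2 g"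
proof -
  have N: "prob_space N" "distr N borel fst = std_gaussian" "sets N = sets borel"
    using assms by (auto simp: noise_law_def)
  have f: "fst \<in> measurable N borel"
    unfolding measurable_cong_sets[OF N(3) refl] by (intro borel_measurable_continuous_onI continuous_intros)
  note g = assms(2)[unfolded decoder_def]
  have "{z \<in> space (PiM {..<n} (\<lambda>_. N)). g (received H1 H2 n (f1 m1) (f2 m2) (\<lambda>j. fst (z j))) \<noteq> m1} \<in> sets (PiM {..<n} (\<lambda>_. N))" for m1 m2
    by (rule measure_noise_block(1)[OF N(1,2) f g, where P = "\<lambda>m. m \<noteq> m1"])
  then show ?thesis
    unfolding error_prob1_def err_def
    by (subst measure_block_space[OF N(1)])
       (auto intro!: sum.cong measure_noise_block(2)[OF N(1,2) f g, where P = "\<lambda>m. m \<noteq> m1" for m1])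
qed

lemma received_commute: "received A B n x1 x2 z = received B A n x2 x1 z"
  by (simp add: received_def add_ac)

lemma error_prob2_eq:
  fixes N :: "((real^'n) \<times> (real^'n)) measure"
  assumes "noise_law N" "decoder n R2 g"
  shows "error_prob2 H3 H4 N n R1 R2 f1 f2 g = err H4 H3 n (messages n R2) (messages n R1) f2 f1 g"
proof -
  have N: "prob_space N" "distr N borel snd = std_gaussian" "sets N = sets borel"
    using assms by (auto simp: noise_law_def)
  have f: "snd \<in> measurable N borel"
    unfolding measurable_cong_sets[OF N(3) refl] by (intro borel_measurable_continuous_onI continuous_intros)
  note g = assms(2)[unfolded decoder_def]
  let ?P = "PiM {..<n} (\<lambda>_. N)"
  have m: "{z \<in> space ?P. g (received H3 H4 n (f1 m1) (f2 m2) (\<lambda>j. snd (z j))) \<noteq> m2} \<in> sets ?P" for m1 m2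
    by (rule measure_noise_block(1)[OF N(1,2) f g, where P = "\<lambda>m. m \<noteq> m2"])
  have "error_prob2 H3 H4 N n R1 R2 f1 f2 g = (1 / (real (card (messages n R1)) * real (card (messages n R2)))) *
      (\<Sum>(m1, m2)\<in>messages n R1 \<times> messages n R2. measure ?P {z \<in> space ?P. g (received H3 H4 n (f1 m1) (f2 m2) (\<lambda>j. snd (z j))) \<noteq> m2})"
    unfolding error_prob2_def by (rule measure_block_space[OF N(1) m])
  also have "\<dots> = (1 / (real (card (messages n R2)) * real (card (messages n R1)))) *
      (\<Sum>(m1, m2)\<in>messages n R1 \<times> messages n R2. measure (gblock n) {z \<in> space (gblock n). g (received H4 H3 n (f2 m2) (f1 m1) z) \<noteq> m2})"
    by (subst received_commute[of H4], subst measure_noise_block(2)[OF N(1,2) f g, where P = "\<lambda>m. m \<noteq> m2" for m2])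
       (simp add: mult.commute)
  also have "\<dots> = err H4 H3 n (messages n R2) (messages n R1) f2 f1 g"
    unfolding err_def by (subst sum.swap[unfolded sum.cartesian_product]) simp
  finally show ?thesis .
qed

section \<open>Empirical covariances and the converse bounds for one block\<close>

definition emean :: "nat set \<Rightarrow> (nat \<Rightarrow> nat \<Rightarrow> real^'n) \<Rightarrow> nat \<Rightarrow> real^'n" where
  "emean W f j = (1 / real (card W)) *\<^sub>R (\<Sum>m\<in>W. f m j)"

text \<open>Centring is done separately in each channel use, which makes the cross terms of the two
  users vanish by \<open>sum_outer_add\<close>. The average over \<open>j\<close> merges all channel
  uses into one matrix, the covariance at which the capacity expression is evaluated.\<close>

definition ecov :: "nat \<Rightarrow> nat set \<Rightarrow> (nat \<Rightarrow> nat \<Rightarrow> real^'n) \<Rightarrow> real^'n^'n" where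
  "ecov n W f = (1 / (real n * real (card W))) *\<^sub>R (\<Sum>m\<in>W. \<Sum>j<n. outer (f m j - emean W f j))"

lemma sum_emean: "finite W \<Longrightarrow> W \<noteq> {} \<Longrightarrow> (\<Sum>m\<in>W. f m j - emean W f j) = 0"
  by (simp add: emean_def sum_subtractf sum_constant_scaleR del: sum_constant)

lemma psd_ecov: "psd (ecov n W f)"
  unfolding ecov_def by (intro psd_scaleR psd_sum psd_outer) simp

text \<open>Centring can only lower the second moment, so a power constraint becomes a constraint on
  the trace.\<close>

lemma trace_ecov_le:
  assumes W: "finite W" "W \<noteq> {}" and n: "n > 0"
  shows "trace (ecov n W f) \<le> (1 / real n) * (\<Sum>j<n. (\<Sum>m\<in>W. (norm (f m j))\<^sup>2) / real (card W))"
proof -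
  have c: "real (card W) > 0" using W by (simp add: card_gt_0_iff)
  have "(\<Sum>m\<in>W. (norm (f m j - emean W f j))\<^sup>2) \<le> (\<Sum>m\<in>W. (norm (f m j))\<^sup>2)" for j
  proof -
    let ?a = "emean W f j"
    have "(\<Sum>m\<in>W. (norm (f m j - ?a))\<^sup>2) = (\<Sum>m\<in>W. (norm (f m j))\<^sup>2 - 2 * (?a \<bullet> (f m j - ?a)) - (norm ?a)\<^sup>2)"
      by (intro sum.cong refl) (simp add: power2_norm_eq_inner inner_diff_left inner_diff_right inner_commute)
    also have "\<dots> = (\<Sum>m\<in>W. (norm (f m j))\<^sup>2) - 2 * (?a \<bullet> (\<Sum>m\<in>W. f m j - ?a)) - real (card W) * (norm ?a)\<^sup>2"
      unfolding inner_sum_right sum_distrib_left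
      by (simp only: sum_subtractf[of "\<lambda>m. _ m - 2 * _ m"] sum_subtractf[of "\<lambda>m. (norm (f m j))\<^sup>2"] sum_constant)
    also have "\<dots> \<le> (\<Sum>m\<in>W. (norm (f m j))\<^sup>2)"
      by (subst sum_emean[OF W]) simp
    finally show ?thesis .
  qed
  then have "(\<Sum>j<n. \<Sum>m\<in>W. (norm (f m j - emean W f j))\<^sup>2) \<le> (\<Sum>j<n. \<Sum>m\<in>W. (norm (f m j))\<^sup>2)"
    by (rule sum_mono)
  then have "(1 / (real n * real (card W))) * (\<Sum>j<n. \<Sum>m\<in>W. (norm (f m j - emean W f j))\<^sup>2) \<le>
      (1 / (real n * real (card W))) * (\<Sum>j<n. \<Sum>m\<in>W. (norm (f m j))\<^sup>2)"
    by (intro mult_left_mono) auto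
  moreover have "trace (ecov n W f) = (1 / (real n * real (card W))) * (\<Sum>j<n. \<Sum>m\<in>W. (norm (f m j - emean W f j))\<^sup>2)"
    unfolding ecov_def trace_scaleR trace_sum trace_outer by (subst sum.swap) simp
  ultimately show ?thesis by (simp add: sum_divide_distrib[symmetric])
qed

lemma err_complement:
  assumes W: "finite W1" "W1 \<noteq> {}" "finite W2" "W2 \<noteq> {}"
    and g: "g \<in> measurable (PiM {..<n} (\<lambda>_. borel)) (count_space W)"
  shows "(1 / (real (card W1) * real (card W2))) *
     (\<Sum>(m1, m2)\<in>W1 \<times> W2. measure (gblock n) {z \<in> space (gblock n). g (received A B n (f1 m1) (f2 m2) z) = m1}) = 1 - err A B n W1 W2 f1 f2 g"
proof -
  interpret G: prob_space "gblock n :: (nat \<Rightarrow> real^'a) measure" by (rule prob_space_gblock)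
  have "measure (gblock n) {z \<in> space (gblock n). g (received A B n x1 x2 z) = m} =
      1 - measure (gblock n) {z \<in> space (gblock n). g (received A B n x1 x2 z) \<noteq> m}" for m x1 x2
    using G.prob_neg[OF error_event_measurable[OF g, where A = A and B = B and ?x1.0 = x1 and ?x2.0 = x2 and P = "\<lambda>k. k \<noteq> m"]] by simp
  then have "(\<Sum>(m1, m2)\<in>W1 \<times> W2. measure (gblock n) {z \<in> space (gblock n). g (received A B n (f1 m1) (f2 m2) z) = m1}) =
      real (card W1) * real (card W2) -
      (\<Sum>(m1, m2)\<in>W1 \<times> W2. measure (gblock n) {z \<in> space (gblock n). g (received A B n (f1 m1) (f2 m2) z) \<noteq> m1})"
    by (simp add: case_prod_beta sum_subtractf card_cartesian_product)
  moreover have "real (card W1) * real (card W2) > 0" using W by (simp add: card_gt_0_iff)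
  ultimately show ?thesis
    using W by (simp add: err_def diff_divide_distrib)
qed

lemma sum_indicator_singleton_le:
  assumes "finite W" shows "(\<Sum>m\<in>W. indicator {x} m :: real) \<le> 1"
proof -
  have "(\<Sum>m\<in>W. indicator {x} m :: real) = (\<Sum>m\<in>W. if m = x then 1 else 0)"
    by (intro sum.cong) (auto simp: indicator_def)
  then show ?thesis using assms by simp
qed

text \<open>The interfering message is treated as known: the recentring \<open>s\<close> contains
  \<open>B *v f2 (snd w) j\<close>, so the deviation \<open>d\<close> involves user 1 alone. For
  fixed \<open>m2\<close> the decisions for different \<open>m1\<close> exclude each other, which
  gives \<open>M = card W1\<close> in \<open>gaussian_code_converse\<close>.\<close>

lemma converse_single:
  assumes W: "finite W1" "W1 \<noteq> {}" "finite W2" "W2 \<noteq> {}" and n: "n > 0"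
    and g: "g \<in> measurable (PiM {..<n} (\<lambda>_. borel)) (count_space W)"
  shows "(1 - err A B n W1 W2 f1 f2 g) * ln (real (card W1)) \<le>
    real n / 2 * ln (det (mat 1 + A ** ecov n W1 f1 ** transpose A)) + ln 2"
proof -
  define d where "d w j = A *v (f1 (fst w) j - emean W1 f1 j)" for w :: "nat \<times> nat" and j
  define s where "s w y = (\<lambda>j\<in>{..<n}. y j + (A *v emean W1 f1 j + B *v f2 (snd w) j))" for w :: "nat \<times> nat" and y
  define k where "k w y = (indicator {fst w} (g (s w y)) :: real)" for w y
  have sm [measurable]: "s w \<in> measurable (PiM {..<n} (\<lambda>_. borel)) (PiM {..<n} (\<lambda>_. borel))" for w
    unfolding s_def by measurable
  have km: "k w \<in> borel_measurable (PiM {..<n} (\<lambda>_. borel))" for w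
    unfolding k_def
    by (rule measurable_compose[OF measurable_compose[OF sm g]]) simp
  have sum: "(\<Sum>w\<in>W1 \<times> W2. k w y) \<le> card (W1 \<times> W2) / real (card W1)" for y
  proof -
    have "(\<Sum>w\<in>W1 \<times> W2. k w y) = (\<Sum>m1\<in>W1. \<Sum>m2\<in>W2. k (m1, m2) y)"
      by (simp add: sum.cartesian_product)
    also have "\<dots> = (\<Sum>m2\<in>W2. \<Sum>m1\<in>W1. indicator {g (s (0, m2) y)} m1)"
      by (subst sum.swap) (auto intro!: sum.cong simp: k_def s_def indicator_def)
    also have "\<dots> \<le> (\<Sum>m2\<in>W2. 1)"
      by (intro sum_mono sum_indicator_singleton_le W)
    finally show ?thesis using W by (simp add: card_cartesian_product)
  qed
  have sd: "s w (\<lambda>j\<in>{..<n}. z j + d w j) = received A B n (f1 (fst w)) (f2 (snd w)) z" for w z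
    by (auto simp: s_def d_def received_def matrix_vector_mult_diff_distrib)
  have E: "(\<integral>z. k w (\<lambda>j\<in>{..<n}. z j + d w j) \<partial>gblock n) =
     measure (gblock n) {z \<in> space (gblock n). g (received A B n (f1 (fst w)) (f2 (snd w)) z) = fst w}" for w
  proof -
    have "(\<integral>z. k w (\<lambda>j\<in>{..<n}. z j + d w j) \<partial>gblock n) =
      (\<integral>z. indicator {z \<in> space (gblock n). g (received A B n (f1 (fst w)) (f2 (snd w)) z) = fst w} z \<partial>gblock n)"
      by (intro Bochner_Integration.integral_cong refl) (simp add: k_def sd indicator_def)
    then show ?thesis using error_event_measurable[OF g, where A = A and B = B and P = "\<lambda>m. m = fst w"] by simp
  qed
  have c: "real (card W1) > 0" "real (card W2) > 0" using W by (auto simp: card_gt_0_iff)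
  have S: "(1 / (real n * real (card (W1 \<times> W2)))) *\<^sub>R (\<Sum>w\<in>W1 \<times> W2. \<Sum>j<n. outer (d w j)) = A ** ecov n W1 f1 ** transpose A"
  proof -
    have "(\<Sum>w\<in>W1 \<times> W2. \<Sum>j<n. outer (d w j)) = real (card W2) *\<^sub>R (A ** (\<Sum>m\<in>W1. \<Sum>j<n. outer (f1 m j - emean W1 f1 j)) ** transpose A)"
    proof -
      have "(\<Sum>w\<in>W1 \<times> W2. \<Sum>j<n. outer (d w j)) = (\<Sum>m1\<in>W1. \<Sum>m2\<in>W2. \<Sum>j<n. outer (d (m1, m2) j))"
        by (subst sum.cartesian_product) (simp add: case_prod_beta)
      then show ?thesis unfolding d_def outer_matrix_vector
        by (simp add: matrix_mult_sum_left matrix_mult_sum_right sum_constant_scaleR scaleR_sum_right del: sum_constant)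
    qed
    then show ?thesis
      using c by (simp add: ecov_def matrix_mult_scaleR_left matrix_mult_scaleR_right card_cartesian_product)
  qed
  have "(1 / card (W1 \<times> W2)) * (\<Sum>w\<in>W1 \<times> W2. \<integral>z. k w (\<lambda>j\<in>{..<n}. z j + d w j) \<partial>gblock n) * ln (real (card W1)) \<le>
    real n / 2 * ln (det (mat 1 + (1 / (real n * real (card (W1 \<times> W2)))) *\<^sub>R (\<Sum>w\<in>W1 \<times> W2. \<Sum>j<n. outer (d w j)))) + ln 2"
  proof (rule gaussian_code_converse)
    show "1 \<le> real (card W1)" using W by (simp add: Suc_le_eq card_gt_0_iff)
    show "0 \<le> k w y" "k w y \<le> 1" for w y by (auto simp: k_def indicator_def)
    show "(\<Sum>w\<in>W1 \<times> W2. k w y) \<le> card (W1 \<times> W2) / real (card W1)" for y by (rule sum)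
  qed (use W n in \<open>auto intro: km\<close>)
  then show ?thesis
    unfolding E S err_complement[OF W g, of A B f1 f2, symmetric]
    by (simp add: case_prod_beta card_cartesian_product)
qed

lemma distr_gblock_mix:
  fixes K L :: "real^'n^'n"
  assumes K: "invertible K" and KL: "K ** transpose K + L ** transpose L = mat 1"
  shows "distr (gblock n \<Otimes>\<^sub>M gblock n) (PiM {..<n} (\<lambda>_. borel)) (\<lambda>(z, w). \<lambda>j\<in>{..<n}. K *v z j + L *v w j) = gblock n"
  using distr_PiM_map2[of "{..<n}" "\<lambda>_. std_gaussian" "\<lambda>_. std_gaussian" "\<lambda>_ z w. K *v z + L *v w" "\<lambda>_. borel"]
  by (simp add: distr_std_gaussian_mix[OF assms])

text \<open>The strong-interference step: once receiver 1 knows \<open>x\<^sub>1\<close>, adding independent noise to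
  \<open>K (y\<^sub>1 - A x\<^sub>1) + C x\<^sub>1\<close> reproduces the law of \<open>y\<^sub>2\<close>, so it can decode both messages.\<close>

lemma converse_sum:
  fixes A B C D K L :: "real^'n^'n"
  assumes W: "finite W1" "W1 \<noteq> {}" "finite W2" "W2 \<noteq> {}" and n: "n > 0"
    and g1: "g1 \<in> measurable (PiM {..<n} (\<lambda>_. borel)) (count_space V1)"
    and g2: "g2 \<in> measurable (PiM {..<n} (\<lambda>_. borel)) (count_space V2)"
    and K: "invertible K" and KL: "K ** transpose K + L ** transpose L = mat 1" and D: "D = K ** B"
  shows "(1 - err A B n W1 W2 f1 f2 g1 - err D C n W2 W1 f2 f1 g2) * ln (real (card W1) * real (card W2)) \<le>
    real n / 2 * ln (det (mat 1 + A ** ecov n W1 f1 ** transpose A + B ** ecov n W2 f2 ** transpose B)) + ln 2"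
proof -
  interpret G: prob_space "gblock n :: (nat \<Rightarrow> real^'n) measure" by (rule prob_space_gblock)
  interpret GG: pair_prob_space "gblock n :: (nat \<Rightarrow> real^'n) measure" "gblock n :: (nat \<Rightarrow> real^'n) measure" ..
  have spG: "space (gblock n :: (nat \<Rightarrow> real^'n) measure) = space (PiM {..<n} (\<lambda>_. borel))"
    by (rule sets_eq_imp_space_eq[OF sets_gblock])
  define d where "d w j = A *v (f1 (fst w) j - emean W1 f1 j) + B *v (f2 (snd w) j - emean W2 f2 j)" for w :: "nat \<times> nat" and j
  define s where "s y = (\<lambda>j\<in>{..<n}. y j + (A *v emean W1 f1 j + B *v emean W2 f2 j))" for y
  define r where "r m y v = (\<lambda>j\<in>{..<n}. K *v (s y j - A *v f1 m j) + L *v v j + C *v f1 m j)" for m y and v :: "nat \<Rightarrow> real^'n"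
  define q where "q w y = (\<integral>v. (indicator {snd w} (g2 (r (fst w) y v)) :: real) \<partial>gblock n)" for w :: "nat \<times> nat" and y
  \<comment> \<open>The simulated output inside \<open>q\<close> is formed with the codeword of
    \<open>fst w\<close>, not with the decoded one. The first factor makes the two agree wherever
    the product is nonzero, so the rule is one that receiver 1 can carry out.\<close>
  define k where "k w y = (indicator {fst w} (g1 (s y)) :: real) * q w y" for w y
  have sm [measurable]: "s \<in> measurable (PiM {..<n} (\<lambda>_. borel)) (PiM {..<n} (\<lambda>_. borel))"
    unfolding s_def by measurable
  have rm [measurable]: "(\<lambda>(y, v). r m y v) \<in> measurable (PiM {..<n} (\<lambda>_. borel) \<Otimes>\<^sub>M gblock n) (PiM {..<n} (\<lambda>_. borel))" for m
  proof -
    have [measurable]: "(\<lambda>x. s (fst x) j) \<in> borel_measurable (PiM {..<n} (\<lambda>_. borel) \<Otimes>\<^sub>M gblock n)" if "j \<in> {..<n}" for j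
    proof -
      note that [measurable]
      have "(\<lambda>x. fst x j + (A *v emean W1 f1 j + B *v emean W2 f2 j)) \<in> borel_measurable (PiM {..<n} (\<lambda>_. borel) \<Otimes>\<^sub>M gblock n)"
        by measurable
      then show ?thesis using that by (simp add: s_def)
    qed
    show ?thesis unfolding r_def case_prod_beta by measurable
  qed
  have im: "(\<lambda>(y, v). indicator {m2} (g2 (r m y v)) :: real) \<in> borel_measurable (PiM {..<n} (\<lambda>_. borel) \<Otimes>\<^sub>M gblock n)" for m m2
  proof -
    have "(\<lambda>x. indicator {m2} (g2 ((\<lambda>(y, v). r m y v) x)) :: real) \<in> borel_measurable (PiM {..<n} (\<lambda>_. borel) \<Otimes>\<^sub>M gblock n)"
      by (rule measurable_compose[OF measurable_compose[OF rm g2]]) simp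
    then show ?thesis by (simp add: case_prod_beta)
  qed
  have qm: "q w \<in> borel_measurable (PiM {..<n} (\<lambda>_. borel))" for w
    unfolding q_def by (rule G.borel_measurable_lebesgue_integral) (rule im)
  have k1m: "(\<lambda>y. indicator {m} (g1 (s y)) :: real) \<in> borel_measurable (PiM {..<n} (\<lambda>_. borel))" for m
    by (rule measurable_compose[OF measurable_compose[OF sm g1]]) simp
  have km: "k w \<in> borel_measurable (PiM {..<n} (\<lambda>_. borel))" for w
    unfolding k_def by (intro borel_measurable_times k1m qm)
  have iv: "integrable (gblock n) (\<lambda>v. indicator {m2} (g2 (r m y v)) :: real)" if "y \<in> space (PiM {..<n} (\<lambda>_. borel))" for y m m2
  proof (rule G.integrable_const_bound[where B = 1])
    show "(\<lambda>v. indicator {m2} (g2 (r m y v)) :: real) \<in> borel_measurable (gblock n)"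
      using measurable_compose[OF measurable_Pair1'[OF that] im[of m2 m]] by simp
  qed (simp add: indicator_def)
  have q0: "0 \<le> q w y" for w y unfolding q_def by (rule Bochner_Integration.integral_nonneg) simp
  have q1: "q w y \<le> 1" for w y
  \<comment> \<open>The bound is wanted for every \<open>y\<close>, also where the section is not
    integrable; there the integral is 0 by convention.\<close>
  proof (cases "integrable (gblock n) (\<lambda>v. indicator {snd w} (g2 (r (fst w) y v)) :: real)")
    case True
    then have "q w y \<le> (\<integral>v. 1 \<partial>(gblock n :: (nat \<Rightarrow> real^'n) measure))"
      unfolding q_def by (intro integral_mono) (auto simp: indicator_def)
    then show ?thesis by (simp add: G.prob_space)
  next
    case False
    then show ?thesis by (simp add: q_def not_integrable_integral_eq)
  qed
  have k0: "0 \<le> k w y" and k1: "k w y \<le> 1" for w y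
    using q0[of w y] q1[of w y] by (auto simp: k_def indicator_def)
  have c: "real (card W1) > 0" "real (card W2) > 0" using W by (auto simp: card_gt_0_iff)
  have sum: "(\<Sum>w\<in>W1 \<times> W2. k w y) \<le> card (W1 \<times> W2) / (real (card W1) * real (card W2))"
    if y: "y \<in> space (PiM {..<n} (\<lambda>_. borel))" for y
  proof -
    have q2: "(\<Sum>m2\<in>W2. q (m1, m2) y) \<le> 1" for m1
    proof -
      have "(\<Sum>m2\<in>W2. q (m1, m2) y) = (\<integral>v. (\<Sum>m2\<in>W2. indicator {m2} (g2 (r m1 y v))) \<partial>gblock n)"
        unfolding q_def using iv[OF y] by (simp add: Bochner_Integration.integral_sum)
      also have "\<dots> \<le> (\<integral>v. 1 \<partial>(gblock n :: (nat \<Rightarrow> real^'n) measure))"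
      proof (rule integral_mono)
        fix v
        show "(\<Sum>m2\<in>W2. indicator {m2} (g2 (r m1 y v)) :: real) \<le> 1"
          using sum_indicator_singleton_le[OF W(3), of "g2 (r m1 y v)"] by (simp add: indicator_def eq_commute)
      qed (auto intro!: iv[OF y])
      finally show ?thesis by (simp add: G.prob_space)
    qed
    have "(\<Sum>w\<in>W1 \<times> W2. k w y) = (\<Sum>m1\<in>W1. \<Sum>m2\<in>W2. k (m1, m2) y)"
      by (simp add: sum.cartesian_product)
    also have "\<dots> = (\<Sum>m1\<in>W1. indicator {g1 (s y)} m1 * (\<Sum>m2\<in>W2. q (m1, m2) y))"
      by (simp add: k_def sum_distrib_left indicator_def eq_commute)
    also have "\<dots> \<le> (\<Sum>m1\<in>W1. indicator {g1 (s y)} m1 * 1)"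
      by (intro sum_mono mult_left_mono q2) simp
    also have "\<dots> \<le> 1" using sum_indicator_singleton_le[OF W(1)] by simp
    finally show ?thesis using c by (simp add: card_cartesian_product)
  qed
  have sd: "s (\<lambda>j\<in>{..<n}. z j + d w j) = received A B n (f1 (fst w)) (f2 (snd w)) z" for w z
    by (auto simp: s_def d_def received_def matrix_vector_mult_diff_distrib)
  have rd: "r (fst w) (\<lambda>j\<in>{..<n}. z j + d w j) v = received D C n (f2 (snd w)) (f1 (fst w)) (\<lambda>j\<in>{..<n}. K *v z j + L *v v j)" for w z v
    unfolding r_def sd by (auto simp: received_def D matrix_vector_right_distrib matrix_vector_mul_assoc[symmetric] add_ac)
  have dm: "(\<lambda>z. \<lambda>j\<in>{..<n}. z j + d w j) \<in> measurable (gblock n) (PiM {..<n} (\<lambda>_. borel))" for w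
    by measurable
  have dsp: "(\<lambda>j\<in>{..<n}. z j + d w j) \<in> space (PiM {..<n} (\<lambda>_. borel))" for w and z :: "nat \<Rightarrow> real^'n"
    by (auto simp: space_PiM)
  \<comment> \<open>A union bound: success at both receivers has at least the probability of the
    second success minus that of the first failure. By the mixing lemma \<open>Q\<close> has the
    mean that receiver 2 itself achieves.\<close>
  have E: "measure (gblock n) {z \<in> space (gblock n). g2 (received D C n (f2 (snd w)) (f1 (fst w)) z) = snd w}
      - (1 - measure (gblock n) {z \<in> space (gblock n). g1 (received A B n (f1 (fst w)) (f2 (snd w)) z) = fst w})
      \<le> (\<integral>z. k w (\<lambda>j\<in>{..<n}. z j + d w j) \<partial>gblock n)" for w
  proof -
    define I where "I z = (indicator {fst w} (g1 (s (\<lambda>j\<in>{..<n}. z j + d w j))) :: real)" for z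
    define Q where "Q z = q w (\<lambda>j\<in>{..<n}. z j + d w j)" for z
    have Im: "I \<in> borel_measurable (gblock n)"
      unfolding I_def by (rule measurable_compose[OF dm k1m])
    have Qm: "Q \<in> borel_measurable (gblock n)"
      unfolding Q_def by (rule measurable_compose[OF dm qm])
    have Ii: "integrable (gblock n) I"
      by (rule G.integrable_const_bound[where B = 1]) (use Im in \<open>auto simp: I_def indicator_def\<close>)
    have Qi: "integrable (gblock n) Q"
      by (rule G.integrable_const_bound[where B = 1]) (use Qm q0 q1 in \<open>auto simp: Q_def\<close>)
    have IQi: "integrable (gblock n) (\<lambda>z. I z * Q z)"
    proof (rule G.integrable_const_bound[where B = 1])
      show "(\<lambda>z. I z * Q z) \<in> borel_measurable (gblock n)" by (intro borel_measurable_times Im Qm)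
      show "AE z in gblock n. norm (I z * Q z) \<le> 1"
        using q0[of w] q1[of w] by (auto simp: I_def Q_def indicator_def)
    qed
    have I: "(\<integral>z. I z \<partial>gblock n) = measure (gblock n) {z \<in> space (gblock n). g1 (received A B n (f1 (fst w)) (f2 (snd w)) z) = fst w}"
    proof -
      have "(\<integral>z. I z \<partial>gblock n) = (\<integral>z. indicator {z \<in> space (gblock n). g1 (received A B n (f1 (fst w)) (f2 (snd w)) z) = fst w} z \<partial>gblock n)"
        by (intro Bochner_Integration.integral_cong refl) (simp add: I_def sd indicator_def)
      then show ?thesis using error_event_measurable[OF g1, where A = A and B = B and P = "\<lambda>m. m = fst w"] by simp
    qed
    have Q: "(\<integral>z. Q z \<partial>gblock n) = measure (gblock n) {z \<in> space (gblock n). g2 (received D C n (f2 (snd w)) (f1 (fst w)) z) = snd w}"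
    proof -
      define u where "u x = (\<lambda>j\<in>{..<n}. K *v fst x j + L *v snd x j)" for x :: "(nat \<Rightarrow> real^'n) \<times> (nat \<Rightarrow> real^'n)"
      define F where "F y = (indicator {snd w} (g2 (received D C n (f2 (snd w)) (f1 (fst w)) y)) :: real)" for y
      have um: "u \<in> measurable (gblock n \<Otimes>\<^sub>M gblock n) (PiM {..<n} (\<lambda>_. borel))"
        unfolding u_def by measurable
      have Fm: "F \<in> borel_measurable (PiM {..<n} (\<lambda>_. borel))"
        unfolding F_def by (rule measurable_compose[OF measurable_compose[OF received_measurable g2]]) simp
      have Fi: "integrable (gblock n \<Otimes>\<^sub>M gblock n) (\<lambda>x. F (u x))"
        by (rule GG.P.integrable_const_bound[where B = 1]) (use measurable_compose[OF um Fm] in \<open>auto simp: F_def indicator_def\<close>)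
      have "(\<integral>z. Q z \<partial>gblock n) = (\<integral>z. \<integral>v. F (u (z, v)) \<partial>gblock n \<partial>gblock n)"
        by (simp add: Q_def q_def rd F_def u_def)
      also have "\<dots> = (\<integral>x. F (u x) \<partial>(gblock n \<Otimes>\<^sub>M gblock n))"
        by (rule GG.integral_fst'[OF Fi])
      also have "\<dots> = (\<integral>y. F y \<partial>distr (gblock n \<Otimes>\<^sub>M gblock n) (PiM {..<n} (\<lambda>_. borel)) u)"
        by (rule integral_distr[symmetric, OF um Fm])
      also have "distr (gblock n \<Otimes>\<^sub>M gblock n) (PiM {..<n} (\<lambda>_. borel)) u = gblock n"
        using distr_gblock_mix[OF K KL, of n] by (simp add: u_def[abs_def] case_prod_beta')
      also have "(\<integral>y. F y \<partial>gblock n) = (\<integral>z. indicator {z \<in> space (gblock n). g2 (received D C n (f2 (snd w)) (f1 (fst w)) z) = snd w} z \<partial>gblock n)"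
        by (intro Bochner_Integration.integral_cong refl) (simp add: F_def indicator_def)
      finally show ?thesis using error_event_measurable[OF g2, where A = D and B = C and P = "\<lambda>m. m = snd w"] by simp
    qed
    have "(\<integral>z. Q z - (1 - I z) \<partial>gblock n) \<le> (\<integral>z. I z * Q z \<partial>gblock n)"
    proof (rule integral_mono)
      show "integrable (gblock n) (\<lambda>z. Q z - (1 - I z))" using Qi Ii by simp
      fix z show "Q z - (1 - I z) \<le> I z * Q z"
        using q0[of w] q1[of w] by (auto simp: I_def Q_def indicator_def)
    qed (rule IQi)
    then show ?thesis
      using Qi Ii by (simp add: I Q G.prob_space k_def I_def[symmetric] Q_def[symmetric])
  qed
  have S: "mat 1 + (1 / (real n * real (card (W1 \<times> W2)))) *\<^sub>R (\<Sum>w\<in>W1 \<times> W2. \<Sum>j<n. outer (d w j)) =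
      mat 1 + A ** ecov n W1 f1 ** transpose A + B ** ecov n W2 f2 ** transpose B"
  proof -
    have m0: "(\<Sum>m\<in>W. M *v (f m j - emean W f j)) = 0" if "finite W" "W \<noteq> {}" for M :: "real^'n^'n" and W f j
    proof -
      have "(\<Sum>m\<in>W. M *v (f m j - emean W f j)) = M *v (\<Sum>m\<in>W. f m j - emean W f j)"
        by (rule linear_sum[symmetric]) simp
      then show ?thesis by (simp add: sum_emean[OF that])
    qed
    have "(\<Sum>w\<in>W1 \<times> W2. \<Sum>j<n. outer (d w j)) = (\<Sum>j<n. \<Sum>w\<in>W1 \<times> W2. outer (d w j))"
      by (rule sum.swap)
    also have "\<dots> = (\<Sum>j<n. real (card W2) *\<^sub>R (\<Sum>m\<in>W1. outer (A *v (f1 m j - emean W1 f1 j))) +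
        real (card W1) *\<^sub>R (\<Sum>m\<in>W2. outer (B *v (f2 m j - emean W2 f2 j))))"
    proof (rule sum.cong[OF refl])
      fix j
      show "(\<Sum>w\<in>W1 \<times> W2. outer (d w j)) = real (card W2) *\<^sub>R (\<Sum>m\<in>W1. outer (A *v (f1 m j - emean W1 f1 j))) +
        real (card W1) *\<^sub>R (\<Sum>m\<in>W2. outer (B *v (f2 m j - emean W2 f2 j)))"
        using sum_outer_add[OF m0[OF W(1,2), of A f1 j] m0[OF W(3,4), of B f2 j]] by (simp add: d_def case_prod_beta)
    qed
    also have "\<dots> = real (card W2) *\<^sub>R (A ** (\<Sum>m\<in>W1. \<Sum>j<n. outer (f1 m j - emean W1 f1 j)) ** transpose A) +
       real (card W1) *\<^sub>R (B ** (\<Sum>m\<in>W2. \<Sum>j<n. outer (f2 m j - emean W2 f2 j)) ** transpose B)"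
      unfolding outer_matrix_vector sum.distrib scaleR_sum_right[symmetric]
      by (subst (1 2) sum.swap) (simp add: matrix_mult_sum_left matrix_mult_sum_right)
    finally show ?thesis
      using c by (simp add: ecov_def matrix_mult_scaleR_left matrix_mult_scaleR_right card_cartesian_product scaleR_add_right add.assoc)
  qed
  have "(1 / card (W1 \<times> W2)) * (\<Sum>w\<in>W1 \<times> W2. \<integral>z. k w (\<lambda>j\<in>{..<n}. z j + d w j) \<partial>gblock n) * ln (real (card W1) * real (card W2)) \<le>
    real n / 2 * ln (det (mat 1 + (1 / (real n * real (card (W1 \<times> W2)))) *\<^sub>R (\<Sum>w\<in>W1 \<times> W2. \<Sum>j<n. outer (d w j)))) + ln 2"
  proof (rule gaussian_code_converse)
    have "1 \<le> card W1 * card W2" using W by (simp add: Suc_le_eq card_gt_0_iff)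
    then show "1 \<le> real (card W1) * real (card W2)" by (metis of_nat_1 of_nat_le_iff of_nat_mult)
    show "(\<Sum>w\<in>W1 \<times> W2. k w y) \<le> card (W1 \<times> W2) / (real (card W1) * real (card W2))"
      if "y \<in> space (PiM {..<n} (\<lambda>_. borel))" for y by (rule sum[OF that])
  qed (use W n in \<open>auto intro: km k0 k1\<close>)
  moreover have "(1 - err A B n W1 W2 f1 f2 g1 - err D C n W2 W1 f2 f1 g2) \<le>
     (1 / card (W1 \<times> W2)) * (\<Sum>w\<in>W1 \<times> W2. \<integral>z. k w (\<lambda>j\<in>{..<n}. z j + d w j) \<partial>gblock n)"
  proof -
    let ?N = "real (card W1) * real (card W2)"
    define p1 where "p1 w = measure (gblock n) {z \<in> space (gblock n). g1 (received A B n (f1 (fst w)) (f2 (snd w)) z) = fst w}" for w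
    define p2 where "p2 w = measure (gblock n) {z \<in> space (gblock n). g2 (received D C n (f2 (snd w)) (f1 (fst w)) z) = snd w}" for w
    have 1: "(\<Sum>w\<in>W1 \<times> W2. p1 w) = ?N * (1 - err A B n W1 W2 f1 f2 g1)"
      unfolding err_complement[OF W g1, of A B f1 f2, symmetric] using c by (simp add: p1_def case_prod_beta)
    have "(\<Sum>w\<in>W1 \<times> W2. p2 w) = (\<Sum>(m2, m1)\<in>W2 \<times> W1. p2 (m1, m2))"
      using sum.swap[of "\<lambda>m1 m2. p2 (m1, m2)" W2 W1] by (simp add: sum.cartesian_product)
    then have 2: "(\<Sum>w\<in>W1 \<times> W2. p2 w) = ?N * (1 - err D C n W2 W1 f2 f1 g2)"
      unfolding err_complement[OF W(3,4,1,2) g2, of D C f2 f1, symmetric] using c by (simp add: p2_def case_prod_beta)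
    have "?N * (1 - err A B n W1 W2 f1 f2 g1 - err D C n W2 W1 f2 f1 g2) = (\<Sum>w\<in>W1 \<times> W2. p2 w - (1 - p1 w))"
    proof -
      have "(\<Sum>w\<in>W1 \<times> W2. p2 w - (1 - p1 w)) = (\<Sum>w\<in>W1 \<times> W2. p2 w) - (?N - (\<Sum>w\<in>W1 \<times> W2. p1 w))"
        by (simp only: sum_subtractf card_cartesian_product sum_constant of_nat_mult mult_1_right)
      then show ?thesis unfolding 1 2 by (simp add: algebra_simps)
    qed
    also have "\<dots> \<le> (\<Sum>w\<in>W1 \<times> W2. \<integral>z. k w (\<lambda>j\<in>{..<n}. z j + d w j) \<partial>gblock n)"
      unfolding p1_def p2_def by (rule sum_mono) (rule E)
    finally show ?thesis using c by (simp add: card_cartesian_product field_simps)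
  qed
  moreover have "0 \<le> ln (real (card W1) * real (card W2))"
  proof -
    have "1 \<le> card W1 * card W2" using W by (simp add: Suc_le_eq card_gt_0_iff)
    then have "1 \<le> real (card W1) * real (card W2)" by (metis of_nat_1 of_nat_le_iff of_nat_mult)
    then show ?thesis by simp
  qed
  ultimately show ?thesis
    unfolding S by (meson mult_right_mono order_trans)
qed

section \<open>Random coding\<close>

lemma exp_minus_le_quadratic:
  fixes y :: real
  shows "exp (- y) \<le> 1 - y + y\<^sup>2 / 2 * exp \<bar>y\<bar>"
proof -
  obtain t where t: "\<bar>t\<bar> \<le> \<bar>- y\<bar>" "exp (- y) = (\<Sum>m<2. (- y) ^ m / fact m) + exp t / fact 2 * (- y) ^ 2"
    using Maclaurin_exp_le[of "- y" 2] by blast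
  have "exp t \<le> exp \<bar>y\<bar>" using t(1) by simp
  then have "exp t * y\<^sup>2 \<le> exp \<bar>y\<bar> * y\<^sup>2" by (rule mult_right_mono) simp
  then show ?thesis using t(2) by (simp add: numeral_2_eq_2 mult.commute)
qed

lemma integrable_exp_moment:
  fixes X :: "'a \<Rightarrow> real"
  assumes [measurable]: "X \<in> borel_measurable M" and s: "s > 0"
    and fin: "(\<integral>\<^sup>+x. ennreal (exp (s * \<bar>X x\<bar>)) \<partial>M) < \<infinity>"
  shows "integrable M (\<lambda>x. exp (s * \<bar>X x\<bar>))" "integrable M X"
proof -
  show eI: "integrable M (\<lambda>x. exp (s * \<bar>X x\<bar>))"
    by (rule integrableI_bounded) (use fin in auto)
  show "integrable M X"
  proof (rule Bochner_Integration.integrable_bound)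
    show "integrable M (\<lambda>x. exp (s * \<bar>X x\<bar>) / s)" using eI by simp
    have "\<bar>X x\<bar> \<le> exp (s * \<bar>X x\<bar>) / s" for x
    proof -
      have "s * \<bar>X x\<bar> \<le> exp (s * \<bar>X x\<bar>)" using exp_ge_add_one_self[of "s * \<bar>X x\<bar>"] by linarith
      then show ?thesis using s by (simp add: field_simps)
    qed
    then show "AE x in M. norm (X x) \<le> norm (exp (s * \<bar>X x\<bar>) / s)" using s by simp
  qed simp
qed

text \<open>As a function of \<open>t\<close>, the mean of exp(- t (X - a)) is 1 - t (E X - a) up to
  a quadratic error, hence below 1 for small positive \<open>t\<close>. The exponential moment
  controls the quadratic error.\<close>

lemma (in prob_space) chernoff_bound:
  fixes X :: "'a \<Rightarrow> real"
  assumes X [measurable]: "X \<in> borel_measurable M" and s: "s > 0"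
    and fin: "(\<integral>\<^sup>+x. ennreal (exp (s * \<bar>X x\<bar>)) \<partial>M) < \<infinity>" and a: "a < expectation X"
  shows "\<exists>t>0. \<exists>\<tau>. 0 \<le> \<tau> \<and> \<tau> < 1 \<and> (\<integral>\<^sup>+x. ennreal (exp (- t * (X x - a))) \<partial>M) \<le> ennreal \<tau>"
proof -
  \<comment> \<open>The factor \<open>4 / s\<^sup>2\<close> comes from
    \<open>u\<^sup>2 / 2 \<le> exp u\<close> at u = s |X| / 2, which bounds X^2 by 8/s^2 times an
    exponential, and from the 1/2 in the Taylor remainder.\<close>
  define K where "K = 4 / s\<^sup>2 * expectation (\<lambda>x. exp (s * \<bar>X x\<bar>))"
  note eI = integrable_exp_moment(1)[OF X s fin] and XI = integrable_exp_moment(2)[OF X s fin]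
  have K: "K \<ge> 0" unfolding K_def by (intro mult_nonneg_nonneg Bochner_Integration.integral_nonneg) auto
  \<comment> \<open>The second bound keeps \<open>t * K\<close> below the gap
    \<open>expectation X - a\<close>. The first spends at most half of the exponent \<open>s\<close>
    on the Taylor remainder and leaves the other half to dominate the square.\<close>
  define t where "t = min (s / 2) ((expectation X - a) / (2 * (K + 1)))"
  have t: "t > 0" using s a K by (auto simp: t_def)
  have ts: "t \<le> s / 2" unfolding t_def by (rule min.cobounded1)
  have "t * K < expectation X - a"
  proof -
    have "t * K \<le> (expectation X - a) / (2 * (K + 1)) * K" using K by (intro mult_right_mono) (auto simp: t_def)
    also have "\<dots> = (expectation X - a) * (K / (2 * (K + 1)))" by simp
    also have "\<dots> < (expectation X - a) * 1" using a K by (intro mult_strict_left_mono) (auto simp: field_simps)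
    finally show ?thesis by simp
  qed
  have bound: "exp (- t * (X x - a)) \<le> exp (t * a) * (1 - t * X x + t\<^sup>2 * (4 / s\<^sup>2 * exp (s * \<bar>X x\<bar>)))" for x
  proof -
    let ?u = "\<bar>X x\<bar>"
    have "(s / 2 * ?u)\<^sup>2 / 2 \<le> exp (s / 2 * ?u)"
    proof -
      have "1 + s / 2 * ?u + (s / 2 * ?u)\<^sup>2 / 2 \<le> exp (s / 2 * ?u)"
        using s by (intro exp_lower_Taylor_quadratic) auto
      moreover have "0 \<le> s / 2 * ?u" using s by simp
      ultimately show ?thesis by linarith
    qed
    then have sq: "(X x)\<^sup>2 \<le> 8 / s\<^sup>2 * exp (s / 2 * ?u)" using s by (simp add: field_simps power2_eq_square)
    have "exp (- (t * X x)) \<le> 1 - t * X x + (t * X x)\<^sup>2 / 2 * exp \<bar>t * X x\<bar>"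
      by (rule exp_minus_le_quadratic)
    also have "(t * X x)\<^sup>2 / 2 * exp \<bar>t * X x\<bar> \<le> (t\<^sup>2 * (8 / s\<^sup>2 * exp (s / 2 * ?u))) / 2 * exp (s / 2 * ?u)"
    proof (intro mult_mono)
      show "(t * X x)\<^sup>2 / 2 \<le> t\<^sup>2 * (8 / s\<^sup>2 * exp (s / 2 * ?u)) / 2"
        unfolding power_mult_distrib using sq by (intro divide_right_mono mult_left_mono) auto
      have "\<bar>t * X x\<bar> \<le> s / 2 * ?u" unfolding abs_mult using t ts by (intro mult_mono) auto
      then show "exp \<bar>t * X x\<bar> \<le> exp (s / 2 * ?u)" by simp
    qed auto
    also have "\<dots> = t\<^sup>2 * (4 / s\<^sup>2 * exp (s * ?u))"
      by (simp add: exp_add[symmetric] mult.assoc)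
    finally have "exp (- (t * X x)) \<le> 1 - t * X x + t\<^sup>2 * (4 / s\<^sup>2 * exp (s * ?u))" by simp
    then have "exp (t * a) * exp (- (t * X x)) \<le> exp (t * a) * (1 - t * X x + t\<^sup>2 * (4 / s\<^sup>2 * exp (s * ?u)))"
      by (rule mult_left_mono) simp
    then show ?thesis by (simp add: exp_add[symmetric] algebra_simps)
  qed
  define \<tau> where "\<tau> = exp (t * a) * (1 - t * expectation X + t\<^sup>2 * K)"
  have BI: "has_bochner_integral M (\<lambda>x. exp (t * a) * (1 - t * X x + t\<^sup>2 * (4 / s\<^sup>2 * exp (s * \<bar>X x\<bar>)))) \<tau>"
    unfolding \<tau>_def K_def using XI eI by (simp add: has_bochner_integral_iff prob_space)
  have pos: "0 \<le> exp (t * a) * (1 - t * X x + t\<^sup>2 * (4 / s\<^sup>2 * exp (s * \<bar>X x\<bar>)))" for x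
    by (rule order_trans[OF _ bound]) simp
  have "(\<integral>\<^sup>+x. ennreal (exp (- t * (X x - a))) \<partial>M) \<le>
      (\<integral>\<^sup>+x. ennreal (exp (t * a) * (1 - t * X x + t\<^sup>2 * (4 / s\<^sup>2 * exp (s * \<bar>X x\<bar>)))) \<partial>M)"
    using bound by (intro nn_integral_mono ennreal_leI) auto
  also have "\<dots> = ennreal \<tau>"
    using BI pos by (subst nn_integral_eq_integral) (auto simp: has_bochner_integral_iff)
  finally have 1: "(\<integral>\<^sup>+x. ennreal (exp (- t * (X x - a))) \<partial>M) \<le> ennreal \<tau>" .
  have 2: "0 \<le> \<tau>" 
    unfolding has_bochner_integral_integral_eq[OF BI, symmetric] by (rule Bochner_Integration.integral_nonneg) (rule pos)
  have "\<tau> \<le> exp (t * a) * exp (- t * expectation X + t\<^sup>2 * K)"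
    unfolding \<tau>_def using exp_ge_add_one_self[of "- t * expectation X + t\<^sup>2 * K"] by (intro mult_left_mono, linarith, simp)
  also have "\<dots> = exp (t * (t * K - (expectation X - a)))"
    by (simp add: exp_add[symmetric] power2_eq_square algebra_simps)
  also have "\<dots> < 1" using t \<open>t * K < expectation X - a\<close> by (simp add: mult_less_0_iff)
  finally show ?thesis using 1 2 t by blast
qed

lemma has_bochner_integral_qform:
  fixes S C :: "real^'n^'n"
  assumes "pdef S"
  shows "has_bochner_integral std_gaussian (\<lambda>z. qform S (d + C *v z)) (trace (matrix_inv S ** (C ** transpose C)) + qform S d)"
proof -
  interpret prob_space "std_gaussian :: (real^'n) measure" by simp
  let ?I = "matrix_inv S"
  have q: "qform S (d + C *v z) = z \<bullet> ((transpose C ** ?I ** C) *v z) + 2 * ((transpose C *v (?I *v d)) \<bullet> z) + qform S d" for z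
  proof -
    have "d \<bullet> (?I *v (C *v z)) = (?I *v d) \<bullet> (C *v z)"
      by (simp add: inner_matrix_vector[of d] pdef_matrix_inv_sym[OF assms])
    moreover have "(?I *v d) \<bullet> (C *v z) = (transpose C *v (?I *v d)) \<bullet> z"
      by (rule inner_matrix_vector)
    moreover have "(C *v z) \<bullet> (?I *v (C *v z)) = z \<bullet> ((transpose C ** ?I ** C) *v z)"
      by (simp add: matrix_vector_mul_assoc[symmetric] inner_matrix_vector[of z "transpose C"])
    ultimately show ?thesis
      by (simp add: qform_def matrix_vector_right_distrib inner_add_left inner_add_right inner_commute[of "C *v z" "?I *v d"])
  qed
  have c: "has_bochner_integral (std_gaussian :: (real^'n) measure) (\<lambda>_. a) a" for a :: real
    using prob_space by (simp add: has_bochner_integral_iff)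
  have "has_bochner_integral std_gaussian
     (\<lambda>z. z \<bullet> ((transpose C ** ?I ** C) *v z) + 2 * ((transpose C *v (?I *v d)) \<bullet> z) + qform S d)
     (trace (transpose C ** ?I ** C) + 2 * 0 + qform S d)"
    by (intro has_bochner_integral_add has_bochner_integral_mult_right c
       has_bochner_integral_std_gaussian_quadratic has_bochner_integral_std_gaussian_linear)
  moreover have "trace (transpose C ** ?I ** C) = trace (?I ** (C ** transpose C))"
    by (metis matrix_mul_assoc trace_mul_sym)
  ultimately show ?thesis by (simp add: q)
qed

lemma exists_bound_matrix: "\<exists>K\<ge>0. \<forall>x. \<bar>x \<bullet> (A *v x)\<bar> \<le> K * (x \<bullet> x)" for A :: "real^'n^'n"
proof -
  obtain K where K: "K > 0" "\<And>x. norm (A *v x) \<le> norm x * K"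
    using bounded_linear.pos_bounded[OF matrix_vector_mul_bounded_linear[of A]] by blast
  have "\<bar>x \<bullet> (A *v x)\<bar> \<le> K * (x \<bullet> x)" for x
  proof -
    have "\<bar>x \<bullet> (A *v x)\<bar> \<le> norm x * norm (A *v x)" by (rule Cauchy_Schwarz_ineq2)
    also have "\<dots> \<le> norm x * (norm x * K)" by (intro mult_left_mono K) simp
    finally show ?thesis by (simp add: dot_square_norm power2_eq_square mult_ac)
  qed
  then show ?thesis using K(1) by (intro exI[of _ K]) auto
qed

lemma norm_sum3_sq: "(a + b + c) \<bullet> (a + b + c) \<le> 3 * (a \<bullet> a + b \<bullet> b + c \<bullet> c)" for a b c :: "real^'n"
proof -
  have "0 \<le> (a - b) \<bullet> (a - b) + (b - c) \<bullet> (b - c) + (a - c) \<bullet> (a - c)" by simp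
  then show ?thesis by (simp add: inner_add_left inner_add_right inner_diff_left inner_diff_right inner_commute algebra_simps)
qed

section \<open>Information density: exponential moments and mean\<close>

abbreviation gauss3 :: "((real^'n) \<times> (real^'n) \<times> (real^'n)) measure" where
  "gauss3 \<equiv> std_gaussian \<Otimes>\<^sub>M (std_gaussian \<Otimes>\<^sub>M std_gaussian)"

lemma prob_space_gauss3: "prob_space gauss3"
  by (intro prob_space_pair) simp_all

lemma nn_integral_gauss3:
  assumes "f \<in> borel_measurable (gauss3 :: ((real^'n) \<times> (real^'n) \<times> (real^'n)) measure)"
  shows "(\<integral>\<^sup>+x. f x \<partial>gauss3) = (\<integral>\<^sup>+u. \<integral>\<^sup>+v. \<integral>\<^sup>+z. f (u, v, z :: real^'n) \<partial>std_gaussian \<partial>std_gaussian \<partial>std_gaussian)"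
proof -
  interpret G: sigma_finite_measure "std_gaussian :: (real^'n) measure"
    by (rule prob_space_imp_sigma_finite) simp
  interpret GG: sigma_finite_measure "(std_gaussian :: (real^'n) measure) \<Otimes>\<^sub>M (std_gaussian :: (real^'n) measure)"
    by (rule prob_space_imp_sigma_finite) (simp add: prob_space_pair)
  note [measurable] = assms
  have "(\<integral>\<^sup>+x. f x \<partial>gauss3) = (\<integral>\<^sup>+u. \<integral>\<^sup>+p. f (u, p) \<partial>(std_gaussian \<Otimes>\<^sub>M std_gaussian) \<partial>std_gaussian)"
    by (rule GG.nn_integral_fst[symmetric]) (rule assms)
  also have "\<dots> = (\<integral>\<^sup>+u. \<integral>\<^sup>+v. \<integral>\<^sup>+z. f (u, v, z) \<partial>std_gaussian \<partial>std_gaussian \<partial>std_gaussian)"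
    by (intro nn_integral_cong G.nn_integral_fst[symmetric]) measurable
  finally show ?thesis .
qed

text \<open>The information density of one channel use, in terms of the noise: \<open>z\<close> is \<open>y - A u - C v\<close> and
  \<open>tilt\<close> at \<open>z\<close> is the output density at \<open>y\<close> divided by the noise density.\<close>

definition infod :: "real^'n^'n \<Rightarrow> real^'n^'n \<Rightarrow> real^'n^'n \<Rightarrow> (real^'n) \<times> (real^'n) \<times> (real^'n) \<Rightarrow> real" where
  "infod S A C = (\<lambda>(u, v, z). - ln (tilt S (A *v u + C *v v) z))"

lemma infod_measurable [measurable]: "infod S A C \<in> borel_measurable gauss3"
proof -
  have "(\<lambda>x. - ln (gdens S (snd (snd x) + (A *v fst x + C *v fst (snd x))) / phi (snd (snd x)))) \<in> borel_measurable gauss3"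
    by measurable
  then show ?thesis by (simp add: infod_def tilt_def case_prod_beta)
qed

lemma infod_eq:
  assumes "pdef S"
  shows "infod S A C (u, v, z) = (qform S (A *v u + C *v v + z) - z \<bullet> z + ln (det S)) / 2"
  by (simp add: infod_def ln_tilt[OF assms] add_ac field_simps)

text \<open>The information density grows at most quadratically in \<open>(u, v, z)\<close>, and a
  small multiple of the squared norm of a Gaussian vector has a finite exponential moment.\<close>

lemma infod_exp_moment:
  fixes S A C :: "real^'n^'n"
  assumes S: "pdef S"
  shows "\<exists>s>0. (\<integral>\<^sup>+x. ennreal (exp (s * \<bar>infod S A C x\<bar>)) \<partial>gauss3) < \<infinity>"
proof -
  obtain K0 where K0: "K0 \<ge> 0" "\<And>x. \<bar>x \<bullet> (matrix_inv S *v x)\<bar> \<le> K0 * (x \<bullet> x)" using exists_bound_matrix by blast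
  obtain K1 where K1: "K1 \<ge> 0" "\<And>x. \<bar>x \<bullet> ((transpose A ** A) *v x)\<bar> \<le> K1 * (x \<bullet> x)" using exists_bound_matrix by blast
  obtain K2 where K2: "K2 \<ge> 0" "\<And>x. \<bar>x \<bullet> ((transpose C ** C) *v x)\<bar> \<le> K2 * (x \<bullet> x)" using exists_bound_matrix by blast
  define K where "K = 3 * K0 * (K1 + K2 + 1) + 1"
  have K: "K > 0" unfolding K_def using K0(1) K1(1) K2(1) by (intro add_nonneg_pos mult_nonneg_nonneg) auto
  define c where "c = \<bar>ln (det S)\<bar>"
  have n: "(M *v x) \<bullet> (M *v x) = x \<bullet> ((transpose M ** M) *v x)" for M :: "real^'n^'n" and x
    by (simp add: matrix_vector_mul_assoc[symmetric] inner_matrix_vector[of x "transpose M"])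
  have b: "\<bar>infod S A C (u, v, z)\<bar> \<le> c + K * (u \<bullet> u + v \<bullet> v + z \<bullet> z)" for u v z
  proof -
    let ?y = "A *v u + C *v v + z"
    have "\<bar>qform S ?y\<bar> \<le> K0 * (?y \<bullet> ?y)" unfolding qform_def by (rule K0(2))
    also have "\<dots> \<le> K0 * (3 * ((A *v u) \<bullet> (A *v u) + (C *v v) \<bullet> (C *v v) + z \<bullet> z))"
      by (intro mult_left_mono norm_sum3_sq K0(1))
    also have "\<dots> \<le> K0 * (3 * (K1 * (u \<bullet> u) + K2 * (v \<bullet> v) + z \<bullet> z))"
      using K1(2)[of u] K2(2)[of v] unfolding n by (intro mult_left_mono K0(1) add_mono) auto
    also have "\<dots> \<le> K0 * (3 * ((K1 + K2 + 1) * (u \<bullet> u) + (K1 + K2 + 1) * (v \<bullet> v) + (K1 + K2 + 1) * (z \<bullet> z)))"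
      using K1(1) K2(1) mult_right_mono[of 1 "K1 + K2 + 1" "z \<bullet> z"] by (intro mult_left_mono K0(1) add_mono mult_right_mono) auto
    also have "\<dots> = (K - 1) * (u \<bullet> u + v \<bullet> v + z \<bullet> z)" by (simp add: K_def algebra_simps)
    finally have "\<bar>qform S ?y\<bar> + z \<bullet> z \<le> K * (u \<bullet> u + v \<bullet> v + z \<bullet> z)"
      using inner_ge_zero[of u] inner_ge_zero[of v] by (simp only: left_diff_distrib distrib_left mult_1)
    moreover have "\<bar>(q - r + l) / 2\<bar> \<le> \<bar>q\<bar> + r + \<bar>l\<bar>" if "0 \<le> r" for q r l :: real
    proof -
      have "\<bar>q - r + l\<bar> \<le> \<bar>q\<bar> + \<bar>r\<bar> + \<bar>l\<bar>" by linarith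
      then show ?thesis using that by simp
    qed
    from this[of "z \<bullet> z" "qform S ?y" "ln (det S)"]
    have "\<bar>infod S A C (u, v, z)\<bar> \<le> \<bar>qform S ?y\<bar> + z \<bullet> z + c"
      unfolding infod_eq[OF S] c_def by simp
    ultimately show ?thesis by linarith
  qed
  \<comment> \<open>Scales the quadratic bound to the rate 1/4 of
    \<open>nn_integral_std_gaussian_exp_norm\<close>.\<close>
  define s where "s = 1 / (4 * K)"
  have s: "s > 0" "s * K = 1/4" using K by (auto simp: s_def)
  have le: "exp (s * \<bar>infod S A C x\<bar>) \<le> exp (s * c) * (exp (1/4 * (fst x \<bullet> fst x)) * (exp (1/4 * (fst (snd x) \<bullet> fst (snd x))) * exp (1/4 * (snd (snd x) \<bullet> snd (snd x)))))" for x
  proof -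
    obtain u v z where x: "x = (u, v, z)" by (cases x)
    have "s * \<bar>infod S A C x\<bar> \<le> s * (c + K * (u \<bullet> u + v \<bullet> v + z \<bullet> z))"
      unfolding x using b s by (intro mult_left_mono) auto
    also have "\<dots> = s * c + (s * K) * (u \<bullet> u + v \<bullet> v + z \<bullet> z)" by (simp add: algebra_simps)
    also have "\<dots> = s * c + (1/4 * (u \<bullet> u) + (1/4 * (v \<bullet> v) + 1/4 * (z \<bullet> z)))"
      by (simp only: s(2) distrib_left add.assoc)
    finally have "exp (s * \<bar>infod S A C x\<bar>) \<le> exp (s * c + (1/4 * (u \<bullet> u) + (1/4 * (v \<bullet> v) + 1/4 * (z \<bullet> z))))"
      by (simp only: exp_le_cancel_iff)
    then show ?thesis by (simp only: exp_add x fst_conv snd_conv)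
  qed
  let ?g = "\<integral>\<^sup>+z. ennreal (exp (1/4 * (z \<bullet> z))) \<partial>(std_gaussian :: (real^'n) measure)"
  have "(\<integral>\<^sup>+x. ennreal (exp (s * \<bar>infod S A C x\<bar>)) \<partial>gauss3) \<le>
    (\<integral>\<^sup>+x. ennreal (exp (s * c)) * (ennreal (exp (1/4 * (fst x \<bullet> fst x))) * (ennreal (exp (1/4 * (fst (snd x) \<bullet> fst (snd x)))) * ennreal (exp (1/4 * (snd (snd x) \<bullet> snd (snd x)))))) \<partial>(gauss3 :: ((real^'n) \<times> (real^'n) \<times> (real^'n)) measure))"
    by (rule nn_integral_mono) (simp only: ennreal_mult[symmetric] exp_ge_zero mult_nonneg_nonneg ennreal_leI le)
  also have "\<dots> = ennreal (exp (s * c)) * (?g * (?g * ?g))"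
    by (subst nn_integral_gauss3, measurable) (simp add: nn_integral_cmult nn_integral_multc)
  also have "\<dots> < \<infinity>" using nn_integral_std_gaussian_exp_norm by (auto simp: ennreal_mult_less_top)
  finally show ?thesis using s(1) by blast
qed

text \<open>The mutual information between the pair of inputs and the output. The three sources
  contribute to the mean of the quadratic form the traces that add up to
  \<open>trace (matrix_inv S ** S)\<close>, the dimension, and this cancels the mean of
  \<open>z \<bullet> z\<close>.\<close>

lemma expectation_infod:
  fixes A C :: "real^'n^'n"
  defines "S \<equiv> mat 1 + A ** transpose A + C ** transpose C"
  shows "(\<integral>x. infod S A C x \<partial>gauss3) = ln (det S) / 2"
proof -
  interpret G: prob_space "std_gaussian :: (real^'n) measure" by simp
  interpret P: prob_space "gauss3 :: ((real^'n) \<times> (real^'n) \<times> (real^'n)) measure" by (rule prob_space_gauss3)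
  interpret GG: pair_prob_space "std_gaussian :: (real^'n) measure" "std_gaussian :: (real^'n) measure" ..
  interpret G3: pair_prob_space "std_gaussian :: (real^'n) measure" "(std_gaussian :: (real^'n) measure) \<Otimes>\<^sub>M (std_gaussian :: (real^'n) measure)"
    by unfold_locales
  have S: "pdef S" unfolding S_def by (intro pdef_add_psd pdef_mat_1 psd_gram)
  obtain s where s: "s > 0" "(\<integral>\<^sup>+x. ennreal (exp (s * \<bar>infod S A C x\<bar>)) \<partial>gauss3) < \<infinity>"
    using infod_exp_moment[OF S] by blast
  have I: "integrable gauss3 (infod S A C)"
    by (rule integrable_exp_moment(2)[OF infod_measurable s])
  let ?I = "matrix_inv S"
  let ?c = "(trace ?I - real CARD('n) + ln (det S)) / 2"
  have z: "(\<integral>z. infod S A C (u, v, z) \<partial>std_gaussian) = qform S (A *v u + C *v v) / 2 + ?c" for u v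
    using has_bochner_integral_ln_tilt[OF S, of "A *v u + C *v v"]
    by (simp add: infod_def has_bochner_integral_iff field_simps)
  have v: "(\<integral>v. qform S (A *v u + C *v v) / 2 + ?c \<partial>std_gaussian) = qform S (0 + A *v u) / 2 + (trace (?I ** (C ** transpose C)) / 2 + ?c)" for u
    using has_bochner_integral_qform[OF S, of "A *v u" C] G.prob_space by (simp add: has_bochner_integral_iff add_divide_distrib)
  have u: "(\<integral>u. qform S (0 + A *v u) / 2 + (trace (?I ** (C ** transpose C)) / 2 + ?c) \<partial>std_gaussian) =
      trace (?I ** (A ** transpose A)) / 2 + (trace (?I ** (C ** transpose C)) / 2 + ?c)"
    using has_bochner_integral_qform[OF S, of 0 A] G.prob_space by (simp add: has_bochner_integral_iff qform_def)
  have "(\<integral>x. infod S A C x \<partial>gauss3) = (\<integral>u. (\<integral>p. infod S A C (u, p) \<partial>(std_gaussian \<Otimes>\<^sub>M std_gaussian)) \<partial>std_gaussian)"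
    by (rule G3.integral_fst'[symmetric, OF I])
  also have "\<dots> = (\<integral>u. qform S (0 + A *v u) / 2 + (trace (?I ** (C ** transpose C)) / 2 + ?c) \<partial>std_gaussian)"
  \<comment> \<open>Fubini yields integrable sections only for almost every
    \<open>u\<close>.\<close>
  proof (rule integral_cong_AE)
    show "AE u in std_gaussian. (\<integral>p. infod S A C (u, p) \<partial>(std_gaussian \<Otimes>\<^sub>M std_gaussian)) =
       qform S (0 + A *v u) / 2 + (trace (?I ** (C ** transpose C)) / 2 + ?c)"
      using G3.AE_integrable_fst'[OF I]
    proof eventually_elim
      case (elim u)
      have "(\<integral>p. infod S A C (u, p) \<partial>(std_gaussian \<Otimes>\<^sub>M std_gaussian)) = (\<integral>v. \<integral>z. infod S A C (u, v, z) \<partial>std_gaussian \<partial>std_gaussian)"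
        by (rule GG.integral_fst'[symmetric, OF elim])
      then show ?case by (simp only: z v)
    qed
    show "(\<lambda>u. \<integral>p. infod S A C (u, p) \<partial>(std_gaussian \<Otimes>\<^sub>M std_gaussian)) \<in> borel_measurable std_gaussian"
      by measurable
    show "(\<lambda>u. qform S (0 + A *v u) / 2 + (trace (?I ** (C ** transpose C)) / 2 + ?c)) \<in> borel_measurable std_gaussian"
      by measurable
  qed
  also have "\<dots> = (trace (?I ** S) - real CARD('n) + ln (det S)) / 2"
  proof -
    have "?I ** S = ?I ** (mat 1 + A ** transpose A + C ** transpose C)" by (simp add: S_def)
    also have "\<dots> = ?I + ?I ** (A ** transpose A) + ?I ** (C ** transpose C)" by (simp add: matrix_add_ldistrib)
    finally show ?thesis unfolding u by (simp add: trace_add add_divide_distrib diff_divide_distrib)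
  qed
  also have "\<dots> = ln (det S) / 2"
    by (simp add: matrix_inv_cancel[OF pdef_invertible[OF S]] trace_I)
  finally show ?thesis .
qed

lemma infod_chernoff:
  fixes A C :: "real^'n^'n"
  defines "S \<equiv> mat 1 + A ** transpose A + C ** transpose C"
  assumes "a < ln (det S) / 2"
  shows "\<exists>t>0. \<exists>\<tau>. 0 \<le> \<tau> \<and> \<tau> < 1 \<and> (\<integral>\<^sup>+u. \<integral>\<^sup>+v. \<integral>\<^sup>+z. ennreal (exp (- t * (infod S A C (u, v, z) - a)))
     \<partial>std_gaussian \<partial>std_gaussian \<partial>std_gaussian) \<le> ennreal \<tau>"
proof -
  interpret P: prob_space "gauss3 :: ((real^'n) \<times> (real^'n) \<times> (real^'n)) measure" by (rule prob_space_gauss3)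
  have S: "pdef S" unfolding S_def by (intro pdef_add_psd pdef_mat_1 psd_gram)
  obtain s where s: "s > 0" "(\<integral>\<^sup>+x. ennreal (exp (s * \<bar>infod S A C x\<bar>)) \<partial>gauss3) < \<infinity>"
    using infod_exp_moment[OF S] by blast
  have "a < (\<integral>x. infod S A C x \<partial>gauss3)" using assms by (simp add: expectation_infod)
  from P.chernoff_bound[OF infod_measurable s this]
  show ?thesis by (subst (asm) nn_integral_gauss3) auto
qed

text \<open>\<open>chernoff_bound\<close> for minus the power of \<open>B *v g\<close>; the mean
  power is \<open>trace (B ** transpose B)\<close>.\<close>

lemma power_chernoff:
  fixes B :: "real^'n^'n"
  assumes "trace (B ** transpose B) < P"
  shows "\<exists>t>0. \<exists>\<tau>. 0 \<le> \<tau> \<and> \<tau> < 1 \<and> (\<integral>\<^sup>+g. ennreal (exp (t * ((norm (B *v g))\<^sup>2 - P))) \<partial>std_gaussian) \<le> ennreal \<tau>"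
proof -
  interpret G: prob_space "std_gaussian :: (real^'n) measure" by simp
  let ?X = "\<lambda>g. - (g \<bullet> ((transpose B ** B) *v g))"
  have n: "(norm (B *v g))\<^sup>2 = g \<bullet> ((transpose B ** B) *v g)" for g
    by (simp add: power2_norm_eq_inner matrix_vector_mul_assoc[symmetric] inner_matrix_vector[of g "transpose B"])
  obtain K where K: "K \<ge> 0" "\<And>x. \<bar>x \<bullet> ((transpose B ** B) *v x)\<bar> \<le> K * (x \<bullet> x)" using exists_bound_matrix by blast
  define s where "s = 1 / (4 * (K + 1))"
  have s: "s > 0" "s * K \<le> 1/4" using K(1) by (auto simp: s_def field_simps)
  have "(\<integral>\<^sup>+g. ennreal (exp (s * \<bar>?X g\<bar>)) \<partial>std_gaussian) \<le> (\<integral>\<^sup>+z. ennreal (exp (1/4 * (z \<bullet> z))) \<partial>(std_gaussian :: (real^'n) measure))"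
  proof (intro nn_integral_mono ennreal_leI)
    fix g
    have "s * \<bar>?X g\<bar> \<le> s * (K * (g \<bullet> g))" using K(2)[of g] s(1) by (intro mult_left_mono) auto
    also have "\<dots> \<le> 1/4 * (g \<bullet> g)" unfolding mult.assoc[symmetric] using s(2) by (intro mult_right_mono) auto
    finally show "exp (s * \<bar>?X g\<bar>) \<le> exp (1/4 * (g \<bullet> g))" by simp
  qed
  also have "\<dots> < \<infinity>" by (rule nn_integral_std_gaussian_exp_norm)
  finally have f: "(\<integral>\<^sup>+g. ennreal (exp (s * \<bar>?X g\<bar>)) \<partial>std_gaussian) < \<infinity>" .
  have "- P < (\<integral>g. ?X g \<partial>std_gaussian)"
    using has_bochner_integral_std_gaussian_quadratic[of "transpose B ** B"] assms
    by (simp add: has_bochner_integral_iff trace_mul_sym[of "transpose B" B])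
  from G.chernoff_bound[OF _ s(1) f this] show ?thesis
    by (simp add: n algebra_simps)
qed

section \<open>Averages over random codebooks\<close>

lemma nn_integral_PiM_component:
  assumes M: "prob_space M" "i \<in> I" and [measurable]: "f \<in> borel_measurable M"
  shows "(\<integral>\<^sup>+\<omega>. f (\<omega> i) \<partial>PiM I (\<lambda>_. M)) = (\<integral>\<^sup>+x. f x \<partial>M)"
proof -
  have m: "(\<lambda>\<omega>. \<omega> i) \<in> measurable (PiM I (\<lambda>_. M)) M" using M(2) by measurable
  have "(\<integral>\<^sup>+x. f x \<partial>M) = (\<integral>\<^sup>+x. f x \<partial>distr (PiM I (\<lambda>_. M)) M (\<lambda>\<omega>. \<omega> i))"
    using distr_PiM_component[of I "\<lambda>_. M" i] M by simp
  then show ?thesis using m by (simp add: nn_integral_distr)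
qed

text \<open>Distinct codewords of a random codebook are independent; pairwise independence is what
  the union bound over wrong messages uses.\<close>

lemma nn_integral_PiM_two_components:
  assumes M: "prob_space M" and I: "finite I" "i \<in> I" "k \<in> I" "i \<noteq> k"
    and f [measurable]: "(\<lambda>(x, y). f x y) \<in> borel_measurable (M \<Otimes>\<^sub>M M)"
  shows "(\<integral>\<^sup>+\<omega>. f (\<omega> i) (\<omega> k) \<partial>PiM I (\<lambda>_. M)) = (\<integral>\<^sup>+x. \<integral>\<^sup>+y. f x y \<partial>M \<partial>M)"
proof -
  interpret product_sigma_finite "\<lambda>_. M" 
    using M by (simp add: product_sigma_finite_def prob_space_imp_sigma_finite)
  define J where "J = I - {i}"
  have J: "I = insert i J" "finite J" "i \<notin> J" "k \<in> J" using I by (auto simp: J_def)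
  have pr: "(\<lambda>\<omega>. (\<omega> i, \<omega> k)) \<in> measurable (PiM I (\<lambda>_. M)) (M \<Otimes>\<^sub>M M)"
    using I(2,3) by measurable
  have m: "(\<lambda>\<omega>. f (\<omega> i) (\<omega> k)) \<in> borel_measurable (PiM (insert i J) (\<lambda>_. M))"
    using measurable_compose[OF pr f] unfolding J(1) by simp
  have "(\<integral>\<^sup>+\<omega>. f (\<omega> i) (\<omega> k) \<partial>PiM I (\<lambda>_. M)) = (\<integral>\<^sup>+x. \<integral>\<^sup>+\<omega>. f (fun_upd \<omega> i x i) (fun_upd \<omega> i x k) \<partial>PiM J (\<lambda>_. M) \<partial>M)"
    unfolding J(1) by (rule product_nn_integral_insert_rev[OF J(2,3) m])
  also have "\<dots> = (\<integral>\<^sup>+x. \<integral>\<^sup>+\<omega>. f x (\<omega> k) \<partial>PiM J (\<lambda>_. M) \<partial>M)"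
    using I(4) by simp
  also have "\<dots> = (\<integral>\<^sup>+x. \<integral>\<^sup>+y. f x y \<partial>M \<partial>M)"
    by (intro nn_integral_cong nn_integral_PiM_component[OF M J(4)]) measurable
  finally show ?thesis .
qed

text \<open>\<open>b\<close>, \<open>w\<close> and \<open>v\<close> stand for the error
  contributions of the sent pair, of a wrong codeword of user 1 beside the sent one of user 2, and
  of two wrong codewords. Counting \<open>card W1 - 1\<close> wrong messages matters: at rate 0
  there is a single message and these terms vanish.\<close>

lemma nn_integral_codebooks_le:
  fixes b :: "'x \<Rightarrow> 'x \<Rightarrow> ennreal" and w v
  assumes X: "prob_space X" and W: "finite W1" "finite W2"
    and b: "(\<lambda>(x1, x2). b x1 x2) \<in> borel_measurable (X \<Otimes>\<^sub>M X)"
    and w: "(\<lambda>(y1, x1). w y1 x1) \<in> borel_measurable (X \<Otimes>\<^sub>M X)"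
    and v: "(\<lambda>((y1, x1), (y2, x2)). v y1 x1 y2 x2) \<in> borel_measurable ((X \<Otimes>\<^sub>M X) \<Otimes>\<^sub>M (X \<Otimes>\<^sub>M X))"
    and Eb: "(\<integral>\<^sup>+x1. \<integral>\<^sup>+x2. b x1 x2 \<partial>X \<partial>X) \<le> cb"
    and Ew: "(\<integral>\<^sup>+y1. \<integral>\<^sup>+x1. w y1 x1 \<partial>X \<partial>X) \<le> cw"
    and Ev: "(\<integral>\<^sup>+y1. \<integral>\<^sup>+x1. \<integral>\<^sup>+y2. \<integral>\<^sup>+x2. v y1 x1 y2 x2 \<partial>X \<partial>X \<partial>X \<partial>X) \<le> cv"
  defines "F \<equiv> \<lambda>\<omega>1 \<omega>2. \<Sum>m1\<in>W1. \<Sum>m2\<in>W2. b (\<omega>1 m1) (\<omega>2 m2) + (\<Sum>k1\<in>W1 - {m1}. w (\<omega>1 k1) (\<omega>1 m1)) +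
      (\<Sum>k1\<in>W1 - {m1}. \<Sum>k2\<in>W2 - {m2}. v (\<omega>1 k1) (\<omega>1 m1) (\<omega>2 k2) (\<omega>2 m2))"
  shows "(\<lambda>(\<omega>1, \<omega>2). F \<omega>1 \<omega>2) \<in> borel_measurable (PiM W1 (\<lambda>_. X) \<Otimes>\<^sub>M PiM W2 (\<lambda>_. X))"
    and "(\<integral>\<^sup>+\<omega>. F (fst \<omega>) (snd \<omega>) \<partial>(PiM W1 (\<lambda>_. X) \<Otimes>\<^sub>M PiM W2 (\<lambda>_. X))) \<le>
      of_nat (card W1) * of_nat (card W2) * (cb + of_nat (card W1 - 1) * cw + of_nat (card W1 - 1) * of_nat (card W2 - 1) * cv)"
proof -
  let ?C1 = "PiM W1 (\<lambda>_. X)" and ?C2 = "PiM W2 (\<lambda>_. X)"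
  interpret X: prob_space X by (rule X)
  interpret C1: prob_space ?C1 using X by (intro prob_space_PiM)
  interpret C2: prob_space ?C2 using X by (intro prob_space_PiM)
  have bm: "(\<lambda>\<omega>. b (fst \<omega> m1) (snd \<omega> m2)) \<in> borel_measurable (?C1 \<Otimes>\<^sub>M ?C2)" if "m1 \<in> W1" "m2 \<in> W2" for m1 m2
  proof -
    have "(\<lambda>\<omega>. (fst \<omega> m1, snd \<omega> m2)) \<in> measurable (?C1 \<Otimes>\<^sub>M ?C2) (X \<Otimes>\<^sub>M X)" using that by measurable
    from measurable_compose[OF this b] show ?thesis by simp
  qed
  have wm: "(\<lambda>\<omega>. w (fst \<omega> k1) (fst \<omega> m1)) \<in> borel_measurable (?C1 \<Otimes>\<^sub>M ?C2)" if "m1 \<in> W1" "k1 \<in> W1" for m1 k1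
  proof -
    have "(\<lambda>\<omega>. (fst \<omega> k1, fst \<omega> m1)) \<in> measurable (?C1 \<Otimes>\<^sub>M ?C2) (X \<Otimes>\<^sub>M X)" using that by measurable
    from measurable_compose[OF this w] show ?thesis by simp
  qed
  have vm: "(\<lambda>\<omega>. v (fst \<omega> k1) (fst \<omega> m1) (snd \<omega> k2) (snd \<omega> m2)) \<in> borel_measurable (?C1 \<Otimes>\<^sub>M ?C2)"
    if "m1 \<in> W1" "k1 \<in> W1" "m2 \<in> W2" "k2 \<in> W2" for m1 k1 m2 k2
  proof -
    have "(\<lambda>\<omega>. ((fst \<omega> k1, fst \<omega> m1), (snd \<omega> k2, snd \<omega> m2))) \<in> measurable (?C1 \<Otimes>\<^sub>M ?C2) ((X \<Otimes>\<^sub>M X) \<Otimes>\<^sub>M (X \<Otimes>\<^sub>M X))" using that by measurable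
    from measurable_compose[OF this v] show ?thesis by simp
  qed
  have Ib: "(\<integral>\<^sup>+\<omega>. b (fst \<omega> m1) (snd \<omega> m2) \<partial>(?C1 \<Otimes>\<^sub>M ?C2)) \<le> cb" if "m1 \<in> W1" "m2 \<in> W2" for m1 m2
  proof -
    have "(\<integral>\<^sup>+\<omega>. b (fst \<omega> m1) (snd \<omega> m2) \<partial>(?C1 \<Otimes>\<^sub>M ?C2)) = (\<integral>\<^sup>+\<omega>1. \<integral>\<^sup>+\<omega>2. b (\<omega>1 m1) (\<omega>2 m2) \<partial>?C2 \<partial>?C1)"
      using C2.nn_integral_fst[OF bm[OF that]] by simp
    also have "\<dots> = (\<integral>\<^sup>+\<omega>1. \<integral>\<^sup>+x2. b (\<omega>1 m1) x2 \<partial>X \<partial>?C1)"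
    proof (rule nn_integral_cong)
      fix \<omega>1 assume "\<omega>1 \<in> space ?C1"
      then have "\<omega>1 m1 \<in> space X" using that by (auto simp: space_PiM)
      then have "(\<lambda>x2. b (\<omega>1 m1) x2) \<in> borel_measurable X"
        using measurable_compose[OF measurable_Pair1' b] by simp
      then show "(\<integral>\<^sup>+\<omega>2. b (\<omega>1 m1) (\<omega>2 m2) \<partial>?C2) = (\<integral>\<^sup>+x2. b (\<omega>1 m1) x2 \<partial>X)"
        by (rule nn_integral_PiM_component[OF X that(2)])
    qed
    also have "\<dots> = (\<integral>\<^sup>+x1. \<integral>\<^sup>+x2. b x1 x2 \<partial>X \<partial>X)"
      by (rule nn_integral_PiM_component[OF X that(1)]) (use b in measurable)
    finally show ?thesis using Eb by simp
  qed
  have Iw: "(\<integral>\<^sup>+\<omega>. w (fst \<omega> k1) (fst \<omega> m1) \<partial>(?C1 \<Otimes>\<^sub>M ?C2)) \<le> cw" if "m1 \<in> W1" "k1 \<in> W1" "k1 \<noteq> m1" for m1 k1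
  proof -
    have "(\<integral>\<^sup>+\<omega>. w (fst \<omega> k1) (fst \<omega> m1) \<partial>(?C1 \<Otimes>\<^sub>M ?C2)) = (\<integral>\<^sup>+\<omega>1. \<integral>\<^sup>+\<omega>2. w (\<omega>1 k1) (\<omega>1 m1) \<partial>?C2 \<partial>?C1)"
      using C2.nn_integral_fst[OF wm[OF that(1,2)]] by simp
    also have "\<dots> = (\<integral>\<^sup>+\<omega>1. w (\<omega>1 k1) (\<omega>1 m1) \<partial>?C1)" by (simp add: C2.emeasure_space_1)
    also have "\<dots> = (\<integral>\<^sup>+y1. \<integral>\<^sup>+x1. w y1 x1 \<partial>X \<partial>X)"
      by (rule nn_integral_PiM_two_components[OF X W(1) that(2,1,3) w])
    finally show ?thesis using Ew by simp
  qed
  have Iv: "(\<integral>\<^sup>+\<omega>. v (fst \<omega> k1) (fst \<omega> m1) (snd \<omega> k2) (snd \<omega> m2) \<partial>(?C1 \<Otimes>\<^sub>M ?C2)) \<le> cv"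
    if "m1 \<in> W1" "k1 \<in> W1" "k1 \<noteq> m1" "m2 \<in> W2" "k2 \<in> W2" "k2 \<noteq> m2" for m1 k1 m2 k2
  proof -
    have "(\<integral>\<^sup>+\<omega>. v (fst \<omega> k1) (fst \<omega> m1) (snd \<omega> k2) (snd \<omega> m2) \<partial>(?C1 \<Otimes>\<^sub>M ?C2)) =
        (\<integral>\<^sup>+\<omega>1. \<integral>\<^sup>+\<omega>2. v (\<omega>1 k1) (\<omega>1 m1) (\<omega>2 k2) (\<omega>2 m2) \<partial>?C2 \<partial>?C1)"
      using C2.nn_integral_fst[OF vm[OF that(1,2,4,5)]] by simp
    also have "\<dots> = (\<integral>\<^sup>+\<omega>1. \<integral>\<^sup>+y2. \<integral>\<^sup>+x2. v (\<omega>1 k1) (\<omega>1 m1) y2 x2 \<partial>X \<partial>X \<partial>?C1)"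
    proof (rule nn_integral_cong)
      fix \<omega>1 assume "\<omega>1 \<in> space ?C1"
      then have "(\<omega>1 k1, \<omega>1 m1) \<in> space (X \<Otimes>\<^sub>M X)" using that by (auto simp: space_PiM space_pair_measure)
      from measurable_compose[OF measurable_Pair1'[OF this] v]
      have "(\<lambda>(y2, x2). v (\<omega>1 k1) (\<omega>1 m1) y2 x2) \<in> borel_measurable (X \<Otimes>\<^sub>M X)"
        by (simp add: case_prod_beta)
      then show "(\<integral>\<^sup>+\<omega>2. v (\<omega>1 k1) (\<omega>1 m1) (\<omega>2 k2) (\<omega>2 m2) \<partial>?C2) = (\<integral>\<^sup>+y2. \<integral>\<^sup>+x2. v (\<omega>1 k1) (\<omega>1 m1) y2 x2 \<partial>X \<partial>X)"
        by (rule nn_integral_PiM_two_components[OF X W(2) that(5,4,6)])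
    qed
    also have "\<dots> = (\<integral>\<^sup>+y1. \<integral>\<^sup>+x1. \<integral>\<^sup>+y2. \<integral>\<^sup>+x2. v y1 x1 y2 x2 \<partial>X \<partial>X \<partial>X \<partial>X)"
    proof (rule nn_integral_PiM_two_components[OF X W(1) that(2,1,3)])
      have v1: "(\<lambda>((p, y2), x2). v (fst p) (snd p) y2 x2) \<in> borel_measurable (((X \<Otimes>\<^sub>M X) \<Otimes>\<^sub>M X) \<Otimes>\<^sub>M X)"
      proof -
        have "(\<lambda>q. (fst (fst q), (snd (fst q), snd q))) \<in> measurable (((X \<Otimes>\<^sub>M X) \<Otimes>\<^sub>M X) \<Otimes>\<^sub>M X) ((X \<Otimes>\<^sub>M X) \<Otimes>\<^sub>M (X \<Otimes>\<^sub>M X))"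
          by measurable
        from measurable_compose[OF this v] show ?thesis by (simp add: case_prod_beta')
      qed
      have "(\<lambda>q. \<integral>\<^sup>+x2. v (fst (fst q)) (snd (fst q)) (snd q) x2 \<partial>X) \<in> borel_measurable ((X \<Otimes>\<^sub>M X) \<Otimes>\<^sub>M X)"
        by (rule X.borel_measurable_nn_integral) (use v1 in \<open>simp add: case_prod_beta'\<close>)
      then have "(\<lambda>p. \<integral>\<^sup>+y2. \<integral>\<^sup>+x2. v (fst p) (snd p) y2 x2 \<partial>X \<partial>X) \<in> borel_measurable (X \<Otimes>\<^sub>M X)"
        by (intro X.borel_measurable_nn_integral) (simp add: case_prod_beta')
      then show "(\<lambda>(y1, x1). \<integral>\<^sup>+y2. \<integral>\<^sup>+x2. v y1 x1 y2 x2 \<partial>X \<partial>X) \<in> borel_measurable (X \<Otimes>\<^sub>M X)"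
        by (simp add: case_prod_beta')
    qed
    finally show ?thesis using Ev by simp
  qed
  have m: "(\<lambda>\<omega>. F (fst \<omega>) (snd \<omega>)) \<in> borel_measurable (?C1 \<Otimes>\<^sub>M ?C2)"
    unfolding F_def by (intro borel_measurable_sum borel_measurable_add bm wm vm) auto
  then show "(\<lambda>(\<omega>1, \<omega>2). F \<omega>1 \<omega>2) \<in> borel_measurable (?C1 \<Otimes>\<^sub>M ?C2)"
    by (simp add: case_prod_beta')
  let ?c = "cb + of_nat (card W1 - 1) * cw + of_nat (card W1 - 1) * of_nat (card W2 - 1) * cv"
  have "(\<integral>\<^sup>+\<omega>. F (fst \<omega>) (snd \<omega>) \<partial>(?C1 \<Otimes>\<^sub>M ?C2)) =
    (\<Sum>m1\<in>W1. \<Sum>m2\<in>W2. (\<integral>\<^sup>+\<omega>. b (fst \<omega> m1) (snd \<omega> m2) \<partial>(?C1 \<Otimes>\<^sub>M ?C2)) +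
      (\<Sum>k1\<in>W1 - {m1}. \<integral>\<^sup>+\<omega>. w (fst \<omega> k1) (fst \<omega> m1) \<partial>(?C1 \<Otimes>\<^sub>M ?C2)) +
      (\<Sum>k1\<in>W1 - {m1}. \<Sum>k2\<in>W2 - {m2}. \<integral>\<^sup>+\<omega>. v (fst \<omega> k1) (fst \<omega> m1) (snd \<omega> k2) (snd \<omega> m2) \<partial>(?C1 \<Otimes>\<^sub>M ?C2)))"
    unfolding F_def
    apply (subst nn_integral_sum, (intro borel_measurable_sum borel_measurable_add bm wm vm; auto), rule sum.cong[OF refl])
    apply (subst nn_integral_sum, (intro borel_measurable_sum borel_measurable_add bm wm vm; auto), rule sum.cong[OF refl])
    apply (subst nn_integral_add, (intro borel_measurable_sum borel_measurable_add bm wm vm; auto),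
        (intro borel_measurable_sum borel_measurable_add bm wm vm; auto))
    apply (subst nn_integral_add, (intro borel_measurable_sum borel_measurable_add bm wm vm; auto),
        (intro borel_measurable_sum borel_measurable_add bm wm vm; auto))
    apply (subst nn_integral_sum, (intro borel_measurable_sum borel_measurable_add bm wm vm; auto))
    apply (subst nn_integral_sum, (intro borel_measurable_sum borel_measurable_add bm wm vm; auto))
    apply (intro arg_cong2[where f = "(+)"] refl sum.cong)
    apply (subst nn_integral_sum, (intro borel_measurable_sum borel_measurable_add bm wm vm; auto))
    apply (rule refl)
    done
  also have "\<dots> \<le> (\<Sum>m1\<in>W1. \<Sum>m2\<in>W2. cb + (\<Sum>k1\<in>W1 - {m1}. cw) + (\<Sum>k1\<in>W1 - {m1}. \<Sum>k2\<in>W2 - {m2}. cv))"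
    by (intro sum_mono add_mono Ib Iw Iv) auto
  also have "\<dots> = (\<Sum>m1\<in>W1. \<Sum>m2\<in>W2. ?c)"
    using W by (intro sum.cong refl) (simp add: mult.assoc)
  finally show "(\<integral>\<^sup>+\<omega>. F (fst \<omega>) (snd \<omega>) \<partial>(?C1 \<Otimes>\<^sub>M ?C2)) \<le> of_nat (card W1) * of_nat (card W2) * ?c"
    by (simp add: mult.assoc)
qed

section \<open>Likelihood ratios of wrong codewords\<close>

interpretation std_gaussian: prob_space "std_gaussian :: (real^'n) measure"
  by (rule prob_space_std_gaussian)

interpretation gblock: prob_space "gblock n :: (nat \<Rightarrow> real^'n) measure" for n
  by (rule prob_space_gblock)

lemma emeasure_std_gaussian_UNIV [simp]: "emeasure (std_gaussian :: (real^'n) measure) UNIV = 1"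
  using std_gaussian.emeasure_space_1[where 'n='n] by simp

lemma std_gaussian_Fubini:
  assumes "(\<lambda>(x, y). f x y) \<in> borel_measurable ((std_gaussian :: (real^'n) measure) \<Otimes>\<^sub>M (std_gaussian :: (real^'m) measure))"
  shows "(\<integral>\<^sup>+x. \<integral>\<^sup>+y. f x y \<partial>std_gaussian \<partial>std_gaussian) = (\<integral>\<^sup>+y. \<integral>\<^sup>+x. f x y \<partial>std_gaussian \<partial>std_gaussian)"
  by (rule pair_sigma_finite.Fubini'[symmetric])
     (use assms in \<open>auto intro!: pair_sigma_finite.intro prob_space_imp_sigma_finite\<close>)

lemma nn_integral_std_gaussian_const [simp]: "(\<integral>\<^sup>+x. c \<partial>(std_gaussian :: (real^'n) measure)) = c"
  using std_gaussian.emeasure_space_1[where 'n='n] by simp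

lemma nn_integral_gblock_const [simp]: "(\<integral>\<^sup>+x. c \<partial>(gblock n :: (nat \<Rightarrow> real^'n) measure)) = c"
  using gblock.emeasure_space_1[of n, where 'n='n] by simp

lemma nn_integral_gblock_prod:
  assumes "\<And>j. j < n \<Longrightarrow> f j \<in> borel_measurable borel"
  shows "(\<integral>\<^sup>+x. (\<Prod>j<n. f j (x j)) \<partial>(gblock n :: (nat \<Rightarrow> real^'n) measure)) = (\<Prod>j<n. \<integral>\<^sup>+x. f j x \<partial>std_gaussian)"
proof -
  interpret product_sigma_finite "\<lambda>_. std_gaussian :: (real^'n) measure"
    by (simp add: product_sigma_finite_def prob_space_imp_sigma_finite)
  show ?thesis by (rule product_nn_integral_prod) (use assms in auto)
qed

text \<open>The exponential of the information density of a wrong codeword \<open>u'\<close> when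
  \<open>u\<close> is sent, after the interference has been subtracted. Its mean is 1, so over a
  block it exceeds exp(n g1) with probability at most exp(- n g1).\<close>

definition wrong1 :: "real^'n^'n \<Rightarrow> real^'n \<Rightarrow> real^'n \<Rightarrow> real^'n \<Rightarrow> real" where
  "wrong1 A u' u z = phi (z + A *v u - A *v u') / gdens (mat 1 + A ** transpose A) (z + A *v u)"

definition wrong2 :: "real^'n^'n \<Rightarrow> real^'n^'n \<Rightarrow> real^'n \<Rightarrow> real^'n \<Rightarrow> real^'n \<Rightarrow> real^'n \<Rightarrow> real^'n \<Rightarrow> real" where
  "wrong2 A C u' u v' v z = phi (z + A *v u + C *v v - A *v u' - C *v v') /
     gdens (mat 1 + A ** transpose A + C ** transpose C) (z + A *v u + C *v v)"

lemma nn_integral_phi_ratio: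
  fixes C :: "real^'n^'n"
  assumes "g > 0"
  shows "(\<integral>\<^sup>+w. ennreal (phi (y - C *v w) / g) \<partial>std_gaussian) = ennreal (gdens (mat 1 + C ** transpose C) y / g)"
proof -
  have "(\<integral>\<^sup>+w. ennreal (phi (y - C *v w) / g) \<partial>std_gaussian) = (\<integral>\<^sup>+w. ennreal (1 / g) * ennreal (gdens (mat 1) (y - C *v w)) \<partial>std_gaussian)"
    using assms less_imp_le[OF phi_pos] by (intro nn_integral_cong) (simp add: gdens_mat_1 ennreal_mult'[symmetric])
  also have "\<dots> = ennreal (1 / g) * ennreal (gdens (mat 1 + C ** transpose C) y)"
    using gdens_convolution[of 0 "mat 1" y C] by (subst nn_integral_cmult) auto
  also have "\<dots> = ennreal (gdens (mat 1 + C ** transpose C) y / g)"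
    using assms gdens_pos[OF pdef_add_psd[OF pdef_mat_1 psd_gram], of C y]
    by (subst ennreal_mult[symmetric]) (auto simp: less_imp_le)
  finally show ?thesis .
qed

lemma nn_integral_gdens_ratio:
  fixes A C :: "real^'n^'n"
  assumes "g > 0"
  shows "(\<integral>\<^sup>+w. ennreal (gdens (mat 1 + C ** transpose C) (y - A *v w) / g) \<partial>std_gaussian) =
     ennreal (gdens (mat 1 + C ** transpose C + A ** transpose A) y / g)"
proof -
  let ?S = "mat 1 + C ** transpose C"
  have p: "pdef ?S" "pdef (?S + A ** transpose A)" by (intro pdef_add_psd pdef_mat_1 psd_gram)+
  have "(\<integral>\<^sup>+w. ennreal (gdens ?S (y - A *v w) / g) \<partial>std_gaussian) = (\<integral>\<^sup>+w. ennreal (1 / g) * ennreal (gdens ?S (y - A *v w)) \<partial>std_gaussian)"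
    using assms less_imp_le[OF gdens_pos[OF p(1)]] by (intro nn_integral_cong) (simp add: ennreal_mult'[symmetric])
  also have "\<dots> = ennreal (1 / g) * ennreal (gdens (?S + A ** transpose A) y)"
    using gdens_convolution[OF psd_gram, of ?S C y A] by (subst nn_integral_cmult) auto
  also have "\<dots> = ennreal (gdens (?S + A ** transpose A) y / g)"
    using assms gdens_pos[OF p(2), of y] by (subst ennreal_mult[symmetric]) (auto simp: less_imp_le)
  finally show ?thesis .
qed

lemma wrong1_measurable [measurable]:
  "(\<lambda>(u', u, z). wrong1 A u' u z) \<in> borel_measurable (std_gaussian \<Otimes>\<^sub>M std_gaussian \<Otimes>\<^sub>M std_gaussian)"
  unfolding wrong1_def by measurable

text \<open>A wrong codeword is independent of the output. Integrating over \<open>u'\<close>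
  innermost convolves the numerator to exactly the density in the denominator.\<close>

lemma nn_integral_wrong1:
  "(\<integral>\<^sup>+u'. \<integral>\<^sup>+u. \<integral>\<^sup>+z. ennreal (wrong1 A u' u z) \<partial>std_gaussian \<partial>std_gaussian \<partial>std_gaussian) = 1"
proof -
  let ?S = "mat 1 + A ** transpose A"
  have S: "0 < gdens ?S y" for y by (intro gdens_pos pdef_add_psd pdef_mat_1 psd_gram)
  have "(\<integral>\<^sup>+u'. \<integral>\<^sup>+u. \<integral>\<^sup>+z. ennreal (wrong1 A u' u z) \<partial>std_gaussian \<partial>std_gaussian \<partial>std_gaussian) =
     (\<integral>\<^sup>+u. \<integral>\<^sup>+u'. \<integral>\<^sup>+z. ennreal (wrong1 A u' u z) \<partial>std_gaussian \<partial>std_gaussian \<partial>std_gaussian)"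
    unfolding wrong1_def by (rule std_gaussian_Fubini) measurable
  also have "\<dots> = (\<integral>\<^sup>+u. \<integral>\<^sup>+z. \<integral>\<^sup>+u'. ennreal (wrong1 A u' u z) \<partial>std_gaussian \<partial>std_gaussian \<partial>std_gaussian)"
    unfolding wrong1_def by (rule nn_integral_cong, rule std_gaussian_Fubini) measurable
  also have "\<dots> = 1"
    unfolding wrong1_def using S by (simp add: nn_integral_phi_ratio less_imp_neq[symmetric])
  finally show ?thesis .
qed

text \<open>The argument of \<open>nn_integral_wrong1\<close> in two stages: the integral over
  \<open>v'\<close> turns \<open>phi\<close> into \<open>gdens ?T\<close>, and the one over
  \<open>u'\<close> turns this into the denominator.\<close>

lemma nn_integral_wrong2:
  "(\<integral>\<^sup>+u'. \<integral>\<^sup>+u. \<integral>\<^sup>+v'. \<integral>\<^sup>+v. \<integral>\<^sup>+z. ennreal (wrong2 A C u' u v' v z)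
     \<partial>std_gaussian \<partial>std_gaussian \<partial>std_gaussian \<partial>std_gaussian \<partial>std_gaussian) = 1"
proof -
  let ?S = "mat 1 + A ** transpose A + C ** transpose C" and ?T = "mat 1 + C ** transpose C"
  have S: "0 < gdens ?S y" for y by (intro gdens_pos pdef_add_psd pdef_mat_1 psd_gram)
  have TS: "?T + A ** transpose A = ?S" by (simp add: add_ac)
  have "(\<integral>\<^sup>+u'. \<integral>\<^sup>+u. \<integral>\<^sup>+v'. \<integral>\<^sup>+v. \<integral>\<^sup>+z. ennreal (wrong2 A C u' u v' v z)
     \<partial>std_gaussian \<partial>std_gaussian \<partial>std_gaussian \<partial>std_gaussian \<partial>std_gaussian) =
    (\<integral>\<^sup>+u. \<integral>\<^sup>+u'. \<integral>\<^sup>+v'. \<integral>\<^sup>+v. \<integral>\<^sup>+z. ennreal (wrong2 A C u' u v' v z)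
     \<partial>std_gaussian \<partial>std_gaussian \<partial>std_gaussian \<partial>std_gaussian \<partial>std_gaussian)"
    unfolding wrong2_def by (rule std_gaussian_Fubini) measurable
  also have "\<dots> = (\<integral>\<^sup>+u. \<integral>\<^sup>+u'. \<integral>\<^sup>+v. \<integral>\<^sup>+z. \<integral>\<^sup>+v'. ennreal (wrong2 A C u' u v' v z)
     \<partial>std_gaussian \<partial>std_gaussian \<partial>std_gaussian \<partial>std_gaussian \<partial>std_gaussian)"
  proof (rule nn_integral_cong, rule nn_integral_cong)
    fix u u'
    have "(\<integral>\<^sup>+v'. \<integral>\<^sup>+v. \<integral>\<^sup>+z. ennreal (wrong2 A C u' u v' v z) \<partial>std_gaussian \<partial>std_gaussian \<partial>std_gaussian) =
      (\<integral>\<^sup>+v. \<integral>\<^sup>+v'. \<integral>\<^sup>+z. ennreal (wrong2 A C u' u v' v z) \<partial>std_gaussian \<partial>std_gaussian \<partial>std_gaussian)"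
      unfolding wrong2_def by (rule std_gaussian_Fubini) measurable
    also have "\<dots> = (\<integral>\<^sup>+v. \<integral>\<^sup>+z. \<integral>\<^sup>+v'. ennreal (wrong2 A C u' u v' v z) \<partial>std_gaussian \<partial>std_gaussian \<partial>std_gaussian)"
      unfolding wrong2_def by (rule nn_integral_cong, rule std_gaussian_Fubini) measurable
    finally show "(\<integral>\<^sup>+v'. \<integral>\<^sup>+v. \<integral>\<^sup>+z. ennreal (wrong2 A C u' u v' v z) \<partial>std_gaussian \<partial>std_gaussian \<partial>std_gaussian) = \<dots>" .
  qed
  also have "\<dots> = (\<integral>\<^sup>+u. \<integral>\<^sup>+u'. \<integral>\<^sup>+v. \<integral>\<^sup>+z. ennreal (gdens ?T (z + A *v u + C *v v - A *v u') / gdens ?S (z + A *v u + C *v v))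
     \<partial>std_gaussian \<partial>std_gaussian \<partial>std_gaussian \<partial>std_gaussian)"
    unfolding wrong2_def using S by (simp add: nn_integral_phi_ratio)
  also have "\<dots> = (\<integral>\<^sup>+u. \<integral>\<^sup>+v. \<integral>\<^sup>+z. \<integral>\<^sup>+u'. ennreal (gdens ?T (z + A *v u + C *v v - A *v u') / gdens ?S (z + A *v u + C *v v))
     \<partial>std_gaussian \<partial>std_gaussian \<partial>std_gaussian \<partial>std_gaussian)"
  proof (rule nn_integral_cong)
    fix u
    have "(\<integral>\<^sup>+u'. \<integral>\<^sup>+v. \<integral>\<^sup>+z. ennreal (gdens ?T (z + A *v u + C *v v - A *v u') / gdens ?S (z + A *v u + C *v v)) \<partial>std_gaussian \<partial>std_gaussian \<partial>std_gaussian) =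
      (\<integral>\<^sup>+v. \<integral>\<^sup>+u'. \<integral>\<^sup>+z. ennreal (gdens ?T (z + A *v u + C *v v - A *v u') / gdens ?S (z + A *v u + C *v v)) \<partial>std_gaussian \<partial>std_gaussian \<partial>std_gaussian)"
      by (rule std_gaussian_Fubini) measurable
    also have "\<dots> = (\<integral>\<^sup>+v. \<integral>\<^sup>+z. \<integral>\<^sup>+u'. ennreal (gdens ?T (z + A *v u + C *v v - A *v u') / gdens ?S (z + A *v u + C *v v)) \<partial>std_gaussian \<partial>std_gaussian \<partial>std_gaussian)"
      by (rule nn_integral_cong, rule std_gaussian_Fubini) measurable
    finally show "(\<integral>\<^sup>+u'. \<integral>\<^sup>+v. \<integral>\<^sup>+z. ennreal (gdens ?T (z + A *v u + C *v v - A *v u') / gdens ?S (z + A *v u + C *v v)) \<partial>std_gaussian \<partial>std_gaussian \<partial>std_gaussian) = \<dots>" .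
  qed
  also have "\<dots> = 1"
    using S by (simp add: nn_integral_gdens_ratio TS less_imp_neq[symmetric])
  finally show ?thesis .
qed

lemma nn_integral_gblock_prod3:
  fixes f :: "real^'n \<Rightarrow> real^'n \<Rightarrow> real^'n \<Rightarrow> ennreal"
  assumes [measurable]: "(\<lambda>(u, v, z). f u v z) \<in> borel_measurable gauss3"
  shows "(\<integral>\<^sup>+x. \<integral>\<^sup>+y. \<integral>\<^sup>+w. (\<Prod>j<n. f (x j) (y j) (w j)) \<partial>gblock n \<partial>gblock n \<partial>gblock n) =
    (\<integral>\<^sup>+u. \<integral>\<^sup>+v. \<integral>\<^sup>+z. f u v z \<partial>std_gaussian \<partial>std_gaussian \<partial>std_gaussian) ^ n"
proof -
  have 1: "(\<lambda>z. f u v z) \<in> borel_measurable borel" for u v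
  proof -
    have "(\<lambda>z. (u, v, z)) \<in> measurable borel gauss3" by measurable
    from measurable_compose[OF this assms] show ?thesis by simp
  qed
  have m2: "(\<lambda>(u, v). \<integral>\<^sup>+z. f u v z \<partial>std_gaussian) \<in> borel_measurable (std_gaussian \<Otimes>\<^sub>M std_gaussian)"
  proof -
    have "(\<lambda>q. (fst (fst q), snd (fst q), snd q)) \<in> measurable ((std_gaussian \<Otimes>\<^sub>M std_gaussian) \<Otimes>\<^sub>M std_gaussian) gauss3" by measurable
    from measurable_compose[OF this assms]
    have "(\<lambda>q. \<integral>\<^sup>+z. f (fst q) (snd q) z \<partial>std_gaussian) \<in> borel_measurable (std_gaussian \<Otimes>\<^sub>M std_gaussian)"
      by (intro std_gaussian.borel_measurable_nn_integral) (simp add: case_prod_beta')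
    then show ?thesis by (simp add: case_prod_beta')
  qed
  have 2: "(\<lambda>v. \<integral>\<^sup>+z. f u v z \<partial>std_gaussian) \<in> borel_measurable borel" for u
  proof -
    have "(\<lambda>v. (u, v)) \<in> measurable borel (std_gaussian \<Otimes>\<^sub>M std_gaussian)" by measurable
    from measurable_compose[OF this m2] show ?thesis by simp
  qed
  have "(\<lambda>u. \<integral>\<^sup>+v. \<integral>\<^sup>+z. f u v z \<partial>std_gaussian \<partial>std_gaussian) \<in> borel_measurable std_gaussian"
    by (rule std_gaussian.borel_measurable_nn_integral) (rule m2)
  then have 3: "(\<lambda>u. \<integral>\<^sup>+v. \<integral>\<^sup>+z. f u v z \<partial>std_gaussian \<partial>std_gaussian) \<in> borel_measurable borel"
    by simp
  have e1: "(\<integral>\<^sup>+w. (\<Prod>j<n. f (x j) (y j) (w j)) \<partial>gblock n) = (\<Prod>j<n. \<integral>\<^sup>+z. f (x j) (y j) z \<partial>std_gaussian)" for x y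
    by (rule nn_integral_gblock_prod[where f = "\<lambda>j z. f (x j) (y j) z"]) (rule 1)
  have e2: "(\<integral>\<^sup>+y. (\<Prod>j<n. \<integral>\<^sup>+z. f (x j) (y j) z \<partial>std_gaussian) \<partial>gblock n) = (\<Prod>j<n. \<integral>\<^sup>+v. \<integral>\<^sup>+z. f (x j) v z \<partial>std_gaussian \<partial>std_gaussian)" for x
    by (rule nn_integral_gblock_prod[where f = "\<lambda>j v. \<integral>\<^sup>+z. f (x j) v z \<partial>std_gaussian"]) (rule 2)
  have e3: "(\<integral>\<^sup>+x. (\<Prod>j<n. \<integral>\<^sup>+v. \<integral>\<^sup>+z. f (x j) v z \<partial>std_gaussian \<partial>std_gaussian) \<partial>gblock n) = (\<Prod>j<n. \<integral>\<^sup>+u. \<integral>\<^sup>+v. \<integral>\<^sup>+z. f u v z \<partial>std_gaussian \<partial>std_gaussian \<partial>std_gaussian)"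
    by (rule nn_integral_gblock_prod[where f = "\<lambda>j u. \<integral>\<^sup>+v. \<integral>\<^sup>+z. f u v z \<partial>std_gaussian \<partial>std_gaussian"]) (rule 3)
  show ?thesis by (simp only: e1 e2 e3 prod_constant card_lessThan)
qed

lemma nn_integral_gblock_wrong2:
  fixes A C :: "real^'n^'n"
  shows "(\<integral>\<^sup>+y1. \<integral>\<^sup>+x1. \<integral>\<^sup>+y2. \<integral>\<^sup>+x2. \<integral>\<^sup>+w. (\<Prod>j<n. ennreal (wrong2 A C (y1 j) (x1 j) (y2 j) (x2 j) (w j)))
     \<partial>gblock n \<partial>gblock n \<partial>gblock n \<partial>gblock n \<partial>gblock n) = 1"
proof -
  have 1: "(\<lambda>z. ennreal (wrong2 A C u' u v' v z)) \<in> borel_measurable borel" for u' u v' v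
    unfolding wrong2_def by measurable
  have 2: "(\<lambda>v. \<integral>\<^sup>+z. ennreal (wrong2 A C u' u v' v z) \<partial>std_gaussian) \<in> borel_measurable borel" for u' u v'
    unfolding wrong2_def by measurable
  have 3: "(\<lambda>v'. \<integral>\<^sup>+v. \<integral>\<^sup>+z. ennreal (wrong2 A C u' u v' v z) \<partial>std_gaussian \<partial>std_gaussian) \<in> borel_measurable borel" for u' u
    unfolding wrong2_def by measurable
  have 4: "(\<lambda>u. \<integral>\<^sup>+v'. \<integral>\<^sup>+v. \<integral>\<^sup>+z. ennreal (wrong2 A C u' u v' v z) \<partial>std_gaussian \<partial>std_gaussian \<partial>std_gaussian) \<in> borel_measurable borel" for u'
    unfolding wrong2_def by measurable
  have 5: "(\<lambda>u'. \<integral>\<^sup>+u. \<integral>\<^sup>+v'. \<integral>\<^sup>+v. \<integral>\<^sup>+z. ennreal (wrong2 A C u' u v' v z) \<partial>std_gaussian \<partial>std_gaussian \<partial>std_gaussian \<partial>std_gaussian) \<in> borel_measurable borel"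
    unfolding wrong2_def by measurable
  note p = nn_integral_gblock_prod
  have e1: "(\<integral>\<^sup>+w. (\<Prod>j<n. ennreal (wrong2 A C (y1 j) (x1 j) (y2 j) (x2 j) (w j))) \<partial>gblock n) =
      (\<Prod>j<n. \<integral>\<^sup>+z. ennreal (wrong2 A C (y1 j) (x1 j) (y2 j) (x2 j) z) \<partial>std_gaussian)" for y1 x1 y2 x2
    by (rule p[where f = "\<lambda>j z. ennreal (wrong2 A C (y1 j) (x1 j) (y2 j) (x2 j) z)"]) (rule 1)
  have e2: "(\<integral>\<^sup>+x2. (\<Prod>j<n. \<integral>\<^sup>+z. ennreal (wrong2 A C (y1 j) (x1 j) (y2 j) (x2 j) z) \<partial>std_gaussian) \<partial>gblock n) =
      (\<Prod>j<n. \<integral>\<^sup>+v. \<integral>\<^sup>+z. ennreal (wrong2 A C (y1 j) (x1 j) (y2 j) v z) \<partial>std_gaussian \<partial>std_gaussian)" for y1 x1 y2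
    by (rule p[where f = "\<lambda>j v. \<integral>\<^sup>+z. ennreal (wrong2 A C (y1 j) (x1 j) (y2 j) v z) \<partial>std_gaussian"]) (rule 2)
  have e3: "(\<integral>\<^sup>+y2. (\<Prod>j<n. \<integral>\<^sup>+v. \<integral>\<^sup>+z. ennreal (wrong2 A C (y1 j) (x1 j) (y2 j) v z) \<partial>std_gaussian \<partial>std_gaussian) \<partial>gblock n) =
      (\<Prod>j<n. \<integral>\<^sup>+v'. \<integral>\<^sup>+v. \<integral>\<^sup>+z. ennreal (wrong2 A C (y1 j) (x1 j) v' v z) \<partial>std_gaussian \<partial>std_gaussian \<partial>std_gaussian)" for y1 x1
    by (rule p[where f = "\<lambda>j v'. \<integral>\<^sup>+v. \<integral>\<^sup>+z. ennreal (wrong2 A C (y1 j) (x1 j) v' v z) \<partial>std_gaussian \<partial>std_gaussian"]) (rule 3)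
  have e4: "(\<integral>\<^sup>+x1. (\<Prod>j<n. \<integral>\<^sup>+v'. \<integral>\<^sup>+v. \<integral>\<^sup>+z. ennreal (wrong2 A C (y1 j) (x1 j) v' v z) \<partial>std_gaussian \<partial>std_gaussian \<partial>std_gaussian) \<partial>gblock n) =
      (\<Prod>j<n. \<integral>\<^sup>+u. \<integral>\<^sup>+v'. \<integral>\<^sup>+v. \<integral>\<^sup>+z. ennreal (wrong2 A C (y1 j) u v' v z) \<partial>std_gaussian \<partial>std_gaussian \<partial>std_gaussian \<partial>std_gaussian)" for y1
    by (rule p[where f = "\<lambda>j u. \<integral>\<^sup>+v'. \<integral>\<^sup>+v. \<integral>\<^sup>+z. ennreal (wrong2 A C (y1 j) u v' v z) \<partial>std_gaussian \<partial>std_gaussian \<partial>std_gaussian"]) (rule 4)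
  have e5: "(\<integral>\<^sup>+y1. (\<Prod>j<n. \<integral>\<^sup>+u. \<integral>\<^sup>+v'. \<integral>\<^sup>+v. \<integral>\<^sup>+z. ennreal (wrong2 A C (y1 j) u v' v z) \<partial>std_gaussian \<partial>std_gaussian \<partial>std_gaussian \<partial>std_gaussian) \<partial>gblock n) =
      (\<Prod>j<n. \<integral>\<^sup>+u'. \<integral>\<^sup>+u. \<integral>\<^sup>+v'. \<integral>\<^sup>+v. \<integral>\<^sup>+z. ennreal (wrong2 A C u' u v' v z) \<partial>std_gaussian \<partial>std_gaussian \<partial>std_gaussian \<partial>std_gaussian \<partial>std_gaussian)"
    by (rule p[where f = "\<lambda>j u'. \<integral>\<^sup>+u. \<integral>\<^sup>+v'. \<integral>\<^sup>+v. \<integral>\<^sup>+z. ennreal (wrong2 A C u' u v' v z) \<partial>std_gaussian \<partial>std_gaussian \<partial>std_gaussian \<partial>std_gaussian"]) (rule 5)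
  show ?thesis by (simp only: e1 e2 e3 e4 e5 nn_integral_wrong2 prod.neutral_const)
qed

lemma measurable_gblock_prod3:
  fixes f :: "real^'n \<Rightarrow> real^'n \<Rightarrow> real^'n \<Rightarrow> ennreal"
  assumes f: "(\<lambda>(u, v, z). f u v z) \<in> borel_measurable gauss3"
  shows "(\<lambda>(x, y). \<integral>\<^sup>+w. (\<Prod>j<n. f (x j) (y j) (w j)) \<partial>gblock n) \<in> borel_measurable (gblock n \<Otimes>\<^sub>M gblock n)"
    and "(\<lambda>w. \<Prod>j<n. f (x j) (y j) (w j)) \<in> borel_measurable (gblock n)"
proof -
  have "(\<lambda>q. \<Prod>j<n. f (fst (fst q) j) (snd (fst q) j) (snd q j)) \<in> borel_measurable ((gblock n \<Otimes>\<^sub>M gblock n) \<Otimes>\<^sub>M gblock n)"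
  proof (rule borel_measurable_prod_ennreal)
    fix j assume [measurable]: "j \<in> {..<n}"
    have "(\<lambda>q. (fst (fst q) j, snd (fst q) j, snd q j)) \<in> measurable ((gblock n \<Otimes>\<^sub>M gblock n) \<Otimes>\<^sub>M gblock n) gauss3"
      by measurable
    from measurable_compose[OF this f]
    show "(\<lambda>q. f (fst (fst q) j) (snd (fst q) j) (snd q j)) \<in> borel_measurable ((gblock n \<Otimes>\<^sub>M gblock n) \<Otimes>\<^sub>M gblock n)"
      by simp
  qed
  then have "(\<lambda>p. \<integral>\<^sup>+w. (\<Prod>j<n. f (fst p j) (snd p j) (w j)) \<partial>gblock n) \<in> borel_measurable (gblock n \<Otimes>\<^sub>M gblock n)"
    by (intro gblock.borel_measurable_nn_integral) (simp add: case_prod_beta')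
  then show "(\<lambda>(x, y). \<integral>\<^sup>+w. (\<Prod>j<n. f (x j) (y j) (w j)) \<partial>gblock n) \<in> borel_measurable (gblock n \<Otimes>\<^sub>M gblock n)"
    by (simp add: case_prod_beta')
  show "(\<lambda>w. \<Prod>j<n. f (x j) (y j) (w j)) \<in> borel_measurable (gblock n)"
  proof (rule borel_measurable_prod_ennreal)
    fix j assume [measurable]: "j \<in> {..<n}"
    have "(\<lambda>w. (x j, y j, w j)) \<in> measurable (gblock n) gauss3" by measurable
    from measurable_compose[OF this f] show "(\<lambda>w. f (x j) (y j) (w j)) \<in> borel_measurable (gblock n)" by simp
  qed
qed

lemma measurable_wrong2_block:
  fixes A C :: "real^'n^'n"
  shows "(\<lambda>((y1, x1), (y2, x2)). \<integral>\<^sup>+w. (\<Prod>j<n. ennreal (wrong2 A C (y1 j) (x1 j) (y2 j) (x2 j) (w j))) \<partial>gblock n)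
    \<in> borel_measurable ((gblock n \<Otimes>\<^sub>M gblock n) \<Otimes>\<^sub>M (gblock n \<Otimes>\<^sub>M gblock n))"
    and "(\<lambda>w. \<Prod>j<n. ennreal (wrong2 A C (y1 j) (x1 j) (y2 j) (x2 j) (w j))) \<in> borel_measurable (gblock n)"
proof -
  have "(\<lambda>q. \<integral>\<^sup>+w. (\<Prod>j<n. ennreal (wrong2 A C (fst (fst q) j) (snd (fst q) j) (fst (snd q) j) (snd (snd q) j) (w j))) \<partial>gblock n)
    \<in> borel_measurable ((gblock n \<Otimes>\<^sub>M gblock n) \<Otimes>\<^sub>M (gblock n \<Otimes>\<^sub>M gblock n))"
    unfolding wrong2_def by measurable
  then show "(\<lambda>((y1, x1), (y2, x2)). \<integral>\<^sup>+w. (\<Prod>j<n. ennreal (wrong2 A C (y1 j) (x1 j) (y2 j) (x2 j) (w j))) \<partial>gblock n)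
    \<in> borel_measurable ((gblock n \<Otimes>\<^sub>M gblock n) \<Otimes>\<^sub>M (gblock n \<Otimes>\<^sub>M gblock n))"
    by (simp add: case_prod_beta')
  show "(\<lambda>w. \<Prod>j<n. ennreal (wrong2 A C (y1 j) (x1 j) (y2 j) (x2 j) (w j))) \<in> borel_measurable (gblock n)"
    unfolding wrong2_def by measurable
qed

section \<open>Encoder, decoder and the bound for one receiver\<close>

text \<open>Codewords violating the power constraint are silenced at the transmitter only; the decoders below
  still search the original codebook, so the codewords they compare stay independent.\<close>

definition enc :: "real^'n^'n \<Rightarrow> real \<Rightarrow> nat \<Rightarrow> (nat \<Rightarrow> nat \<Rightarrow> real^'n) \<Rightarrow> nat \<Rightarrow> nat \<Rightarrow> real^'n" where
  "enc B P n \<omega> m j = (if (\<Sum>i<n. (norm (B *v \<omega> m i))\<^sup>2) \<le> real n * P then B *v \<omega> m j else 0)"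

text \<open>\<open>A\<close> and \<open>C\<close> act on standard Gaussian codewords. Each of \<open>p1\<close>, \<open>p2\<close>, \<open>h1\<close>, \<open>h2\<close> is a Chernoff
  weight: its product over the block dominates the indicator of a failure event (power of either codeword
  exceeded, either information density too small).\<close>

locale gaussian_receiver =
  fixes H J B1 B2 A C :: "real^'n^'n" and P1 P2 g1 g2 :: real
    and p1 p2 :: "real^'n \<Rightarrow> ennreal" and h1 h2 :: "real^'n \<Rightarrow> real^'n \<Rightarrow> real^'n \<Rightarrow> ennreal"
    and \<beta>1 \<beta>2 \<tau>1 \<tau>2 :: ennreal
  assumes A: "A = H ** B1" and C: "C = J ** B2"
    and p_meas [measurable]: "p1 \<in> borel_measurable borel" "p2 \<in> borel_measurable borel"
    and p_int: "(\<integral>\<^sup>+u. p1 u \<partial>std_gaussian) \<le> \<beta>1" "(\<integral>\<^sup>+u. p2 u \<partial>std_gaussian) \<le> \<beta>2"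
    and p1_test: "\<And>n x. 0 < n \<Longrightarrow> real n * P1 < (\<Sum>j<n. (norm (B1 *v x j))\<^sup>2) \<Longrightarrow> 1 \<le> (\<Prod>j<n. p1 (x j))"
    and p2_test: "\<And>n x. 0 < n \<Longrightarrow> real n * P2 < (\<Sum>j<n. (norm (B2 *v x j))\<^sup>2) \<Longrightarrow> 1 \<le> (\<Prod>j<n. p2 (x j))"
    and h_meas: "(\<lambda>(u, v, z). h1 u v z) \<in> borel_measurable gauss3" "(\<lambda>(u, v, z). h2 u v z) \<in> borel_measurable gauss3"
    and h1_int: "(\<integral>\<^sup>+u. \<integral>\<^sup>+v. \<integral>\<^sup>+z. h1 u v z \<partial>std_gaussian \<partial>std_gaussian \<partial>std_gaussian) \<le> \<tau>1"
    and h2_int: "(\<integral>\<^sup>+u. \<integral>\<^sup>+v. \<integral>\<^sup>+z. h2 u v z \<partial>std_gaussian \<partial>std_gaussian \<partial>std_gaussian) \<le> \<tau>2"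
    and h1_test: "\<And>n u v z. (\<Sum>j<n. infod (mat 1 + A ** transpose A) A 0 (u j, v j, z j)) \<le> real n * g1 \<Longrightarrow>
      1 \<le> (\<Prod>j<n. h1 (u j) (v j) (z j))"
    and h2_test: "\<And>n u v z. (\<Sum>j<n. infod (mat 1 + A ** transpose A + C ** transpose C) A C (u j, v j, z j)) \<le> real n * g2 \<Longrightarrow>
      1 \<le> (\<Prod>j<n. h2 (u j) (v j) (z j))"
begin

abbreviation "S1 \<equiv> mat 1 + A ** transpose A"
abbreviation "S2 \<equiv> mat 1 + A ** transpose A + C ** transpose C"

lemma pdef_S: "pdef S1" "pdef S2"
  by (intro pdef_add_psd pdef_mat_1 psd_gram)+

text \<open>\<open>bt\<close>, \<open>wt\<close> and \<open>vt\<close> are noise averages of the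
  three groups of terms in \<open>error_indicator_le\<close>: failure of the sent pair, a wrong own
  codeword beside the sent interferer, and two wrong codewords. They depend on the codewords
  involved and are averaged over codebooks by \<open>nn_integral_codebooks_le\<close>.\<close>

definition bt :: "nat \<Rightarrow> (nat \<Rightarrow> real^'n) \<Rightarrow> (nat \<Rightarrow> real^'n) \<Rightarrow> ennreal" where
  "bt n x y = (\<Prod>j<n. p1 (x j)) + (\<Prod>j<n. p2 (y j)) + (\<integral>\<^sup>+w. (\<Prod>j<n. h1 (x j) (y j) (w j)) \<partial>gblock n)
     + (\<integral>\<^sup>+w. (\<Prod>j<n. h2 (x j) (y j) (w j)) \<partial>gblock n)"

definition wt :: "nat \<Rightarrow> (nat \<Rightarrow> real^'n) \<Rightarrow> (nat \<Rightarrow> real^'n) \<Rightarrow> ennreal" where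
  "wt n x' x = ennreal (exp (- (real n * g1))) * (\<integral>\<^sup>+w. (\<Prod>j<n. ennreal (wrong1 A (x' j) (x j) (w j))) \<partial>gblock n)"

definition vt :: "nat \<Rightarrow> (nat \<Rightarrow> real^'n) \<Rightarrow> (nat \<Rightarrow> real^'n) \<Rightarrow> (nat \<Rightarrow> real^'n) \<Rightarrow> (nat \<Rightarrow> real^'n) \<Rightarrow> ennreal" where
  "vt n x' x y' y = ennreal (exp (- (real n * g2))) *
     (\<integral>\<^sup>+w. (\<Prod>j<n. ennreal (wrong2 A C (x' j) (x j) (y' j) (y j) (w j))) \<partial>gblock n)"

text \<open>A sum over message pairs; \<open>receiver_bound\<close> divides it by their number to
  dominate the average error.\<close>

definition total :: "nat \<Rightarrow> nat set \<Rightarrow> nat set \<Rightarrow> (nat \<Rightarrow> nat \<Rightarrow> real^'n) \<Rightarrow> (nat \<Rightarrow> nat \<Rightarrow> real^'n) \<Rightarrow> ennreal" where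
  "total n W1 W2 \<omega>1 \<omega>2 = (\<Sum>m1\<in>W1. \<Sum>m2\<in>W2. bt n (\<omega>1 m1) (\<omega>2 m2) + (\<Sum>k1\<in>W1 - {m1}. wt n (\<omega>1 k1) (\<omega>1 m1)) +
      (\<Sum>k1\<in>W1 - {m1}. \<Sum>k2\<in>W2 - {m2}. vt n (\<omega>1 k1) (\<omega>1 m1) (\<omega>2 k2) (\<omega>2 m2)))"

lemma ennreal_wrong1_measurable: "(\<lambda>(u', u, z). ennreal (wrong1 A u' u z)) \<in> borel_measurable gauss3"
  using measurable_compose[OF wrong1_measurable measurable_ennreal] by (simp add: case_prod_beta')

lemma bt_measurable: "(\<lambda>(x, y). bt n x y) \<in> borel_measurable (gblock n \<Otimes>\<^sub>M gblock n)"
proof -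
  have "(\<lambda>p. (\<Prod>j<n. p1 (fst p j)) + (\<Prod>j<n. p2 (snd p j)) + (\<integral>\<^sup>+w. (\<Prod>j<n. h1 (fst p j) (snd p j) (w j)) \<partial>gblock n)
     + (\<integral>\<^sup>+w. (\<Prod>j<n. h2 (fst p j) (snd p j) (w j)) \<partial>gblock n)) \<in> borel_measurable (gblock n \<Otimes>\<^sub>M gblock n)"
  proof (intro borel_measurable_add)
    show "(\<lambda>p. \<Prod>j<n. p1 (fst p j)) \<in> borel_measurable (gblock n \<Otimes>\<^sub>M gblock n)" by measurable
    show "(\<lambda>p. \<Prod>j<n. p2 (snd p j)) \<in> borel_measurable (gblock n \<Otimes>\<^sub>M gblock n)" by measurable
  qed (use measurable_gblock_prod3(1)[OF h_meas(1), of n] measurable_gblock_prod3(1)[OF h_meas(2), of n] in \<open>simp_all add: case_prod_beta'\<close>)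
  then show ?thesis by (simp add: bt_def case_prod_beta')
qed

lemma total_bound:
  assumes W: "finite W1" "finite W2"
  shows "(\<lambda>(\<omega>1, \<omega>2). total n W1 W2 \<omega>1 \<omega>2) \<in> borel_measurable (PiM W1 (\<lambda>_. gblock n) \<Otimes>\<^sub>M PiM W2 (\<lambda>_. gblock n))"
    and "(\<integral>\<^sup>+\<omega>. total n W1 W2 (fst \<omega>) (snd \<omega>) \<partial>(PiM W1 (\<lambda>_. gblock n) \<Otimes>\<^sub>M PiM W2 (\<lambda>_. gblock n))) \<le>
      of_nat (card W1) * of_nat (card W2) * ((\<beta>1 ^ n + \<beta>2 ^ n + \<tau>1 ^ n + \<tau>2 ^ n) + of_nat (card W1 - 1) * ennreal (exp (- (real n * g1)))
        + of_nat (card W1 - 1) * of_nat (card W2 - 1) * ennreal (exp (- (real n * g2))))"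
proof -
  have w: "(\<lambda>(x', x). wt n x' x) \<in> borel_measurable (gblock n \<Otimes>\<^sub>M gblock n)"
    using borel_measurable_times_ennreal[OF borel_measurable_const[of "ennreal (exp (- (real n * g1)))"] measurable_gblock_prod3(1)[OF ennreal_wrong1_measurable, of n]]
    by (simp add: wt_def case_prod_beta')
  have v: "(\<lambda>((x', x), (y', y)). vt n x' x y' y) \<in> borel_measurable ((gblock n \<Otimes>\<^sub>M gblock n) \<Otimes>\<^sub>M (gblock n \<Otimes>\<^sub>M gblock n))"
    using borel_measurable_times_ennreal[OF borel_measurable_const[of "ennreal (exp (- (real n * g2)))"] measurable_wrong2_block(1)[of n A C]]
    by (simp add: vt_def case_prod_beta')
  have Eb: "(\<integral>\<^sup>+x. \<integral>\<^sup>+y. bt n x y \<partial>gblock n \<partial>gblock n) \<le> \<beta>1 ^ n + \<beta>2 ^ n + \<tau>1 ^ n + \<tau>2 ^ n"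
  proof -
    have m1: "(\<lambda>x. \<Prod>j<n. p1 (x j)) \<in> borel_measurable (gblock n)" by measurable
    have m2: "(\<lambda>x. \<Prod>j<n. p2 (x j)) \<in> borel_measurable (gblock n)" by measurable
    have sec: "(\<lambda>y. f x y) \<in> borel_measurable (gblock n)"
      if "(\<lambda>(x, y). f x y) \<in> borel_measurable (gblock n \<Otimes>\<^sub>M gblock n)" "x \<in> space (gblock n)" for f :: "(nat \<Rightarrow> real^'n) \<Rightarrow> (nat \<Rightarrow> real^'n) \<Rightarrow> ennreal" and x
      using measurable_compose[OF measurable_Pair1'[OF that(2)] that(1)] by simp
    note h = measurable_gblock_prod3(1)[OF h_meas(1), of n] measurable_gblock_prod3(1)[OF h_meas(2), of n]
    have "(\<integral>\<^sup>+x. \<integral>\<^sup>+y. bt n x y \<partial>gblock n \<partial>gblock n) = (\<integral>\<^sup>+x. (\<Prod>j<n. p1 (x j)) + (\<integral>\<^sup>+y. (\<Prod>j<n. p2 (y j)) \<partial>gblock n)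
        + (\<integral>\<^sup>+y. \<integral>\<^sup>+w. (\<Prod>j<n. h1 (x j) (y j) (w j)) \<partial>gblock n \<partial>gblock n)
        + (\<integral>\<^sup>+y. \<integral>\<^sup>+w. (\<Prod>j<n. h2 (x j) (y j) (w j)) \<partial>gblock n \<partial>gblock n) \<partial>gblock n)"
    proof (rule nn_integral_cong)
      fix x :: "nat \<Rightarrow> real^'n" assume x: "x \<in> space (gblock n)"
      show "(\<integral>\<^sup>+y. bt n x y \<partial>gblock n) = (\<Prod>j<n. p1 (x j)) + (\<integral>\<^sup>+y. (\<Prod>j<n. p2 (y j)) \<partial>gblock n)
        + (\<integral>\<^sup>+y. \<integral>\<^sup>+w. (\<Prod>j<n. h1 (x j) (y j) (w j)) \<partial>gblock n \<partial>gblock n)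
        + (\<integral>\<^sup>+y. \<integral>\<^sup>+w. (\<Prod>j<n. h2 (x j) (y j) (w j)) \<partial>gblock n \<partial>gblock n)"
        unfolding bt_def
        by (subst nn_integral_add, (intro borel_measurable_add borel_measurable_const m2 sec[OF h(1) x]), rule sec[OF h(2) x],
            subst nn_integral_add, (intro borel_measurable_add borel_measurable_const m2), rule sec[OF h(1) x],
            subst nn_integral_add, rule borel_measurable_const, rule m2, simp only: nn_integral_gblock_const)
    qed
    also have "\<dots> = (\<integral>\<^sup>+x. (\<Prod>j<n. p1 (x j)) \<partial>gblock n) + (\<integral>\<^sup>+y. (\<Prod>j<n. p2 (y j)) \<partial>gblock n)
        + (\<integral>\<^sup>+x. \<integral>\<^sup>+y. \<integral>\<^sup>+w. (\<Prod>j<n. h1 (x j) (y j) (w j)) \<partial>gblock n \<partial>gblock n \<partial>gblock n)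
        + (\<integral>\<^sup>+x. \<integral>\<^sup>+y. \<integral>\<^sup>+w. (\<Prod>j<n. h2 (x j) (y j) (w j)) \<partial>gblock n \<partial>gblock n \<partial>gblock n)"
      by (subst nn_integral_add, (intro borel_measurable_add borel_measurable_const m1 gblock.borel_measurable_nn_integral h(1)),
          (rule gblock.borel_measurable_nn_integral, rule h(2)),
          subst nn_integral_add, (intro borel_measurable_add borel_measurable_const m1),
          (rule gblock.borel_measurable_nn_integral, rule h(1)),
          subst nn_integral_add, rule m1, rule borel_measurable_const, simp only: nn_integral_gblock_const)
    also have "\<dots> \<le> \<beta>1 ^ n + \<beta>2 ^ n + \<tau>1 ^ n + \<tau>2 ^ n"
      unfolding nn_integral_gblock_prod3[OF h_meas(1)] nn_integral_gblock_prod3[OF h_meas(2)]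
        nn_integral_gblock_prod[where f = "\<lambda>_. p1", OF p_meas(1)] nn_integral_gblock_prod[where f = "\<lambda>_. p2", OF p_meas(2)] prod_constant card_lessThan
      by (intro add_mono power_mono p_int h1_int h2_int) auto
    finally show ?thesis .
  qed
  have Ew: "(\<integral>\<^sup>+x'. \<integral>\<^sup>+x. wt n x' x \<partial>gblock n \<partial>gblock n) \<le> ennreal (exp (- (real n * g1)))"
  proof -
    note m = measurable_gblock_prod3(1)[OF ennreal_wrong1_measurable, of n]
    have "(\<integral>\<^sup>+x'. \<integral>\<^sup>+x. wt n x' x \<partial>gblock n \<partial>gblock n) = ennreal (exp (- (real n * g1))) *
       (\<integral>\<^sup>+x'. \<integral>\<^sup>+x. \<integral>\<^sup>+w. (\<Prod>j<n. ennreal (wrong1 A (x' j) (x j) (w j))) \<partial>gblock n \<partial>gblock n \<partial>gblock n)"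
    proof -
      have "(\<integral>\<^sup>+x. wt n x' x \<partial>gblock n) = ennreal (exp (- (real n * g1))) * (\<integral>\<^sup>+x. \<integral>\<^sup>+w. (\<Prod>j<n. ennreal (wrong1 A (x' j) (x j) (w j))) \<partial>gblock n \<partial>gblock n)"
        if "x' \<in> space (gblock n)" for x'
        unfolding wt_def by (rule nn_integral_cmult) (use measurable_compose[OF measurable_Pair1'[OF that] m] in simp)
      then have "(\<integral>\<^sup>+x'. \<integral>\<^sup>+x. wt n x' x \<partial>gblock n \<partial>gblock n) = (\<integral>\<^sup>+x'. ennreal (exp (- (real n * g1))) *
         (\<integral>\<^sup>+x. \<integral>\<^sup>+w. (\<Prod>j<n. ennreal (wrong1 A (x' j) (x j) (w j))) \<partial>gblock n \<partial>gblock n) \<partial>gblock n)"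
        by (intro nn_integral_cong)
      also have "\<dots> = ennreal (exp (- (real n * g1))) *
         (\<integral>\<^sup>+x'. \<integral>\<^sup>+x. \<integral>\<^sup>+w. (\<Prod>j<n. ennreal (wrong1 A (x' j) (x j) (w j))) \<partial>gblock n \<partial>gblock n \<partial>gblock n)"
        by (rule nn_integral_cmult) (rule gblock.borel_measurable_nn_integral[OF m])
      finally show ?thesis .
    qed
    then show ?thesis by (simp only: nn_integral_gblock_prod3[OF ennreal_wrong1_measurable] nn_integral_wrong1 power_one mult_1_right order_refl)
  qed
  have Ev: "(\<integral>\<^sup>+x'. \<integral>\<^sup>+x. \<integral>\<^sup>+y'. \<integral>\<^sup>+y. vt n x' x y' y \<partial>gblock n \<partial>gblock n \<partial>gblock n \<partial>gblock n) \<le> ennreal (exp (- (real n * g2)))"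
  proof -
    let ?c = "ennreal (exp (- (real n * g2)))"
    have "(\<integral>\<^sup>+x'. \<integral>\<^sup>+x. \<integral>\<^sup>+y'. \<integral>\<^sup>+y. vt n x' x y' y \<partial>gblock n \<partial>gblock n \<partial>gblock n \<partial>gblock n) = ?c *
       (\<integral>\<^sup>+x'. \<integral>\<^sup>+x. \<integral>\<^sup>+y'. \<integral>\<^sup>+y. \<integral>\<^sup>+w. (\<Prod>j<n. ennreal (wrong2 A C (x' j) (x j) (y' j) (y j) (w j))) \<partial>gblock n \<partial>gblock n \<partial>gblock n \<partial>gblock n \<partial>gblock n)"
      unfolding vt_def wrong2_def
      by (subst nn_integral_cmult[symmetric], measurable, intro nn_integral_cong,
          subst nn_integral_cmult[symmetric], measurable, intro nn_integral_cong,
          subst nn_integral_cmult[symmetric], measurable, intro nn_integral_cong,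
          subst nn_integral_cmult[symmetric], measurable)
    then show ?thesis by (simp only: nn_integral_gblock_wrong2 mult_1_right order_refl)
  qed
  show "(\<lambda>(\<omega>1, \<omega>2). total n W1 W2 \<omega>1 \<omega>2) \<in> borel_measurable (PiM W1 (\<lambda>_. gblock n) \<Otimes>\<^sub>M PiM W2 (\<lambda>_. gblock n))"
    unfolding total_def by (rule nn_integral_codebooks_le(1)[OF prob_space_gblock W bt_measurable w v Eb Ew Ev])
  show "(\<integral>\<^sup>+\<omega>. total n W1 W2 (fst \<omega>) (snd \<omega>) \<partial>(PiM W1 (\<lambda>_. gblock n) \<Otimes>\<^sub>M PiM W2 (\<lambda>_. gblock n))) \<le>
      of_nat (card W1) * of_nat (card W2) * ((\<beta>1 ^ n + \<beta>2 ^ n + \<tau>1 ^ n + \<tau>2 ^ n) + of_nat (card W1 - 1) * ennreal (exp (- (real n * g1)))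
        + of_nat (card W1 - 1) * of_nat (card W2 - 1) * ennreal (exp (- (real n * g2))))"
    unfolding total_def by (rule nn_integral_codebooks_le(2)[OF prob_space_gblock W bt_measurable w v Eb Ew Ev])
qed

end

context gaussian_receiver
begin

definition llr1 :: "nat \<Rightarrow> (nat \<Rightarrow> real^'n) \<Rightarrow> (nat \<Rightarrow> real^'n) \<Rightarrow> (nat \<Rightarrow> real^'n) \<Rightarrow> real" where
  "llr1 n x x2 y = (\<Sum>j<n. ln (phi (y j - A *v x j - C *v x2 j) / gdens S1 (y j - C *v x2 j)))"

definition llr2 :: "nat \<Rightarrow> (nat \<Rightarrow> real^'n) \<Rightarrow> (nat \<Rightarrow> real^'n) \<Rightarrow> (nat \<Rightarrow> real^'n) \<Rightarrow> real" where
  "llr2 n x x2 y = (\<Sum>j<n. ln (phi (y j - A *v x j - C *v x2 j) / gdens S2 (y j)))"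

text \<open>The other message is decoded non-uniquely: a wrong \<open>m2\<close> next to the right \<open>m\<close> is no error, which is why
  no bound on the other rate alone is needed.\<close>

definition good :: "nat \<Rightarrow> nat set \<Rightarrow> (nat \<Rightarrow> nat \<Rightarrow> real^'n) \<Rightarrow> (nat \<Rightarrow> nat \<Rightarrow> real^'n) \<Rightarrow> nat \<Rightarrow> (nat \<Rightarrow> real^'n) \<Rightarrow> bool" where
  "good n W2 \<omega>1 \<omega>2 m y \<longleftrightarrow> (\<exists>m2\<in>W2. real n * g1 < llr1 n (\<omega>1 m) (\<omega>2 m2) y \<and> real n * g2 < llr2 n (\<omega>1 m) (\<omega>2 m2) y)"

text \<open>The analysis uses \<open>dec_correct\<close>, where exactly one message is good.
  \<open>LEAST\<close> and \<open>SOME\<close> settle the remaining outputs so that the map is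
  total, measurable and has values in \<open>W1\<close>.\<close>

definition dec :: "nat \<Rightarrow> nat set \<Rightarrow> nat set \<Rightarrow> (nat \<Rightarrow> nat \<Rightarrow> real^'n) \<Rightarrow> (nat \<Rightarrow> nat \<Rightarrow> real^'n) \<Rightarrow> (nat \<Rightarrow> real^'n) \<Rightarrow> nat" where
  "dec n W1 W2 \<omega>1 \<omega>2 y = (if \<exists>m\<in>W1. good n W2 \<omega>1 \<omega>2 m y then LEAST m. m \<in> W1 \<and> good n W2 \<omega>1 \<omega>2 m y else (SOME m. m \<in> W1))"

lemma llr_measurable:
  "llr1 n x x2 \<in> borel_measurable (PiM {..<n} (\<lambda>_. borel))" "llr2 n x x2 \<in> borel_measurable (PiM {..<n} (\<lambda>_. borel))"
  unfolding llr1_def[abs_def] llr2_def[abs_def] by measurable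

lemma good_measurable:
  assumes "finite W2"
  shows "Measurable.pred (PiM {..<n} (\<lambda>_. borel)) (good n W2 \<omega>1 \<omega>2 m)"
proof -
  note [measurable] = llr_measurable
  show ?thesis unfolding good_def[abs_def] using assms by measurable
qed

lemma dec_in: "W1 \<noteq> {} \<Longrightarrow> dec n W1 W2 \<omega>1 \<omega>2 y \<in> W1"
proof -
  assume "W1 \<noteq> {}"
  show ?thesis
  proof (cases "\<exists>m\<in>W1. good n W2 \<omega>1 \<omega>2 m y")
    case True
    then have "\<exists>m. m \<in> W1 \<and> good n W2 \<omega>1 \<omega>2 m y" by blast
    from LeastI_ex[OF this] show ?thesis using True by (simp add: dec_def)
  next
    case False
    then show ?thesis using \<open>W1 \<noteq> {}\<close> by (simp add: dec_def some_in_eq)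
  qed
qed

lemma dec_measurable:
  assumes "finite W1" "W1 \<noteq> {}" "finite W2"
  shows "dec n W1 W2 \<omega>1 \<omega>2 \<in> measurable (PiM {..<n} (\<lambda>_. borel)) (count_space W1)"
proof -
  note [measurable] = good_measurable[OF assms(3)]
  have [measurable]: "Measurable.pred (PiM {..<n} (\<lambda>_. borel)) (\<lambda>y. \<exists>m\<in>W1. good n W2 \<omega>1 \<omega>2 m y)"
    using assms(1) by measurable
  have "(\<lambda>y. dec n W1 W2 \<omega>1 \<omega>2 y) \<in> measurable (PiM {..<n} (\<lambda>_. borel)) (count_space UNIV)"
    unfolding dec_def by measurable
  then show ?thesis
    unfolding measurable_count_space_eq2[OF assms(1)]
    using dec_in[OF assms(2)] by (auto intro: measurable_sets)
qed

lemma dec_correct: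
  assumes "m1 \<in> W1" "good n W2 \<omega>1 \<omega>2 m1 y" "\<And>m. m \<in> W1 \<Longrightarrow> m \<noteq> m1 \<Longrightarrow> \<not> good n W2 \<omega>1 \<omega>2 m y"
  shows "dec n W1 W2 \<omega>1 \<omega>2 y = m1"
proof -
  have "(LEAST m. m \<in> W1 \<and> good n W2 \<omega>1 \<omega>2 m y) = m1"
    by (rule Least_equality) (use assms in \<open>auto intro: le_refl\<close>)
  then show ?thesis using assms by (auto simp: dec_def)
qed

text \<open>Markov's inequality in pointwise form: once the log-likelihood sum passes the threshold,
  the rescaled product dominates 1.\<close>

lemma one_le_wrong_product:
  fixes f :: "nat \<Rightarrow> real"
  assumes f: "\<And>j. j < n \<Longrightarrow> 0 < f j" and s: "real n * g < (\<Sum>j<n. ln (f j))"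
  shows "1 \<le> ennreal (exp (- (real n * g))) * (\<Prod>j<n. ennreal (f j))"
proof -
  have "1 \<le> exp (- (real n * g) + (\<Sum>j<n. ln (f j)))" using s by simp
  also have "\<dots> = exp (- (real n * g)) * (\<Prod>j<n. f j)"
  proof -
    have "exp (\<Sum>j<n. ln (f j)) = (\<Prod>j<n. f j)"
      unfolding exp_sum[OF finite_lessThan] by (rule prod.cong) (simp_all add: f)
    then show ?thesis by (simp only: exp_add)
  qed
  finally have "ennreal 1 \<le> ennreal (exp (- (real n * g)) * (\<Prod>j<n. f j))" by (rule ennreal_leI)
  also have "\<dots> = ennreal (exp (- (real n * g))) * ennreal (\<Prod>j<n. f j)" by (rule ennreal_mult') simp
  also have "ennreal (\<Prod>j<n. f j) = (\<Prod>j<n. ennreal (f j))"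
    by (rule prod_ennreal[symmetric]) (auto intro: less_imp_le f)
  finally show ?thesis by simp
qed

text \<open>If every group on the right is below 1, then no sent codeword is silenced, the sent pair
  passes both thresholds, and no other message of user 1 passes, so the decision is correct. The
  bound is pointwise in codebooks and noise, which allows averaging in any order afterwards.\<close>

lemma error_indicator_le:
  fixes \<omega>1 \<omega>2 :: "nat \<Rightarrow> nat \<Rightarrow> real^'n" and z :: "nat \<Rightarrow> real^'n"
  assumes n: "0 < n" and W: "finite W1" "finite W2" "m1 \<in> W1" "m2 \<in> W2"
  defines "y \<equiv> \<lambda>z. received H J n (enc B1 P1 n \<omega>1 m1) (enc B2 P2 n \<omega>2 m2) z"
  shows "indicator {z. dec n W1 W2 \<omega>1 \<omega>2 (y z) \<noteq> m1} z \<le>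
     (\<Prod>j<n. p1 (\<omega>1 m1 j)) + (\<Prod>j<n. p2 (\<omega>2 m2 j)) + (\<Prod>j<n. h1 (\<omega>1 m1 j) (\<omega>2 m2 j) (z j)) + (\<Prod>j<n. h2 (\<omega>1 m1 j) (\<omega>2 m2 j) (z j))
     + (\<Sum>k1\<in>W1 - {m1}. ennreal (exp (- (real n * g1))) * (\<Prod>j<n. ennreal (wrong1 A (\<omega>1 k1 j) (\<omega>1 m1 j) (z j))))
     + (\<Sum>k1\<in>W1 - {m1}. \<Sum>k2\<in>W2 - {m2}. ennreal (exp (- (real n * g2))) *
          (\<Prod>j<n. ennreal (wrong2 A C (\<omega>1 k1 j) (\<omega>1 m1 j) (\<omega>2 k2 j) (\<omega>2 m2 j) (z j))))"
    (is "_ \<le> ?p1 + ?p2 + ?h1 + ?h2 + ?w + ?v")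
proof (cases "1 \<le> ?p1 \<or> 1 \<le> ?p2 \<or> 1 \<le> ?h1 \<or> 1 \<le> ?h2 \<or> 1 \<le> ?w \<or> 1 \<le> ?v")
  case True
  have "1 \<le> ?p1 + ?p2 + ?h1 + ?h2 + ?w + ?v"
  proof -
    have "?p1 \<le> ?p1 + (?p2 + (?h1 + (?h2 + (?w + ?v))))"
      "?p2 \<le> ?p2 + (?p1 + (?h1 + (?h2 + (?w + ?v))))"
      "?h1 \<le> ?h1 + (?p1 + (?p2 + (?h2 + (?w + ?v))))"
      "?h2 \<le> ?h2 + (?p1 + (?p2 + (?h1 + (?w + ?v))))"
      "?w \<le> ?w + (?p1 + (?p2 + (?h1 + (?h2 + ?v))))"
      "?v \<le> ?v + (?p1 + (?p2 + (?h1 + (?h2 + ?w))))"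
      by (rule add_increasing2; simp)+
    with True show ?thesis by (auto simp only: add_ac intro: order_trans)
  qed
  then show ?thesis by (auto simp: indicator_def)
next
  case False
  \<comment> \<open>The power weight is below 1, so the test did not fire and the transmitted block
    is the one the decoder assumes.\<close>
  have e1: "enc B1 P1 n \<omega>1 m1 j = B1 *v \<omega>1 m1 j" for j
    using False p1_test[OF n, of "\<omega>1 m1"] by (auto simp: enc_def not_le)
  have e2: "enc B2 P2 n \<omega>2 m2 j = B2 *v \<omega>2 m2 j" for j
    using False p2_test[OF n, of "\<omega>2 m2"] by (auto simp: enc_def not_le)
  have yj: "y z j = z j + A *v \<omega>1 m1 j + C *v \<omega>2 m2 j" if "j < n" for j
    using that by (simp add: y_def received_def e1 e2 A C matrix_vector_mul_assoc[symmetric] add_ac)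
  have gp: "0 < gdens S1 a" "0 < gdens S2 a" for a by (intro gdens_pos pdef_S)+
  have wp: "0 < wrong1 A a b c" "0 < wrong2 A C a b d e c" for a b c d e
    unfolding wrong1_def wrong2_def by (intro divide_pos_pos phi_pos gp)+
  have "llr1 n (\<omega>1 m1) (\<omega>2 m2) (y z) = (\<Sum>j<n. infod S1 A 0 (\<omega>1 m1 j, \<omega>2 m2 j, z j))"
    unfolding llr1_def
  proof (rule sum.cong[OF refl])
    fix j assume "j \<in> {..<n}"
    then show "ln (phi (y z j - A *v \<omega>1 m1 j - C *v \<omega>2 m2 j) / gdens S1 (y z j - C *v \<omega>2 m2 j)) = infod S1 A 0 (\<omega>1 m1 j, \<omega>2 m2 j, z j)"
      using gp(1) phi_pos by (simp add: yj infod_def tilt_def ln_div less_imp_neq[symmetric])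
  qed
  note eq1 = this
  have l1: "real n * g1 < llr1 n (\<omega>1 m1) (\<omega>2 m2) (y z)"
  proof (rule ccontr)
    assume "\<not> ?thesis"
    then have "1 \<le> (\<Prod>j<n. h1 (\<omega>1 m1 j) (\<omega>2 m2 j) (z j))"
      by (intro h1_test) (simp add: eq1)
    then show False using False by simp
  qed
  have "llr2 n (\<omega>1 m1) (\<omega>2 m2) (y z) = (\<Sum>j<n. infod S2 A C (\<omega>1 m1 j, \<omega>2 m2 j, z j))"
    unfolding llr2_def
  proof (rule sum.cong[OF refl])
    fix j assume "j \<in> {..<n}"
    then show "ln (phi (y z j - A *v \<omega>1 m1 j - C *v \<omega>2 m2 j) / gdens S2 (y z j)) = infod S2 A C (\<omega>1 m1 j, \<omega>2 m2 j, z j)"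
      using gp(2) phi_pos by (simp add: yj infod_def tilt_def ln_div less_imp_neq[symmetric] add.assoc)
  qed
  note eq2 = this
  have l2: "real n * g2 < llr2 n (\<omega>1 m1) (\<omega>2 m2) (y z)"
  proof (rule ccontr)
    assume "\<not> ?thesis"
    then have "1 \<le> (\<Prod>j<n. h2 (\<omega>1 m1 j) (\<omega>2 m2 j) (z j))"
      by (intro h2_test) (simp add: eq2)
    then show False using False by simp
  qed
  have "good n W2 \<omega>1 \<omega>2 m1 (y z)" using l1 l2 W by (auto simp: good_def)
  moreover have "\<not> good n W2 \<omega>1 \<omega>2 k1 (y z)" if k1: "k1 \<in> W1" "k1 \<noteq> m1" for k1
  proof
    assume "good n W2 \<omega>1 \<omega>2 k1 (y z)"
    then obtain k2 where k2: "k2 \<in> W2" "real n * g1 < llr1 n (\<omega>1 k1) (\<omega>2 k2) (y z)" "real n * g2 < llr2 n (\<omega>1 k1) (\<omega>2 k2) (y z)"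
      by (auto simp: good_def)
    show False
    \<comment> \<open>With the sent interferer \<open>m2\<close> the first threshold excludes
      \<open>k1\<close>; the interference cancels in that ratio. With a different interferer both
      codewords are independent of the output, and the second threshold excludes the pair.\<close>
    proof (cases "k2 = m2")
      case True
      have "llr1 n (\<omega>1 k1) (\<omega>2 m2) (y z) = (\<Sum>j<n. ln (wrong1 A (\<omega>1 k1 j) (\<omega>1 m1 j) (z j)))"
        unfolding llr1_def by (intro sum.cong refl) (simp add: yj wrong1_def algebra_simps)
      then have "1 \<le> ennreal (exp (- (real n * g1))) * (\<Prod>j<n. ennreal (wrong1 A (\<omega>1 k1 j) (\<omega>1 m1 j) (z j)))"
        using k2(2) unfolding True by (intro one_le_wrong_product wp) simp
      also have "\<dots> \<le> ?w" using W k1 by (intro member_le_sum) auto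
      finally show False using False by simp
    next
      case ne: False
      have "llr2 n (\<omega>1 k1) (\<omega>2 k2) (y z) = (\<Sum>j<n. ln (wrong2 A C (\<omega>1 k1 j) (\<omega>1 m1 j) (\<omega>2 k2 j) (\<omega>2 m2 j) (z j)))"
        unfolding llr2_def by (intro sum.cong refl) (simp add: yj wrong2_def)
      then have "1 \<le> ennreal (exp (- (real n * g2))) * (\<Prod>j<n. ennreal (wrong2 A C (\<omega>1 k1 j) (\<omega>1 m1 j) (\<omega>2 k2 j) (\<omega>2 m2 j) (z j)))"
        using k2(3) by (intro one_le_wrong_product wp) simp
      also have "\<dots> \<le> (\<Sum>k2\<in>W2 - {m2}. ennreal (exp (- (real n * g2))) * (\<Prod>j<n. ennreal (wrong2 A C (\<omega>1 k1 j) (\<omega>1 m1 j) (\<omega>2 k2 j) (\<omega>2 m2 j) (z j))))"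
        using W k2 ne by (intro member_le_sum) auto
      also have "\<dots> \<le> ?v" using W k1
        by (intro member_le_sum[where f = "\<lambda>k1. \<Sum>k2\<in>W2 - {m2}. ennreal (exp (- (real n * g2))) * (\<Prod>j<n. ennreal (wrong2 A C (\<omega>1 k1 j) (\<omega>1 m1 j) (\<omega>2 k2 j) (\<omega>2 m2 j) (z j)))"]) auto
      finally show False using False by simp
    qed
  qed
  ultimately have "dec n W1 W2 \<omega>1 \<omega>2 (y z) = m1" by (rule dec_correct[OF W(3)])
  then show ?thesis by simp
qed

lemma err_le_total:
  assumes n: "0 < n" and W: "finite W1" "W1 \<noteq> {}" "finite W2" "W2 \<noteq> {}"
  shows "of_nat (card W1) * of_nat (card W2) * ennreal (err H J n W1 W2 (enc B1 P1 n \<omega>1) (enc B2 P2 n \<omega>2) (dec n W1 W2 \<omega>1 \<omega>2)) \<le> total n W1 W2 \<omega>1 \<omega>2"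
proof -
  define E where "E m1 m2 = {z \<in> space (gblock n). dec n W1 W2 \<omega>1 \<omega>2 (received H J n (enc B1 P1 n \<omega>1 m1) (enc B2 P2 n \<omega>2 m2) z) \<noteq> m1}" for m1 m2
  have Em: "E m1 m2 \<in> sets (gblock n)" for m1 m2
    unfolding E_def by (rule error_event_measurable[OF dec_measurable[OF W(1,2,3)], where P = "\<lambda>m. m \<noteq> m1"])
  have c: "real (card W1) > 0" "real (card W2) > 0" using W by (auto simp: card_gt_0_iff)
  have le: "ennreal (measure (gblock n) (E m1 m2)) \<le> bt n (\<omega>1 m1) (\<omega>2 m2) + (\<Sum>k1\<in>W1 - {m1}. wt n (\<omega>1 k1) (\<omega>1 m1)) +
      (\<Sum>k1\<in>W1 - {m1}. \<Sum>k2\<in>W2 - {m2}. vt n (\<omega>1 k1) (\<omega>1 m1) (\<omega>2 k2) (\<omega>2 m2))" if m: "m1 \<in> W1" "m2 \<in> W2" for m1 m2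
  proof -
    have hm: "(\<lambda>z. \<Prod>j<n. h1 (\<omega>1 m1 j) (\<omega>2 m2 j) (z j)) \<in> borel_measurable (gblock n)"
      "(\<lambda>z. \<Prod>j<n. h2 (\<omega>1 m1 j) (\<omega>2 m2 j) (z j)) \<in> borel_measurable (gblock n)"
      by (intro measurable_gblock_prod3(2) h_meas)+
    have wm: "(\<lambda>z. \<Prod>j<n. ennreal (wrong1 A (\<omega>1 k1 j) (\<omega>1 m1 j) (z j))) \<in> borel_measurable (gblock n)" for k1
      by (intro measurable_gblock_prod3(2) ennreal_wrong1_measurable)
    note vm = measurable_wrong2_block(2)
    have "ennreal (measure (gblock n) (E m1 m2)) = (\<integral>\<^sup>+z. indicator (E m1 m2) z \<partial>gblock n)"
      using Em by (simp add: gblock.emeasure_eq_measure)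
    also have "\<dots> \<le> (\<integral>\<^sup>+z. (\<Prod>j<n. p1 (\<omega>1 m1 j)) + (\<Prod>j<n. p2 (\<omega>2 m2 j)) + (\<Prod>j<n. h1 (\<omega>1 m1 j) (\<omega>2 m2 j) (z j)) + (\<Prod>j<n. h2 (\<omega>1 m1 j) (\<omega>2 m2 j) (z j))
     + (\<Sum>k1\<in>W1 - {m1}. ennreal (exp (- (real n * g1))) * (\<Prod>j<n. ennreal (wrong1 A (\<omega>1 k1 j) (\<omega>1 m1 j) (z j))))
     + (\<Sum>k1\<in>W1 - {m1}. \<Sum>k2\<in>W2 - {m2}. ennreal (exp (- (real n * g2))) *
          (\<Prod>j<n. ennreal (wrong2 A C (\<omega>1 k1 j) (\<omega>1 m1 j) (\<omega>2 k2 j) (\<omega>2 m2 j) (z j)))) \<partial>gblock n)"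
    proof (rule nn_integral_mono)
      fix z :: "nat \<Rightarrow> real^'n" assume "z \<in> space (gblock n)"
      then have "indicator (E m1 m2) z = (indicator {z. dec n W1 W2 \<omega>1 \<omega>2 (received H J n (enc B1 P1 n \<omega>1 m1) (enc B2 P2 n \<omega>2 m2) z) \<noteq> m1} z :: ennreal)"
        by (simp add: E_def indicator_def)
      also note error_indicator_le[OF n W(1,3) m]
      finally show "indicator (E m1 m2) z \<le> (\<Prod>j<n. p1 (\<omega>1 m1 j)) + (\<Prod>j<n. p2 (\<omega>2 m2 j)) + (\<Prod>j<n. h1 (\<omega>1 m1 j) (\<omega>2 m2 j) (z j)) + (\<Prod>j<n. h2 (\<omega>1 m1 j) (\<omega>2 m2 j) (z j))
       + (\<Sum>k1\<in>W1 - {m1}. ennreal (exp (- (real n * g1))) * (\<Prod>j<n. ennreal (wrong1 A (\<omega>1 k1 j) (\<omega>1 m1 j) (z j))))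
       + (\<Sum>k1\<in>W1 - {m1}. \<Sum>k2\<in>W2 - {m2}. ennreal (exp (- (real n * g2))) *
          (\<Prod>j<n. ennreal (wrong2 A C (\<omega>1 k1 j) (\<omega>1 m1 j) (\<omega>2 k2 j) (\<omega>2 m2 j) (z j))))" .
    qed
    also have "\<dots> = bt n (\<omega>1 m1) (\<omega>2 m2) + (\<Sum>k1\<in>W1 - {m1}. wt n (\<omega>1 k1) (\<omega>1 m1)) +
      (\<Sum>k1\<in>W1 - {m1}. \<Sum>k2\<in>W2 - {m2}. vt n (\<omega>1 k1) (\<omega>1 m1) (\<omega>2 k2) (\<omega>2 m2))"
    proof -
      have w: "(\<integral>\<^sup>+z. (\<Sum>k1\<in>W1 - {m1}. ennreal (exp (- (real n * g1))) * (\<Prod>j<n. ennreal (wrong1 A (\<omega>1 k1 j) (\<omega>1 m1 j) (z j)))) \<partial>gblock n) =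
          (\<Sum>k1\<in>W1 - {m1}. wt n (\<omega>1 k1) (\<omega>1 m1))"
        unfolding wt_def by (subst nn_integral_sum, intro borel_measurable_times_ennreal borel_measurable_const wm)
           (intro sum.cong refl nn_integral_cmult wm)
      have v: "(\<integral>\<^sup>+z. (\<Sum>k1\<in>W1 - {m1}. \<Sum>k2\<in>W2 - {m2}. ennreal (exp (- (real n * g2))) *
          (\<Prod>j<n. ennreal (wrong2 A C (\<omega>1 k1 j) (\<omega>1 m1 j) (\<omega>2 k2 j) (\<omega>2 m2 j) (z j)))) \<partial>gblock n) =
          (\<Sum>k1\<in>W1 - {m1}. \<Sum>k2\<in>W2 - {m2}. vt n (\<omega>1 k1) (\<omega>1 m1) (\<omega>2 k2) (\<omega>2 m2))"
        unfolding vt_def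
        by (subst nn_integral_sum, intro borel_measurable_sum borel_measurable_times_ennreal borel_measurable_const vm,
            intro sum.cong refl, subst nn_integral_sum, intro borel_measurable_times_ennreal borel_measurable_const vm)
           (intro sum.cong refl nn_integral_cmult vm)
      show ?thesis
        unfolding bt_def
        by (subst nn_integral_add, (intro borel_measurable_add borel_measurable_sum borel_measurable_times_ennreal borel_measurable_const wm hm),
            (intro borel_measurable_sum borel_measurable_times_ennreal borel_measurable_const vm),
            subst nn_integral_add, (intro borel_measurable_add borel_measurable_const hm),
            (intro borel_measurable_sum borel_measurable_times_ennreal borel_measurable_const wm),
            subst nn_integral_add, (intro borel_measurable_add borel_measurable_const hm), rule hm,
            subst nn_integral_add, (intro borel_measurable_add borel_measurable_const), rule hm,
            simp only: w v nn_integral_gblock_const)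
    qed
    finally show ?thesis .
  qed
  have e: "of_nat (card W1) * of_nat (card W2) * ennreal (err H J n W1 W2 (enc B1 P1 n \<omega>1) (enc B2 P2 n \<omega>2) (dec n W1 W2 \<omega>1 \<omega>2)) =
      ennreal (\<Sum>m1\<in>W1. \<Sum>m2\<in>W2. measure (gblock n) (E m1 m2))"
  proof -
    have "real (card W1) * real (card W2) * err H J n W1 W2 (enc B1 P1 n \<omega>1) (enc B2 P2 n \<omega>2) (dec n W1 W2 \<omega>1 \<omega>2) = (\<Sum>m1\<in>W1. \<Sum>m2\<in>W2. measure (gblock n) (E m1 m2))"
      using c by (simp add: err_def E_def sum.cartesian_product)
    then show ?thesis
      by (simp add: err_nonneg ennreal_of_nat_eq_real_of_nat ennreal_mult[symmetric])
  qed
  also have "\<dots> = (\<Sum>m1\<in>W1. \<Sum>m2\<in>W2. ennreal (measure (gblock n) (E m1 m2)))"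
    by (simp add: sum_nonneg)
  also have "\<dots> \<le> total n W1 W2 \<omega>1 \<omega>2"
    unfolding total_def by (intro sum_mono le)
  finally show ?thesis .
qed

end

text \<open>A Chernoff weight needs strict slack in the power. With \<open>P = 0\<close> there is
  none, but then \<open>B = 0\<close>, the constraint is never violated, and the weight 0
  serves.\<close>

lemma power_test:
  fixes B :: "real^'n^'n"
  assumes "trace (B ** transpose B) < P \<or> (B = 0 \<and> 0 \<le> P)"
  shows "\<exists>p \<beta>. p \<in> borel_measurable borel \<and> 0 \<le> \<beta> \<and> \<beta> < 1 \<and> (\<integral>\<^sup>+u. p u \<partial>std_gaussian) \<le> ennreal \<beta> \<and>
    (\<forall>n x. 0 < n \<longrightarrow> real n * P < (\<Sum>j<n. (norm (B *v x j))\<^sup>2) \<longrightarrow> 1 \<le> (\<Prod>j<n. p (x j)))"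
  using assms
proof
  assume "trace (B ** transpose B) < P"
  then obtain t \<beta> where t: "t > 0" "0 \<le> \<beta>" "\<beta> < 1" "(\<integral>\<^sup>+g. ennreal (exp (t * ((norm (B *v g))\<^sup>2 - P))) \<partial>std_gaussian) \<le> ennreal \<beta>"
    using power_chernoff by blast
  have "1 \<le> (\<Prod>j<n. ennreal (exp (t * ((norm (B *v x j))\<^sup>2 - P))))" if "real n * P < (\<Sum>j<n. (norm (B *v x j))\<^sup>2)" for n :: nat and x :: "nat \<Rightarrow> real^'n"
  proof -
    have "(\<Prod>j<n. exp (t * ((norm (B *v x j))\<^sup>2 - P))) = exp (t * ((\<Sum>j<n. (norm (B *v x j))\<^sup>2) - real n * P))"
      by (simp add: exp_sum[symmetric] sum_distrib_left[symmetric] sum_subtractf)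
    also have "\<dots> \<ge> 1" using that t(1) by simp
    finally have "ennreal 1 \<le> ennreal (\<Prod>j<n. exp (t * ((norm (B *v x j))\<^sup>2 - P)))" by (intro ennreal_leI)
    then show ?thesis by (simp add: prod_ennreal)
  qed
  then show ?thesis
    using t by (intro exI[of _ "\<lambda>g. ennreal (exp (t * ((norm (B *v g))\<^sup>2 - P)))"] exI[of _ \<beta>]) auto
next
  assume "B = 0 \<and> 0 \<le> P"
  then show ?thesis
    by (intro exI[of _ "\<lambda>_. 0"] exI[of _ 0]) (auto simp: mult_less_0_iff not_less)
qed

lemma infod_test:
  fixes A C :: "real^'n^'n"
  defines "S \<equiv> mat 1 + A ** transpose A + C ** transpose C"
  assumes "a < ln (det S) / 2"
  shows "\<exists>h \<tau>. (\<lambda>(u, v, z). h u v z) \<in> borel_measurable gauss3 \<and> 0 \<le> \<tau> \<and> \<tau> < 1 \<and>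
    (\<integral>\<^sup>+u. \<integral>\<^sup>+v. \<integral>\<^sup>+z. h u v z \<partial>std_gaussian \<partial>std_gaussian \<partial>std_gaussian) \<le> ennreal \<tau> \<and>
    (\<forall>n u v z. (\<Sum>j<n. infod S A C (u j, v j, z j)) \<le> real n * a \<longrightarrow> 1 \<le> (\<Prod>j<n. h (u j) (v j) (z j)))"
proof -
  obtain t \<tau> where t: "t > 0" "0 \<le> \<tau>" "\<tau> < 1" "(\<integral>\<^sup>+u. \<integral>\<^sup>+v. \<integral>\<^sup>+z. ennreal (exp (- t * (infod S A C (u, v, z) - a)))
     \<partial>std_gaussian \<partial>std_gaussian \<partial>std_gaussian) \<le> ennreal \<tau>"
    using infod_chernoff assms(2) unfolding S_def by blast
  define h where "h u v z = ennreal (exp (- t * (infod S A C (u, v, z) - a)))" for u v z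
  have "(\<lambda>x. ennreal (exp (- t * (infod S A C x - a)))) \<in> borel_measurable gauss3"
    by measurable
  then have "(\<lambda>(u, v, z). h u v z) \<in> borel_measurable gauss3" by (simp add: h_def case_prod_beta')
  moreover have "1 \<le> (\<Prod>j<n. h (u j) (v j) (z j))" if "(\<Sum>j<n. infod S A C (u j, v j, z j)) \<le> real n * a" for n :: nat and u v z
  proof -
    have "(\<Prod>j<n. exp (- t * (infod S A C (u j, v j, z j) - a))) = exp (t * (real n * a - (\<Sum>j<n. infod S A C (u j, v j, z j))))"
      by (simp add: exp_sum[symmetric] sum_distrib_left[symmetric] sum_negf sum_subtractf algebra_simps)
    also have "\<dots> \<ge> 1" using that t(1) by simp
    finally have "ennreal 1 \<le> ennreal (\<Prod>j<n. exp (- t * (infod S A C (u j, v j, z j) - a)))" by (intro ennreal_leI)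
    then show ?thesis by (simp add: prod_ennreal h_def)
  qed
  ultimately show ?thesis using t unfolding h_def[symmetric]
    by (intro exI[of _ h] exI[of _ \<tau>]) auto
qed

section \<open>Codebook sizes and existence of good codes\<close>

lemma card_messages_pos: "0 < card (messages n R)"
  by (simp add: card_gt_0_iff)

text \<open>Counting only the wrong messages absorbs the rounding: the ceiling stays below
  \<open>exp (real n * R) + 1\<close>.\<close>

lemma card_messages_le: "real (card (messages n R) - 1) \<le> exp (real n * R)"
proof -
  have "real (card (messages n R)) < exp (real n * R) + 1"
    by (simp add: messages_def) linarith
  moreover have "real (card (messages n R) - 1) = real (card (messages n R)) - 1"
    using card_messages_pos[of n R] by (simp add: of_nat_diff)
  ultimately show ?thesis by linarith
qed

lemma card_messages_0 [simp]: "card (messages n 0) = 1"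
  by (simp add: messages_def)

text \<open>\<open>T\<close> is a random variable on the pair of codebooks that dominates the error
  of some decoder. Keeping \<open>T\<close>, and not just a mean error, lets the bounds of both
  receivers be added on the same codebooks before a realisation is selected.\<close>

definition random_code_bound ::
  "real^'n^'n \<Rightarrow> real^'n^'n \<Rightarrow> real^'n^'n \<Rightarrow> real^'n^'n \<Rightarrow> real \<Rightarrow> real \<Rightarrow> real \<Rightarrow> real \<Rightarrow> real \<Rightarrow>
    ((nat \<Rightarrow> nat \<Rightarrow> real^'n) \<Rightarrow> (nat \<Rightarrow> nat \<Rightarrow> real^'n) \<Rightarrow> ennreal) \<Rightarrow> nat \<Rightarrow> bool" where
  "random_code_bound H J B1 B2 P1 P2 R1 R2 e T n \<longleftrightarrow>
     (\<lambda>\<omega>. T (fst \<omega>) (snd \<omega>)) \<in> borel_measurable (PiM (messages n R1) (\<lambda>_. gblock n) \<Otimes>\<^sub>M PiM (messages n R2) (\<lambda>_. gblock n)) \<and>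
     (\<integral>\<^sup>+\<omega>. T (fst \<omega>) (snd \<omega>) \<partial>(PiM (messages n R1) (\<lambda>_. gblock n) \<Otimes>\<^sub>M PiM (messages n R2) (\<lambda>_. gblock n))) \<le> ennreal e \<and>
     (\<forall>\<omega>1 \<omega>2. \<exists>g. decoder n R1 g \<and> ennreal (err H J n (messages n R1) (messages n R2) (enc B1 P1 n \<omega>1) (enc B2 P2 n \<omega>2) g) \<le> T \<omega>1 \<omega>2)"

text \<open>For \<open>R1 = 0\<close> there is a single message to decode and the wrong-codeword
  terms are void; this covers rates that are 0 while the corresponding information is 0 as well.
  Otherwise the two strict inequalities beat the exponential number of wrong candidates in the two
  groups.\<close>

lemma receiver_bound:
  fixes H J B1 B2 :: "real^'n^'n"
  assumes P: "trace (B1 ** transpose B1) < P1 \<or> (B1 = 0 \<and> 0 \<le> P1)" "trace (B2 ** transpose B2) < P2 \<or> (B2 = 0 \<and> 0 \<le> P2)"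
    and R: "R1 = 0 \<or> (R1 < ln (det (mat 1 + (H ** B1) ** transpose (H ** B1))) / 2 \<and>
      R1 + R2 < ln (det (mat 1 + (H ** B1) ** transpose (H ** B1) + (J ** B2) ** transpose (J ** B2))) / 2)"
  shows "\<exists>(e :: nat \<Rightarrow> real) T. e \<longlonglongrightarrow> 0 \<and> (\<forall>n>0. random_code_bound H J B1 B2 P1 P2 R1 R2 (e n) (T n) n)"
proof -
  define A where "A = H ** B1"
  define C where "C = J ** B2"
  define I1 where "I1 = ln (det (mat 1 + A ** transpose A)) / 2"
  define I2 where "I2 = ln (det (mat 1 + A ** transpose A + C ** transpose C)) / 2"
  \<comment> \<open>Midway between rate and information, so that the right pair passes and wrong
    ones are exponentially rare. At rate 0 only the first requirement remains, and subtracting 1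
    meets it.\<close>
  define g1 where "g1 = (if R1 = 0 then I1 - 1 else (R1 + I1) / 2)"
  define g2 where "g2 = (if R1 = 0 then I2 - 1 else (R1 + R2 + I2) / 2)"
  have g: "g1 < I1" "g2 < I2" "R1 \<noteq> 0 \<Longrightarrow> R1 < g1" "R1 \<noteq> 0 \<Longrightarrow> R1 + R2 < g2"
    using R by (auto simp: g1_def g2_def I1_def I2_def A_def C_def)
  have S0: "mat 1 + A ** transpose A + 0 ** transpose (0 :: real^'n^'n) = mat 1 + A ** transpose A"
    by (simp add: matrix_matrix_mult_def vec_eq_iff)
  obtain p1 \<beta>1 where p1: "p1 \<in> borel_measurable borel" "0 \<le> \<beta>1" "\<beta>1 < 1" "(\<integral>\<^sup>+u. p1 u \<partial>std_gaussian) \<le> ennreal \<beta>1"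
    "\<And>n x. 0 < n \<Longrightarrow> real n * P1 < (\<Sum>j<n. (norm (B1 *v x j))\<^sup>2) \<Longrightarrow> 1 \<le> (\<Prod>j<n. p1 (x j))"
    using power_test[OF P(1)] by blast
  obtain p2 \<beta>2 where p2: "p2 \<in> borel_measurable borel" "0 \<le> \<beta>2" "\<beta>2 < 1" "(\<integral>\<^sup>+u. p2 u \<partial>std_gaussian) \<le> ennreal \<beta>2"
    "\<And>n x. 0 < n \<Longrightarrow> real n * P2 < (\<Sum>j<n. (norm (B2 *v x j))\<^sup>2) \<Longrightarrow> 1 \<le> (\<Prod>j<n. p2 (x j))"
    using power_test[OF P(2)] by blast
  obtain h1 \<tau>1 where h1: "(\<lambda>(u, v, z). h1 u v z) \<in> borel_measurable gauss3" "0 \<le> \<tau>1" "\<tau>1 < 1"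
    "(\<integral>\<^sup>+u. \<integral>\<^sup>+v. \<integral>\<^sup>+z. h1 u v z \<partial>std_gaussian \<partial>std_gaussian \<partial>std_gaussian) \<le> ennreal \<tau>1"
    "\<And>n u v z. (\<Sum>j<n. infod (mat 1 + A ** transpose A) A 0 (u j, v j, z j)) \<le> real n * g1 \<Longrightarrow> 1 \<le> (\<Prod>j<n. h1 (u j) (v j) (z j))"
    using infod_test[of g1 A 0] g(1) unfolding S0 I1_def by blast
  obtain h2 \<tau>2 where h2: "(\<lambda>(u, v, z). h2 u v z) \<in> borel_measurable gauss3" "0 \<le> \<tau>2" "\<tau>2 < 1"
    "(\<integral>\<^sup>+u. \<integral>\<^sup>+v. \<integral>\<^sup>+z. h2 u v z \<partial>std_gaussian \<partial>std_gaussian \<partial>std_gaussian) \<le> ennreal \<tau>2"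
    "\<And>n u v z. (\<Sum>j<n. infod (mat 1 + A ** transpose A + C ** transpose C) A C (u j, v j, z j)) \<le> real n * g2 \<Longrightarrow> 1 \<le> (\<Prod>j<n. h2 (u j) (v j) (z j))"
    using infod_test[of g2 A C] g(2) unfolding I2_def by blast
  interpret gaussian_receiver H J B1 B2 A C P1 P2 g1 g2 p1 p2 h1 h2 "ennreal \<beta>1" "ennreal \<beta>2" "ennreal \<tau>1" "ennreal \<tau>2"
    by (rule gaussian_receiver.intro) (fact A_def C_def p1 p2 h1 h2)+
  define W1 where "W1 n = messages n R1" for n
  define W2 where "W2 n = messages n R2" for n
  define M1 where "M1 n = real (card (W1 n))" for n
  define M2 where "M2 n = real (card (W2 n))" for n
  have M: "M1 n > 0" "M2 n > 0" for n by (simp_all add: M1_def M2_def W1_def W2_def card_messages_pos)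
  define e where "e n = (\<beta>1 ^ n + \<beta>2 ^ n + \<tau>1 ^ n + \<tau>2 ^ n) + real (card (W1 n) - 1) * exp (- (real n * g1))
        + real (card (W1 n) - 1) * real (card (W2 n) - 1) * exp (- (real n * g2))" for n
  define T where "T n \<omega>1 \<omega>2 = ennreal (1 / (M1 n * M2 n)) * total n (W1 n) (W2 n) \<omega>1 \<omega>2" for n \<omega>1 \<omega>2
  have z1: "(\<lambda>n. real (card (W1 n) - 1) * exp (- (real n * g1))) \<longlonglongrightarrow> 0"
  proof (cases "R1 = 0")
    case False
    have L: "(\<lambda>n. exp (R1 - g1) ^ n) \<longlonglongrightarrow> 0" using g(3)[OF False] by (intro LIMSEQ_power_zero) simp
    have b: "norm (real (card (W1 n) - 1) * exp (- (real n * g1))) \<le> exp (R1 - g1) ^ n" for n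
    proof -
      have "real (card (W1 n) - 1) * exp (- (real n * g1)) \<le> exp (real n * R1) * exp (- (real n * g1))"
        unfolding W1_def by (intro mult_right_mono card_messages_le) simp
      also have "\<dots> = exp (real n * (R1 - g1))"
        unfolding exp_add[symmetric] by (rule arg_cong[where f = exp]) (simp add: algebra_simps)
      also have "\<dots> = exp (R1 - g1) ^ n" by (rule exp_of_nat_mult)
      finally show ?thesis by simp
    qed
    show ?thesis by (rule Lim_null_comparison[OF eventuallyI L]) (rule b)
  qed (simp add: W1_def)
  have z2: "(\<lambda>n. real (card (W1 n) - 1) * real (card (W2 n) - 1) * exp (- (real n * g2))) \<longlonglongrightarrow> 0"
  proof (cases "R1 = 0")
    case False
    have L: "(\<lambda>n. exp (R1 + R2 - g2) ^ n) \<longlonglongrightarrow> 0" using g(4)[OF False] by (intro LIMSEQ_power_zero) simp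
    have b: "norm (real (card (W1 n) - 1) * real (card (W2 n) - 1) * exp (- (real n * g2))) \<le> exp (R1 + R2 - g2) ^ n" for n
    proof -
      have a: "real (card (W1 n) - 1) \<le> exp (real n * R1)"
        unfolding W1_def by (rule card_messages_le)
      have b: "real (card (W2 n) - 1) \<le> exp (real n * R2)"
        unfolding W2_def by (rule card_messages_le)
      have "real (card (W1 n) - 1) * real (card (W2 n) - 1) \<le> exp (real n * R1) * exp (real n * R2)"
        by (rule mult_mono[OF a b]) simp_all
      then have "real (card (W1 n) - 1) * real (card (W2 n) - 1) * exp (- (real n * g2)) \<le> exp (real n * R1) * exp (real n * R2) * exp (- (real n * g2))"
        by (rule mult_right_mono) simp
      also have "\<dots> = exp (real n * (R1 + R2 - g2))"
        unfolding exp_add[symmetric] by (rule arg_cong[where f = exp]) (simp add: algebra_simps)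
      also have "\<dots> = exp (R1 + R2 - g2) ^ n" by (rule exp_of_nat_mult)
      finally show ?thesis by simp
    qed
    show ?thesis by (rule Lim_null_comparison[OF eventuallyI L]) (rule b)
  qed (simp add: W1_def)
  have "(\<lambda>n. (\<beta>1 ^ n + \<beta>2 ^ n + \<tau>1 ^ n + \<tau>2 ^ n) + real (card (W1 n) - 1) * exp (- (real n * g1))
        + real (card (W1 n) - 1) * real (card (W2 n) - 1) * exp (- (real n * g2))) \<longlonglongrightarrow> (0 + 0 + 0 + 0) + 0 + 0"
    using p1 p2 h1 h2 by (intro tendsto_add LIMSEQ_power_zero z1 z2) auto
  then have e: "e \<longlonglongrightarrow> 0" unfolding e_def by simp
  have "random_code_bound H J B1 B2 P1 P2 R1 R2 (e n) (T n) n" if n: "0 < n" for n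
    unfolding random_code_bound_def W1_def[symmetric] W2_def[symmetric]
  proof (intro conjI allI)
    have W: "finite (W1 n)" "W1 n \<noteq> {}" "finite (W2 n)" "W2 n \<noteq> {}" by (auto simp: W1_def W2_def)
    note tb = total_bound[OF W(1,3), of n]
    have tm: "(\<lambda>\<omega>. total n (W1 n) (W2 n) (fst \<omega>) (snd \<omega>)) \<in> borel_measurable (PiM (W1 n) (\<lambda>_. gblock n) \<Otimes>\<^sub>M PiM (W2 n) (\<lambda>_. gblock n))"
      using tb(1) by (simp add: case_prod_beta')
    show "(\<lambda>\<omega>. T n (fst \<omega>) (snd \<omega>)) \<in> borel_measurable (PiM (W1 n) (\<lambda>_. gblock n) \<Otimes>\<^sub>M PiM (W2 n) (\<lambda>_. gblock n))"
      unfolding T_def by (intro borel_measurable_times_ennreal borel_measurable_const tm)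
    have inv: "ennreal (1 / (M1 n * M2 n)) * (of_nat (card (W1 n)) * of_nat (card (W2 n)) * x) = x" for x
    proof -
      have "ennreal (1 / (M1 n * M2 n)) * (of_nat (card (W1 n)) * of_nat (card (W2 n))) = ennreal (1 / (M1 n * M2 n) * (M1 n * M2 n))"
        using M[of n] by (simp add: ennreal_of_nat_eq_real_of_nat ennreal_mult'[symmetric] M1_def[symmetric] M2_def[symmetric])
      also have "\<dots> = 1" using M[of n] by simp
      finally show ?thesis by (simp only: mult.assoc[symmetric] mult_1)
    qed
    have "(\<integral>\<^sup>+\<omega>. T n (fst \<omega>) (snd \<omega>) \<partial>(PiM (W1 n) (\<lambda>_. gblock n) \<Otimes>\<^sub>M PiM (W2 n) (\<lambda>_. gblock n))) =
      ennreal (1 / (M1 n * M2 n)) * (\<integral>\<^sup>+\<omega>. total n (W1 n) (W2 n) (fst \<omega>) (snd \<omega>) \<partial>(PiM (W1 n) (\<lambda>_. gblock n) \<Otimes>\<^sub>M PiM (W2 n) (\<lambda>_. gblock n)))"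
      unfolding T_def by (rule nn_integral_cmult[OF tm])
    also have "\<dots> \<le> ennreal (1 / (M1 n * M2 n)) * (of_nat (card (W1 n)) * of_nat (card (W2 n)) *
       ((ennreal \<beta>1 ^ n + ennreal \<beta>2 ^ n + ennreal \<tau>1 ^ n + ennreal \<tau>2 ^ n) + of_nat (card (W1 n) - 1) * ennreal (exp (- (real n * g1)))
        + of_nat (card (W1 n) - 1) * of_nat (card (W2 n) - 1) * ennreal (exp (- (real n * g2)))))"
      by (intro mult_left_mono tb(2)) simp
    also have "\<dots> = ennreal (e n)"
      unfolding inv e_def ennreal_power[OF p1(2)] ennreal_power[OF p2(2)] ennreal_power[OF h1(2)] ennreal_power[OF h2(2)]
      by (simp only: ennreal_of_nat_eq_real_of_nat ennreal_mult'[symmetric] ennreal_plus[symmetric] of_nat_0_le_iff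
          zero_le_power mult_nonneg_nonneg add_nonneg_nonneg exp_ge_zero p1(2) p2(2) h1(2) h2(2))
    finally show "(\<integral>\<^sup>+\<omega>. T n (fst \<omega>) (snd \<omega>) \<partial>(PiM (W1 n) (\<lambda>_. gblock n) \<Otimes>\<^sub>M PiM (W2 n) (\<lambda>_. gblock n))) \<le> ennreal (e n)" .
    fix \<omega>1 \<omega>2 :: "nat \<Rightarrow> nat \<Rightarrow> real^'n"
    show "\<exists>g. decoder n R1 g \<and> ennreal (err H J n (W1 n) (W2 n) (enc B1 P1 n \<omega>1) (enc B2 P2 n \<omega>2) g) \<le> T n \<omega>1 \<omega>2"
    proof (intro exI conjI)
      show "decoder n R1 (dec n (W1 n) (W2 n) \<omega>1 \<omega>2)"
        using dec_measurable[OF W(1,2,3)] by (simp add: decoder_def W1_def)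
      have "ennreal (1 / (M1 n * M2 n)) * (of_nat (card (W1 n)) * of_nat (card (W2 n)) * ennreal (err H J n (W1 n) (W2 n) (enc B1 P1 n \<omega>1) (enc B2 P2 n \<omega>2) (dec n (W1 n) (W2 n) \<omega>1 \<omega>2))) \<le> T n \<omega>1 \<omega>2"
        unfolding T_def by (intro mult_left_mono err_le_total[OF n W]) simp
      then show "ennreal (err H J n (W1 n) (W2 n) (enc B1 P1 n \<omega>1) (enc B2 P2 n \<omega>2) (dec n (W1 n) (W2 n) \<omega>1 \<omega>2)) \<le> T n \<omega>1 \<omega>2"
        by (simp only: inv)
    qed
  qed
  then show ?thesis using e by blast
qed

text \<open>Each codeword obeys the power bound by itself, which is stronger than the average over
  messages.\<close>

lemma encoder_enc:
  assumes n: "0 < n" and P: "0 \<le> P"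
  shows "encoder n R P (enc B P n \<omega>)"
proof -
  have m: "(\<Sum>j<n. (norm (enc B P n \<omega> m j))\<^sup>2) \<le> real n * P" for m
    using P by (cases "(\<Sum>i<n. (norm (B *v \<omega> m i))\<^sup>2) \<le> real n * P") (simp_all add: enc_def)
  have c: "real (card (messages n R)) > 0" using card_messages_pos[of n R] by simp
  have "(\<Sum>j<n. measure_pmf.expectation (uniform_message n R) (\<lambda>m. (norm (enc B P n \<omega> m j))\<^sup>2)) =
     (\<Sum>m\<in>messages n R. \<Sum>j<n. (norm (enc B P n \<omega> m j))\<^sup>2) / real (card (messages n R))"
    unfolding uniform_message_def
    by (subst sum.swap) (simp add: integral_pmf_of_set sum_divide_distrib)
  also have "\<dots> \<le> (\<Sum>m\<in>messages n R. real n * P) / real (card (messages n R))"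
    by (intro divide_right_mono sum_mono m) simp
  also have "\<dots> = real n * P" using c by simp
  finally show ?thesis using n by (simp add: encoder_def field_simps)
qed

lemma (in prob_space) nn_integral_exists_le:
  assumes "(\<integral>\<^sup>+x. f x \<partial>M) \<le> ennreal c" "0 \<le> c" "0 < \<delta>"
  shows "\<exists>x\<in>space M. f x \<le> ennreal (c + \<delta>)"
proof (rule ccontr)
  assume "\<not> ?thesis"
  then have "ennreal (c + \<delta>) \<le> f x" if "x \<in> space M" for x using that by (auto simp: not_le less_imp_le)
  then have "(\<integral>\<^sup>+x. ennreal (c + \<delta>) \<partial>M) \<le> (\<integral>\<^sup>+x. f x \<partial>M)" by (rule nn_integral_mono)
  then have "ennreal (c + \<delta>) \<le> ennreal c" using assms(1) by (simp add: emeasure_space_1)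
  then show False using assms by simp
qed

text \<open>Both receivers use the same codebooks, so one realisation has to be good for both. It
  exists because the sum of the two nonnegative error bounds has small mean.\<close>

lemma achievable_rates:
  fixes H1 H2 H3 H4 B1 B2 :: "real^'n^'n"
  assumes N: "noise_law N" and R0: "0 \<le> R1" "0 \<le> R2" and P0: "0 \<le> P1" "0 \<le> P2"
    and P: "trace (B1 ** transpose B1) < P1 \<or> B1 = 0" "trace (B2 ** transpose B2) < P2 \<or> B2 = 0"
    and R1: "R1 = 0 \<or> (R1 < ln (det (mat 1 + (H1 ** B1) ** transpose (H1 ** B1))) / 2 \<and>
      R1 + R2 < ln (det (mat 1 + (H1 ** B1) ** transpose (H1 ** B1) + (H2 ** B2) ** transpose (H2 ** B2))) / 2)"
    and R2: "R2 = 0 \<or> (R2 < ln (det (mat 1 + (H4 ** B2) ** transpose (H4 ** B2))) / 2 \<and>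
      R2 + R1 < ln (det (mat 1 + (H4 ** B2) ** transpose (H4 ** B2) + (H3 ** B1) ** transpose (H3 ** B1))) / 2)"
  shows "achievable H1 H2 H3 H4 N P1 P2 R1 R2"
proof -
  have P': "trace (B1 ** transpose B1) < P1 \<or> (B1 = 0 \<and> 0 \<le> P1)" "trace (B2 ** transpose B2) < P2 \<or> (B2 = 0 \<and> 0 \<le> P2)"
    using P P0 by auto
  let ?C1 = "\<lambda>n. PiM (messages n R1) (\<lambda>_. gblock n :: (nat \<Rightarrow> real^'n) measure)"
  let ?C2 = "\<lambda>n. PiM (messages n R2) (\<lambda>_. gblock n :: (nat \<Rightarrow> real^'n) measure)"
  obtain e1 T1 where 1: "e1 \<longlonglongrightarrow> 0" and t1: "\<forall>n>0. random_code_bound H1 H2 B1 B2 P1 P2 R1 R2 (e1 n) (T1 n) n"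
    using receiver_bound[OF P' R1] by blast
  have T1: "\<And>n. 0 < n \<Longrightarrow> (\<lambda>\<omega>. T1 n (fst \<omega>) (snd \<omega>)) \<in> borel_measurable (?C1 n \<Otimes>\<^sub>M ?C2 n)"
      "\<And>n. 0 < n \<Longrightarrow> (\<integral>\<^sup>+\<omega>. T1 n (fst \<omega>) (snd \<omega>) \<partial>(?C1 n \<Otimes>\<^sub>M ?C2 n)) \<le> ennreal (e1 n)"
      "\<And>n \<omega>1 \<omega>2. 0 < n \<Longrightarrow> \<exists>g. decoder n R1 g \<and> ennreal (err H1 H2 n (messages n R1) (messages n R2) (enc B1 P1 n \<omega>1) (enc B2 P2 n \<omega>2) g) \<le> T1 n \<omega>1 \<omega>2"
    using t1 unfolding random_code_bound_def by simp_all
  obtain e2 T2 where 2: "e2 \<longlonglongrightarrow> 0" and t2: "\<forall>n>0. random_code_bound H4 H3 B2 B1 P2 P1 R2 R1 (e2 n) (T2 n) n"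
    using receiver_bound[OF P'(2,1) R2] by blast
  have T2: "\<And>n. 0 < n \<Longrightarrow> (\<lambda>\<omega>. T2 n (fst \<omega>) (snd \<omega>)) \<in> borel_measurable (?C2 n \<Otimes>\<^sub>M ?C1 n)"
      "\<And>n. 0 < n \<Longrightarrow> (\<integral>\<^sup>+\<omega>. T2 n (fst \<omega>) (snd \<omega>) \<partial>(?C2 n \<Otimes>\<^sub>M ?C1 n)) \<le> ennreal (e2 n)"
      "\<And>n \<omega>1 \<omega>2. 0 < n \<Longrightarrow> \<exists>g. decoder n R2 g \<and> ennreal (err H4 H3 n (messages n R2) (messages n R1) (enc B2 P2 n \<omega>2) (enc B1 P1 n \<omega>1) g) \<le> T2 n \<omega>2 \<omega>1"
    using t2 unfolding random_code_bound_def by simp_all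
  \<comment> \<open>\<open>inverse (real n)\<close> is the slack in
    \<open>nn_integral_exists_le\<close>. Absolute values appear because \<open>e1\<close> and
    \<open>e2\<close> are only known to tend to 0.\<close>
  define \<epsilon> where "\<epsilon> n = \<bar>e1 n\<bar> + \<bar>e2 n\<bar> + inverse (real n)" for n
  have "\<epsilon> \<longlonglongrightarrow> \<bar>0\<bar> + \<bar>0\<bar> + 0"
    unfolding \<epsilon>_def by (intro tendsto_add tendsto_rabs 1 2 lim_inverse_n)
  then have \<epsilon>: "\<epsilon> \<longlonglongrightarrow> 0" by simp
  have "\<exists>\<omega>1 \<omega>2 g1 g2. decoder n R1 g1 \<and> decoder n R2 g2 \<and>
      err H1 H2 n (messages n R1) (messages n R2) (enc B1 P1 n \<omega>1) (enc B2 P2 n \<omega>2) g1 \<le> \<epsilon> n \<and>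
      err H4 H3 n (messages n R2) (messages n R1) (enc B2 P2 n \<omega>2) (enc B1 P1 n \<omega>1) g2 \<le> \<epsilon> n" if n: "0 < n" for n
  proof -
    interpret C1: prob_space "?C1 n" by (intro prob_space_PiM prob_space_gblock)
    interpret C2: prob_space "?C2 n" by (intro prob_space_PiM prob_space_gblock)
    interpret C12: pair_prob_space "?C1 n" "?C2 n" ..
    interpret C21: pair_prob_space "?C2 n" "?C1 n" ..
    have m1: "(\<lambda>\<omega>. T1 n (fst \<omega>) (snd \<omega>)) \<in> borel_measurable (?C1 n \<Otimes>\<^sub>M ?C2 n)"
      by (rule T1(1)[OF n])
    have m2': "(\<lambda>\<omega>. T2 n (fst \<omega>) (snd \<omega>)) \<in> borel_measurable (?C2 n \<Otimes>\<^sub>M ?C1 n)"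
      by (rule T2(1)[OF n])
    have m2: "(\<lambda>\<omega>. T2 n (snd \<omega>) (fst \<omega>)) \<in> borel_measurable (?C1 n \<Otimes>\<^sub>M ?C2 n)"
    proof -
      have "(\<lambda>\<omega>. (snd \<omega>, fst \<omega>)) \<in> measurable (?C1 n \<Otimes>\<^sub>M ?C2 n) (?C2 n \<Otimes>\<^sub>M ?C1 n)" by measurable
      from measurable_compose[OF this m2'] show ?thesis by simp
    qed
    have "(\<integral>\<^sup>+\<omega>. T2 n (snd \<omega>) (fst \<omega>) \<partial>(?C1 n \<Otimes>\<^sub>M ?C2 n)) = (\<integral>\<^sup>+\<omega>. T2 n (fst \<omega>) (snd \<omega>) \<partial>(?C2 n \<Otimes>\<^sub>M ?C1 n))"
      using C12.nn_integral_snd[OF m2] C1.nn_integral_fst[OF m2'] by simp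
    then have "(\<integral>\<^sup>+\<omega>. T1 n (fst \<omega>) (snd \<omega>) + T2 n (snd \<omega>) (fst \<omega>) \<partial>(?C1 n \<Otimes>\<^sub>M ?C2 n)) \<le> ennreal (e1 n) + ennreal (e2 n)"
      using m1 m2 T1(2)[OF n] T2(2)[OF n] by (simp add: nn_integral_add add_mono)
    also have "\<dots> \<le> ennreal \<bar>e1 n\<bar> + ennreal \<bar>e2 n\<bar>" by (intro add_mono ennreal_leI) auto
    also have "\<dots> = ennreal (\<bar>e1 n\<bar> + \<bar>e2 n\<bar>)" by simp
    finally have I: "(\<integral>\<^sup>+\<omega>. T1 n (fst \<omega>) (snd \<omega>) + T2 n (snd \<omega>) (fst \<omega>) \<partial>(?C1 n \<Otimes>\<^sub>M ?C2 n)) \<le> ennreal (\<bar>e1 n\<bar> + \<bar>e2 n\<bar>)" .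
    have "\<exists>\<omega>\<in>space (?C1 n \<Otimes>\<^sub>M ?C2 n). T1 n (fst \<omega>) (snd \<omega>) + T2 n (snd \<omega>) (fst \<omega>) \<le> ennreal (\<epsilon> n)"
      unfolding \<epsilon>_def by (rule C12.P.nn_integral_exists_le[OF I]) (use n in auto)
    then obtain \<omega> where \<omega>: "T1 n (fst \<omega>) (snd \<omega>) + T2 n (snd \<omega>) (fst \<omega>) \<le> ennreal (\<epsilon> n)" by blast
    have \<epsilon>0: "0 \<le> \<epsilon> n" by (simp add: \<epsilon>_def)
    have t: "T1 n (fst \<omega>) (snd \<omega>) \<le> ennreal (\<epsilon> n)" "T2 n (snd \<omega>) (fst \<omega>) \<le> ennreal (\<epsilon> n)"
      using \<omega> by (auto intro: order_trans[OF _ \<omega>])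
    obtain g1 where g1: "decoder n R1 g1" "ennreal (err H1 H2 n (messages n R1) (messages n R2) (enc B1 P1 n (fst \<omega>)) (enc B2 P2 n (snd \<omega>)) g1) \<le> ennreal (\<epsilon> n)"
      using T1(3)[OF n] t(1) order_trans by blast
    obtain g2 where g2: "decoder n R2 g2" "ennreal (err H4 H3 n (messages n R2) (messages n R1) (enc B2 P2 n (snd \<omega>)) (enc B1 P1 n (fst \<omega>)) g2) \<le> ennreal (\<epsilon> n)"
      using T2(3)[OF n] t(2) order_trans by blast
    show ?thesis using g1 g2 \<epsilon>0 by (auto simp: ennreal_le_iff)
  qed
  then have "\<forall>n. \<exists>q. 0 < n \<longrightarrow> decoder n R1 (fst (snd (snd q))) \<and> decoder n R2 (snd (snd (snd q))) \<and>
      err H1 H2 n (messages n R1) (messages n R2) (enc B1 P1 n (fst q)) (enc B2 P2 n (fst (snd q))) (fst (snd (snd q))) \<le> \<epsilon> n \<and>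
      err H4 H3 n (messages n R2) (messages n R1) (enc B2 P2 n (fst (snd q))) (enc B1 P1 n (fst q)) (snd (snd (snd q))) \<le> \<epsilon> n"
    by simp
  from choice[OF this] obtain q where q: "\<And>n. 0 < n \<Longrightarrow> decoder n R1 (fst (snd (snd (q n)))) \<and> decoder n R2 (snd (snd (snd (q n)))) \<and>
      err H1 H2 n (messages n R1) (messages n R2) (enc B1 P1 n (fst (q n))) (enc B2 P2 n (fst (snd (q n)))) (fst (snd (snd (q n)))) \<le> \<epsilon> n \<and>
      err H4 H3 n (messages n R2) (messages n R1) (enc B2 P2 n (fst (snd (q n)))) (enc B1 P1 n (fst (q n))) (snd (snd (snd (q n)))) \<le> \<epsilon> n"
    by auto
  define w1 w2 d1 d2 where "w1 n = fst (q n)" and "w2 n = fst (snd (q n))" and "d1 n = fst (snd (snd (q n)))" and "d2 n = snd (snd (snd (q n)))" for n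
  have c: "\<And>n. 0 < n \<Longrightarrow> decoder n R1 (d1 n) \<and> decoder n R2 (d2 n) \<and>
      err H1 H2 n (messages n R1) (messages n R2) (enc B1 P1 n (w1 n)) (enc B2 P2 n (w2 n)) (d1 n) \<le> \<epsilon> n \<and>
      err H4 H3 n (messages n R2) (messages n R1) (enc B2 P2 n (w2 n)) (enc B1 P1 n (w1 n)) (d2 n) \<le> \<epsilon> n"
    using q unfolding w1_def w2_def d1_def d2_def by blast
  have L1: "(\<lambda>n. error_prob1 H1 H2 N n R1 R2 (enc B1 P1 n (w1 n)) (enc B2 P2 n (w2 n)) (d1 n)) \<longlonglongrightarrow> 0"
  proof (rule Lim_null_comparison[OF _ \<epsilon>])
    show "\<forall>\<^sub>F n in sequentially. norm (error_prob1 H1 H2 N n R1 R2 (enc B1 P1 n (w1 n)) (enc B2 P2 n (w2 n)) (d1 n)) \<le> \<epsilon> n"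
      using eventually_gt_at_top[of "0::nat"]
    proof eventually_elim
      case (elim n)
      then show ?case using c[OF elim] by (simp add: err_nonneg error_prob1_eq[OF N])
    qed
  qed
  have L2: "(\<lambda>n. error_prob2 H3 H4 N n R1 R2 (enc B1 P1 n (w1 n)) (enc B2 P2 n (w2 n)) (d2 n)) \<longlonglongrightarrow> 0"
  proof (rule Lim_null_comparison[OF _ \<epsilon>])
    show "\<forall>\<^sub>F n in sequentially. norm (error_prob2 H3 H4 N n R1 R2 (enc B1 P1 n (w1 n)) (enc B2 P2 n (w2 n)) (d2 n)) \<le> \<epsilon> n"
      using eventually_gt_at_top[of "0::nat"]
    proof eventually_elim
      case (elim n)
      then show ?case using c[OF elim] by (simp add: err_nonneg error_prob2_eq[OF N])
    qed
  qed
  show ?thesis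
    unfolding achievable_def
  proof (intro conjI R0 exI)
    show "\<forall>n\<ge>1. encoder n R1 P1 (enc B1 P1 n (w1 n)) \<and> encoder n R2 P2 (enc B2 P2 n (w2 n)) \<and> decoder n R1 (d1 n) \<and> decoder n R2 (d2 n)"
      using c P0 by (auto intro!: encoder_enc)
  qed (fact L1 L2)+
qed

section \<open>Sum-rate capacity\<close>

text \<open>The order relation says |H u| <= |G u| for all \<open>u\<close>. At u = G^{-1} x this
  makes \<open>K\<close> a contraction, hence also its transpose, so
  \<open>mat 1 - K ** transpose K\<close> is positive semidefinite and \<open>L\<close> is a factor
  of it: the shaping of the auxiliary noise.\<close>

lemma contraction_factor:
  fixes G H :: "real^'n^'n"
  assumes G: "invertible G" and le: "transpose G ** G \<succeq> transpose H ** H"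
  defines "K \<equiv> H ** matrix_inv G"
  obtains L :: "real^'n^'n" where "K ** transpose K + L ** transpose L = mat 1"
proof -
  have c: "(K *v x) \<bullet> (K *v x) \<le> x \<bullet> x" for x
  proof -
    define u where "u = matrix_inv G *v x"
    have sq: "u \<bullet> ((transpose M ** M) *v u) = (M *v u) \<bullet> (M *v u)" for M :: "real^'n^'n"
      by (simp add: matrix_vector_mul_assoc[symmetric] inner_matrix_vector[of u "transpose M"])
    have "0 \<le> u \<bullet> ((transpose G ** G - transpose H ** H) *v u)"
      using le by (simp add: loewner_ge_def psd_def)
    then have "(H *v u) \<bullet> (H *v u) \<le> (G *v u) \<bullet> (G *v u)"
      by (simp add: matrix_vector_mult_diff_rdistrib inner_diff_right sq)
    then show ?thesis
      by (simp add: u_def K_def matrix_inv_vector_cancel[OF G] matrix_vector_mul_assoc[symmetric])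
  qed
  have n: "norm (K *v x) \<le> norm x" for x
    using c[of x] by (simp add: norm_le)
  have "psd (mat 1 - K ** transpose K)"
    unfolding psd_def
  proof (intro conjI allI)
    show "transpose (mat 1 - K ** transpose K) = mat 1 - K ** transpose K"
      by (simp add: transpose_minus matrix_transpose_mul)
    fix x
    \<comment> \<open>Moves the contraction bound to the transpose: |K^T x|^2 = x . K K^T x <= |x|
      |K^T x|, and one factor is divided out.\<close>
    have e: "x \<bullet> (K *v (transpose K *v x)) = (norm (transpose K *v x))\<^sup>2"
      by (simp add: inner_matrix_vector[of x K] power2_norm_eq_inner)
    have "(norm (transpose K *v x))\<^sup>2 \<le> norm x * norm (K *v (transpose K *v x))"
      unfolding e[symmetric] by (rule norm_cauchy_schwarz)
    also have "\<dots> \<le> norm x * norm (transpose K *v x)" by (intro mult_left_mono n) simp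
    finally have "norm (transpose K *v x) \<le> norm x"
      by (cases "norm (transpose K *v x) = 0") (auto simp: power2_eq_square)
    then have "(norm (transpose K *v x))\<^sup>2 \<le> (norm x)\<^sup>2" by (rule power_mono) simp
    then show "0 \<le> x \<bullet> ((mat 1 - K ** transpose K) *v x)"
      by (simp add: matrix_vector_mult_diff_rdistrib inner_diff_right matrix_vector_mul_assoc[symmetric] e power2_norm_eq_inner)
  qed
  then obtain L :: "real^'n^'n" where "mat 1 - K ** transpose K = L ** transpose L" by (rule psd_factor)
  then show ?thesis by (intro that[of L]) (simp add: algebra_simps)
qed

section \<open>Converse for achievable rate pairs\<close>

lemma sum_rate_min_eq:
  "sum_rate_min H1 H2 H3 H4 S1 S2 = min (1/2 * ln (det (mat 1 + H1 ** S1 ** transpose H1 + H2 ** S2 ** transpose H2)))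
    (min (1/2 * ln (det (mat 1 + H3 ** S1 ** transpose H3 + H4 ** S2 ** transpose H4)))
      (1/2 * ln (det (mat 1 + H1 ** S1 ** transpose H1)) + 1/2 * ln (det (mat 1 + H4 ** S2 ** transpose H4))))"
  by (simp add: sum_rate_min_def)

lemma encoder_trace_ecov:
  assumes "encoder n R P f" "0 < n"
  shows "trace (ecov n (messages n R) f) \<le> P"
proof -
  have "(1 / real n) * (\<Sum>j<n. (\<Sum>m\<in>messages n R. (norm (f m j))\<^sup>2) / real (card (messages n R))) \<le> P"
    using assms(1) by (simp add: encoder_def uniform_message_def integral_pmf_of_set)
  then show ?thesis
    by (rule order_trans[OF trace_ecov_le[OF messages_finite messages_nonempty assms(2)]])
qed

lemma ln_card_messages_ge: "real n * R \<le> ln (real (card (messages n R)))"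
  using card_messages_ge[of n R] card_messages_pos[of n R] by (simp add: ln_ge_iff)

text \<open>The covariances of a code change with the block length and the code, which is why
  \<open>C\<close> is assumed to bound the objective at every admissible pair. All bounds are taken
  at \<open>E1\<close>, \<open>E2\<close>; the one at receiver 2 is \<open>converse_sum\<close> with
  the users exchanged.\<close>

lemma block_converse:
  fixes H1 H2 H3 H4 :: "real^'n^'n" and N :: "((real^'n) \<times> (real^'n)) measure"
  assumes N: "noise_law N" and inv: "invertible H1" "invertible H2" "invertible H3" "invertible H4"
    and s1: "transpose H2 ** H2 \<succeq> transpose H4 ** H4" and s2: "transpose H3 ** H3 \<succeq> transpose H1 ** H1"
    and C: "\<And>S1 S2. psd S1 \<Longrightarrow> psd S2 \<Longrightarrow> trace S1 \<le> P1 \<Longrightarrow> trace S2 \<le> P2 \<Longrightarrow> sum_rate_min H1 H2 H3 H4 S1 S2 \<le> C"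
    and n: "0 < n" and e: "encoder n R1 P1 f1" "encoder n R2 P2 f2" and d: "decoder n R1 g1" "decoder n R2 g2"
  defines "\<delta> \<equiv> 1 - error_prob1 H1 H2 N n R1 R2 f1 f2 g1 - error_prob2 H3 H4 N n R1 R2 f1 f2 g2"
  assumes \<delta>: "0 \<le> \<delta>"
  shows "\<delta> * (R1 + R2) \<le> C + 2 * ln 2 / real n"
proof -
  let ?W1 = "messages n R1" and ?W2 = "messages n R2"
  define \<epsilon>1 where "\<epsilon>1 = err H1 H2 n ?W1 ?W2 f1 f2 g1"
  define \<epsilon>2 where "\<epsilon>2 = err H4 H3 n ?W2 ?W1 f2 f1 g2"
  have \<epsilon>: "0 \<le> \<epsilon>1" "0 \<le> \<epsilon>2"
    unfolding \<epsilon>1_def \<epsilon>2_def by (rule err_nonneg)+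
  have \<delta>': "\<delta> = 1 - \<epsilon>1 - \<epsilon>2"
    by (simp add: \<delta>_def \<epsilon>1_def \<epsilon>2_def error_prob1_eq[OF N d(1)] error_prob2_eq[OF N d(2)])
  define E1 where "E1 = ecov n ?W1 f1"
  define E2 where "E2 = ecov n ?W2 f2"
  have min: "sum_rate_min H1 H2 H3 H4 E1 E2 \<le> C"
    unfolding E1_def E2_def by (intro C psd_ecov encoder_trace_ecov e n)
  note g = d[unfolded decoder_def]
  note W = messages_finite[of n R1] messages_nonempty[of n R1] messages_finite[of n R2] messages_nonempty[of n R2]
  define l1 where "l1 = ln (real (card ?W1))"
  define l2 where "l2 = ln (real (card ?W2))"
  have l: "real n * R1 \<le> l1" "real n * R2 \<le> l2" by (simp_all add: l1_def l2_def ln_card_messages_ge)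
  have l0: "0 \<le> l1" "0 \<le> l2"
    using card_messages_pos[of n R1] card_messages_pos[of n R2] by (simp_all add: l1_def l2_def Suc_le_eq)
  have l12: "ln (real (card ?W1) * real (card ?W2)) = l1 + l2"
    using card_messages_pos[of n R1] card_messages_pos[of n R2] by (simp add: l1_def l2_def ln_mult)
  obtain L :: "real^'n^'n" where L: "(H4 ** matrix_inv H2) ** transpose (H4 ** matrix_inv H2) + L ** transpose L = mat 1"
    using contraction_factor[OF inv(2) s1] .
  obtain L' :: "real^'n^'n" where L': "(H1 ** matrix_inv H3) ** transpose (H1 ** matrix_inv H3) + L' ** transpose L' = mat 1"
    using contraction_factor[OF inv(3) s2] .
  have K: "invertible (H4 ** matrix_inv H2)" "H4 = (H4 ** matrix_inv H2) ** H2"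
    "invertible (H1 ** matrix_inv H3)" "H1 = (H1 ** matrix_inv H3) ** H3"
    using inv invertible_matrix_inv[OF inv(2)] invertible_matrix_inv[OF inv(3)]
    by (simp_all add: invertible_det_nz det_mul matrix_mul_assoc[symmetric] matrix_inv_cancel[OF inv(2)] matrix_inv_cancel[OF inv(3)])
  have 1: "(1 - \<epsilon>1) * l1 \<le> real n / 2 * ln (det (mat 1 + H1 ** E1 ** transpose H1)) + ln 2"
    unfolding \<epsilon>1_def l1_def E1_def by (rule converse_single[OF W n g(1)])
  have 2: "(1 - \<epsilon>2) * l2 \<le> real n / 2 * ln (det (mat 1 + H4 ** E2 ** transpose H4)) + ln 2"
    unfolding \<epsilon>2_def l2_def E2_def by (rule converse_single[OF W(3,4,1,2) n g(2)])
  have 3: "\<delta> * (l1 + l2) \<le> real n / 2 * ln (det (mat 1 + H1 ** E1 ** transpose H1 + H2 ** E2 ** transpose H2)) + ln 2"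
    unfolding \<delta>' \<epsilon>1_def \<epsilon>2_def l12[symmetric] E1_def E2_def by (rule converse_sum[OF W n g K(1) L K(2)])
  have 4: "\<delta> * (l1 + l2) \<le> real n / 2 * ln (det (mat 1 + H3 ** E1 ** transpose H3 + H4 ** E2 ** transpose H4)) + ln 2"
  proof -
    have "(1 - \<epsilon>2 - \<epsilon>1) * (l1 + l2) \<le> real n / 2 * ln (det (mat 1 + H4 ** E2 ** transpose H4 + H3 ** E1 ** transpose H3)) + ln 2"
      using converse_sum[OF W(3,4,1,2) n g(2,1) K(3) L' K(4), where ?f1.0 = f2 and ?f2.0 = f1] l12
      by (simp add: \<epsilon>1_def \<epsilon>2_def E1_def E2_def mult.commute)
    then show ?thesis by (simp add: \<delta>' add_ac diff_diff_eq)
  qed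
  \<comment> \<open>Each single-user success probability is at least \<open>\<delta>\<close>, so
    both single-user bounds can be weakened to this common factor and added.\<close>
  have 5: "\<delta> * (l1 + l2) \<le> real n / 2 * (ln (det (mat 1 + H1 ** E1 ** transpose H1)) + ln (det (mat 1 + H4 ** E2 ** transpose H4))) + 2 * ln 2"
  proof -
    have "\<delta> * l1 \<le> (1 - \<epsilon>1) * l1" "\<delta> * l2 \<le> (1 - \<epsilon>2) * l2"
      using \<epsilon> l0 by (auto simp: \<delta>' intro!: mult_right_mono)
    with 1 2 show ?thesis by (simp add: algebra_simps)
  qed
  \<comment> \<open>The slack \<open>2 * l\<close> is that of the third bound, which is a sum of
    two; the other two bounds are weakened to it.\<close>
  have min_bound: "x \<le> real n * min (1/2 * a) (min (1/2 * b) (1/2 * c + 1/2 * d)) + 2 * l"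
    if "x \<le> real n / 2 * a + l" "x \<le> real n / 2 * b + l" "x \<le> real n / 2 * (c + d) + 2 * l" "0 < l" for x a b c d l :: real
  proof -
    have "x - 2 * l \<le> real n * (1/2 * a)" "x - 2 * l \<le> real n * (1/2 * b)" "x - 2 * l \<le> real n * (1/2 * c + 1/2 * d)"
      using that by (simp_all add: algebra_simps add_divide_distrib)
    then have "x - 2 * l \<le> real n * min (1/2 * a) (min (1/2 * b) (1/2 * c + 1/2 * d))"
      unfolding min_def by simp
    then show ?thesis by simp
  qed
  have "\<delta> * (l1 + l2) \<le> real n * sum_rate_min H1 H2 H3 H4 E1 E2 + 2 * ln 2"
    unfolding sum_rate_min_eq by (rule min_bound[OF 3 4 5]) simp
  also have "\<dots> \<le> real n * C + 2 * ln 2" using min by (intro add_right_mono mult_left_mono) auto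
  finally have "\<delta> * (l1 + l2) \<le> real n * C + 2 * ln 2" .
  moreover have "\<delta> * (real n * R1 + real n * R2) \<le> \<delta> * (l1 + l2)" using l \<delta> by (intro mult_left_mono add_mono) auto
  ultimately have "real n * (\<delta> * (R1 + R2)) \<le> real n * C + 2 * ln 2" by (simp add: algebra_simps)
  then show ?thesis using n by (simp add: field_simps)
qed

text \<open>The limit in the block bound: \<open>\<delta>\<close> tends to 1, so it is eventually
  positive as \<open>block_converse\<close> demands, and the term with \<open>ln 2\<close>
  vanishes.\<close>

lemma achievable_sum_le:
  fixes H1 H2 H3 H4 :: "real^'n^'n" and N :: "((real^'n) \<times> (real^'n)) measure"
  assumes N: "noise_law N" and inv: "invertible H1" "invertible H2" "invertible H3" "invertible H4"
    and s1: "transpose H2 ** H2 \<succeq> transpose H4 ** H4" and s2: "transpose H3 ** H3 \<succeq> transpose H1 ** H1"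
    and C: "\<And>S1 S2. psd S1 \<Longrightarrow> psd S2 \<Longrightarrow> trace S1 \<le> P1 \<Longrightarrow> trace S2 \<le> P2 \<Longrightarrow> sum_rate_min H1 H2 H3 H4 S1 S2 \<le> C"
    and a: "achievable H1 H2 H3 H4 N P1 P2 R1 R2"
  shows "R1 + R2 \<le> C"
proof -
  from a obtain f1 f2 g1 g2 where ed: "\<And>n. 1 \<le> n \<Longrightarrow> encoder n R1 P1 (f1 n) \<and> encoder n R2 P2 (f2 n) \<and> decoder n R1 (g1 n) \<and> decoder n R2 (g2 n)"
    and l1: "(\<lambda>n. error_prob1 H1 H2 N n R1 R2 (f1 n) (f2 n) (g1 n)) \<longlonglongrightarrow> 0"
    and l2: "(\<lambda>n. error_prob2 H3 H4 N n R1 R2 (f1 n) (f2 n) (g2 n)) \<longlonglongrightarrow> 0"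
    unfolding achievable_def by blast
  define \<delta> where "\<delta> n = 1 - error_prob1 H1 H2 N n R1 R2 (f1 n) (f2 n) (g1 n) - error_prob2 H3 H4 N n R1 R2 (f1 n) (f2 n) (g2 n)" for n
  have \<delta>: "\<delta> \<longlonglongrightarrow> 1"
    using tendsto_diff[OF tendsto_diff[OF tendsto_const[of 1] l1] l2] by (simp add: \<delta>_def[abs_def])
  have "(\<lambda>n. \<delta> n * (R1 + R2)) \<longlonglongrightarrow> 1 * (R1 + R2)" by (intro tendsto_mult \<delta> tendsto_const)
  moreover have "(\<lambda>n. C + 2 * ln 2 * inverse (real n)) \<longlonglongrightarrow> C + 2 * ln 2 * 0"
    by (intro tendsto_add tendsto_mult tendsto_const lim_inverse_n)
  moreover have "eventually (\<lambda>n. \<delta> n * (R1 + R2) \<le> C + 2 * ln 2 * inverse (real n)) sequentially"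
    using order_tendstoD(1)[OF \<delta>, of 0, simplified] eventually_ge_at_top[of "1::nat"]
  proof eventually_elim
    case (elim n)
    then have n: "0 < n" by simp
    from ed[OF elim(2)] have "\<delta> n * (R1 + R2) \<le> C + 2 * ln 2 / real n"
      unfolding \<delta>_def by (intro block_converse[OF N inv s1 s2 C n]) (use elim(1) in \<open>auto simp: \<delta>_def\<close>)
    then show ?case by (simp add: divide_inverse)
  qed
  ultimately show ?thesis
    using tendsto_le[of sequentially "\<lambda>n. C + 2 * ln 2 * inverse (real n)" _ "\<lambda>n. \<delta> n * (R1 + R2)"] by simp
qed

section \<open>Compactness of the admissible covariances and continuity of the objective\<close>

lemma psd_entry_le:
  fixes S :: "real^'n^'n"
  assumes "psd S"
  shows "\<bar>S $ i $ j\<bar> \<le> trace S"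
proof -
  have sym: "S $ j $ i = S $ i $ j"
    using assms unfolding psd_def transpose_def by (metis vec_lambda_beta)
  have e: "(axis i 1 + c *\<^sub>R axis j 1) \<bullet> (S *v (axis i 1 + c *\<^sub>R axis j 1)) = S $ i $ i + 2 * c * S $ i $ j + c * c * S $ j $ j" for c
    by (simp add: matrix_vector_right_distrib matrix_vector_mult_scaleR inner_add_left inner_add_right
        matrix_vector_mult_basis inner_axis' column_def sym algebra_simps)
  have "0 \<le> S $ i $ i + 2 * 1 * S $ i $ j + 1 * 1 * S $ j $ j" "0 \<le> S $ i $ i + 2 * (-1) * S $ i $ j + (-1) * (-1) * S $ j $ j"
    using assms unfolding psd_def e[symmetric] by blast+
  then have "\<bar>S $ i $ j\<bar> \<le> (S $ i $ i + S $ j $ j) / 2" by simp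
  have k: "S $ k $ k \<le> trace S" for k
    unfolding trace_def using psd_diag_nonneg[OF assms] by (intro member_le_sum) auto
  have "(S $ i $ i + S $ j $ j) / 2 \<le> trace S" using k[of i] k[of j] by simp
  with \<open>\<bar>S $ i $ j\<bar> \<le> _\<close> show ?thesis by (rule order_trans)
qed

lemma psd_trace_nonneg: "psd S \<Longrightarrow> 0 \<le> trace S"
  unfolding trace_def by (intro sum_nonneg psd_diag_nonneg)

lemma compact_psd_trace_le: "compact {S :: real^'n^'n. psd S \<and> trace S \<le> P}"
proof -
  have "closed {S :: real^'n^'n. psd S \<and> trace S \<le> P}"
  proof -
    have "{S :: real^'n^'n. psd S \<and> trace S \<le> P} =
      (\<Inter>i. \<Inter>j. {S. S $ j $ i = S $ i $ j}) \<inter> (\<Inter>x. {S. 0 \<le> (\<Sum>i\<in>UNIV. x $ i * (\<Sum>j\<in>UNIV. S $ i $ j * x $ j))}) \<inter> {S. (\<Sum>i\<in>UNIV. S $ i $ i) \<le> P}"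
      by (auto simp: psd_def trace_def transpose_def vec_eq_iff inner_vec_def matrix_vector_mult_def)
    also have "closed \<dots>"
      by (intro closed_Int closed_INT ballI closed_Collect_eq closed_Collect_le continuous_intros)
    finally show ?thesis .
  qed
  moreover have "bounded {S :: real^'n^'n. psd S \<and> trace S \<le> P}"
  proof (rule boundedI)
    fix S :: "real^'n^'n" assume "S \<in> {S. psd S \<and> trace S \<le> P}"
    then have S: "psd S" "trace S \<le> P" by auto
    have "norm S \<le> (\<Sum>i\<in>UNIV. norm (S $ i))" unfolding norm_vec_def[of S] by (rule L2_set_le_sum) simp
    also have "\<dots> \<le> (\<Sum>i\<in>UNIV. \<Sum>j\<in>UNIV. \<bar>S $ i $ j\<bar>)" by (intro sum_mono norm_le_l1_cart)
    also have "\<dots> \<le> (\<Sum>i\<in>(UNIV :: 'n set). \<Sum>j\<in>(UNIV :: 'n set). P)"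
      using psd_entry_le[OF S(1)] S(2) by (intro sum_mono) (meson order_trans)
    finally show "norm S \<le> (\<Sum>i\<in>(UNIV :: 'n set). \<Sum>j\<in>(UNIV :: 'n set). P)" .
  qed
  ultimately show ?thesis by (simp add: compact_eq_bounded_closed)
qed

lemma continuous_on_det: "continuous_on X f \<Longrightarrow> continuous_on X (\<lambda>x. det (f x :: real^'n^'n))"
  unfolding det_def by (intro continuous_intros)

lemma continuous_on_matrix_conj:
  fixes A :: "real^'n^'n"
  assumes "continuous_on X f"
  shows "continuous_on X (\<lambda>x. A ** f x ** transpose A)"
proof -
  have "linear (\<lambda>S. A ** S ** transpose A)"
    by (rule linearI) (simp_all add: matrix_add_ldistrib matrix_add_rdistrib matrix_mult_scaleR_left matrix_mult_scaleR_right)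
  then have "bounded_linear (\<lambda>S. A ** S ** transpose A)" by (simp add: linear_conv_bounded_linear)
  from bounded_linear.continuous_on[OF this assms] show ?thesis .
qed

lemma continuous_on_sum_rate_min:
  fixes H1 H2 H3 H4 :: "real^'n^'n"
  shows "continuous_on {p. psd (fst p) \<and> psd (snd p)} (\<lambda>p. sum_rate_min H1 H2 H3 H4 (fst p) (snd p))"
proof -
  have pos: "det (mat 1 + A ** S ** transpose A) \<noteq> 0" if "psd S" for A S :: "real^'n^'n"
    by (intro less_imp_neq[symmetric] pdef_det_pos pdef_add_psd pdef_mat_1 psd_conj that)
  have pos2: "det (mat 1 + A ** S ** transpose A + B ** T ** transpose B) \<noteq> 0"
    if "psd S" "psd T" for A B S T :: "real^'n^'n"
    by (intro less_imp_neq[symmetric] pdef_det_pos pdef_add_psd pdef_mat_1 psd_conj that)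
  show ?thesis
    unfolding sum_rate_min_eq
    by (intro continuous_on_min continuous_on_add continuous_on_mult continuous_on_const continuous_on_ln continuous_on_det
        continuous_on_matrix_conj continuous_on_fst continuous_on_snd continuous_on_id ballI)
       (auto simp: pos pos2)
qed

section \<open>Achievability near the maximum\<close>

lemma trace_gram_zero:
  fixes B :: "real^'n^'n"
  assumes "trace (B ** transpose B) = 0"
  shows "B = 0"
proof -
  have "trace (B ** transpose B) = (\<Sum>i\<in>UNIV. \<Sum>k\<in>UNIV. (B $ i $ k)\<^sup>2)"
    by (simp add: trace_def matrix_matrix_mult_def transpose_def power2_eq_square)
  then show ?thesis
    using assms by (simp add: sum_nonneg_eq_0_iff sum_nonneg vec_eq_iff)
qed

text \<open>Scaling both covariances by some \<open>s < 1\<close> leaves slack in the power constraints.\<close>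

lemma achievable_near:
  fixes H1 H2 H3 H4 :: "real^'n^'n" and N :: "((real^'n) \<times> (real^'n)) measure"
  assumes N: "noise_law N" and P0: "0 \<le> P1" "0 \<le> P2"
    and S: "psd S1" "psd S2" "trace S1 \<le> P1" "trace S2 \<le> P2" and \<epsilon>: "0 < \<epsilon>"
  shows "\<exists>R1 R2. achievable H1 H2 H3 H4 N P1 P2 R1 R2 \<and> sum_rate_min H1 H2 H3 H4 S1 S2 - \<epsilon> \<le> R1 + R2"
proof -
  define m where "m s = sum_rate_min H1 H2 H3 H4 (s *\<^sub>R S1) (s *\<^sub>R S2)" for s
  have "continuous_on {0..1} m"
  proof -
    have "continuous_on {0..1} (\<lambda>s. (\<lambda>p. sum_rate_min H1 H2 H3 H4 (fst p) (snd p)) (s *\<^sub>R S1, s *\<^sub>R S2))"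
      by (rule continuous_on_compose2[OF continuous_on_sum_rate_min])
         (auto intro!: continuous_intros psd_scaleR S)
    then show ?thesis by (simp add: m_def)
  qed
  then have "\<exists>d>0. \<forall>s\<in>{0..1}. dist s 1 < d \<longrightarrow> dist (m s) (m 1) < \<epsilon> / 2"
    unfolding continuous_on_iff using \<epsilon> by (metis atLeastAtMost_iff half_gt_zero order_refl zero_le_one)
  then obtain d where d: "d > 0" "\<And>s. s \<in> {0..1} \<Longrightarrow> dist s 1 < d \<Longrightarrow> dist (m s) (m 1) < \<epsilon> / 2" by blast
  define s where "s = max 0 (1 - d / 2)"
  have s: "0 \<le> s" "s < 1" using d(1) by (auto simp: s_def)
  have "dist (m s) (m 1) < \<epsilon> / 2"
    by (rule d(2)) (use s d(1) in \<open>auto simp: s_def dist_real_def\<close>)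
  then have "m 1 - \<epsilon> / 2 < m s" unfolding dist_real_def by linarith
  then have ms: "sum_rate_min H1 H2 H3 H4 S1 S2 - \<epsilon> / 2 < m s" by (simp add: m_def[of 1])
  obtain B1 :: "real^'n^'n" where B1: "s *\<^sub>R S1 = B1 ** transpose B1" using psd_factor[OF psd_scaleR[OF s(1) S(1)]] .
  obtain B2 :: "real^'n^'n" where B2: "s *\<^sub>R S2 = B2 ** transpose B2" using psd_factor[OF psd_scaleR[OF s(1) S(2)]] .
  \<comment> \<open>Scaling by \<open>s < 1\<close> gains slack exactly when the trace is positive;
    when it is 0, the factor \<open>B\<close> is 0.\<close>
  have pw: "trace (B ** transpose B) < P \<or> B = 0"
    if B: "s *\<^sub>R T = B ** transpose B" and T: "psd T" "trace T \<le> P" for B T :: "real^'n^'n" and P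
  proof -
    have tr: "trace (B ** transpose B) = s * trace T" by (simp add: B[symmetric] trace_scaleR)
    show ?thesis
    proof (cases "trace T = 0")
      case True
      then show ?thesis using tr trace_gram_zero by auto
    next
      case False
      then have "0 < trace T" using psd_trace_nonneg[OF T(1)] by simp
      then have "s * trace T < trace T" using s by simp
      then show ?thesis using tr T(2) by simp
    qed
  qed
  have g: "(H ** B) ** transpose (H ** B) = H ** (B ** transpose B) ** transpose H" for H B :: "real^'n^'n"
    by (simp add: matrix_transpose_mul matrix_mul_assoc)
  define c1 where "c1 = ln (det (mat 1 + (H1 ** B1) ** transpose (H1 ** B1))) / 2"
  define c2 where "c2 = ln (det (mat 1 + (H4 ** B2) ** transpose (H4 ** B2))) / 2"
  define a where "a = ln (det (mat 1 + (H1 ** B1) ** transpose (H1 ** B1) + (H2 ** B2) ** transpose (H2 ** B2))) / 2"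
  define b where "b = ln (det (mat 1 + (H4 ** B2) ** transpose (H4 ** B2) + (H3 ** B1) ** transpose (H3 ** B1))) / 2"
  have ba: "b = ln (det (mat 1 + (H3 ** B1) ** transpose (H3 ** B1) + (H4 ** B2) ** transpose (H4 ** B2))) / 2"
    by (simp add: b_def add_ac)
  have mm: "m s = min a (min b (c1 + c2))"
    unfolding m_def sum_rate_min_eq c1_def c2_def a_def ba g B1[symmetric] B2[symmetric] by simp
  \<comment> \<open>The target sum rate, strictly below all three expressions at the scaled
    covariances. One half of the loss of \<open>\<epsilon>\<close> is spent here, the other half on
    the scaling.\<close>
  define T where "T = m s - \<epsilon> / 2"
  have T: "T < a" "T < b" "T \<le> c1 + c2 - \<epsilon> / 2" using \<epsilon> by (auto simp: T_def mm)
  \<comment> \<open>User 1 gets as much of \<open>T\<close> as \<open>c1 - \<epsilon> / 8\<close>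
    permits and user 2 the rest. Since \<open>T \<le> c1 + c2 - \<epsilon> / 2\<close>, the rest is
    0 or lies below \<open>c2\<close>, even when \<open>c1 - \<epsilon> / 8\<close> is negative and
    \<open>R1\<close> is cut off at 0.\<close>
  define R1 where "R1 = (if T \<le> 0 then 0 else max 0 (min (c1 - \<epsilon> / 8) T))"
  define R2 where "R2 = (if T \<le> 0 then 0 else T - R1)"
  have "achievable H1 H2 H3 H4 N P1 P2 R1 R2"
  proof (rule achievable_rates[OF N _ _ P0 pw[OF B1 S(1,3)] pw[OF B2 S(2,4)]], fold c1_def c2_def a_def b_def)
    show "0 \<le> R1" "0 \<le> R2" by (auto simp: R1_def R2_def)
    show "R1 = 0 \<or> R1 < c1 \<and> R1 + R2 < a" using T \<epsilon> by (auto simp: R1_def R2_def)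
    show "R2 = 0 \<or> R2 < c2 \<and> R2 + R1 < b" using T \<epsilon> by (auto simp: R1_def R2_def max_def min_def)
  qed
  moreover have "sum_rate_min H1 H2 H3 H4 S1 S2 - \<epsilon> \<le> R1 + R2"
    using ms by (auto simp: R1_def R2_def T_def)
  ultimately show ?thesis by blast
qed

theorem theorem4:
  fixes H1 H2 H3 H4 :: "real^'n^'n"
    and P1 P2 :: real
    and N :: "((real^'n) \<times> (real^'n)) measure"
  assumes "noise_law N"
    and "0 \<le> P1" and "0 \<le> P2"
    and "invertible H1" and "invertible H2" and "invertible H3" and "invertible H4"
    and "transpose H2 ** H2 \<succeq> transpose H4 ** H4"
    and "transpose H3 ** H3 \<succeq> transpose H1 ** H1"
  defines "V \<equiv> {sum_rate_min H1 H2 H3 H4 S1 S2 | S1 S2.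
                  psd S1 \<and> psd S2 \<and> trace S1 \<le> P1 \<and> trace S2 \<le> P2}"
  shows "\<exists>C. C \<in> V \<and> (\<forall>v\<in>V. v \<le> C) \<and> sum_rate_capacity H1 H2 H3 H4 N P1 P2 = ereal C"
proof -
  let ?K = "{S :: real^'n^'n. psd S \<and> trace S \<le> P1} \<times> {S :: real^'n^'n. psd S \<and> trace S \<le> P2}"
  have tr0: "trace (0 :: real^'n^'n) = 0" by (simp add: trace_def)
  have K: "compact ?K" by (intro compact_Times compact_psd_trace_le)
  have K0: "?K \<noteq> {}"
  proof -
    have "(0, 0) \<in> ?K" using assms(2,3) tr0 by simp
    then show ?thesis by blast
  qed
  have Kc: "continuous_on ?K (\<lambda>p. sum_rate_min H1 H2 H3 H4 (fst p) (snd p))"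
    by (rule continuous_on_subset[OF continuous_on_sum_rate_min]) auto
  obtain p where p: "p \<in> ?K"
    "\<And>q. q \<in> ?K \<Longrightarrow> sum_rate_min H1 H2 H3 H4 (fst q) (snd q) \<le> sum_rate_min H1 H2 H3 H4 (fst p) (snd p)"
    using continuous_attains_sup[OF K K0 Kc] by blast
  obtain S1 S2 where pS: "p = (S1, S2)" by (cases p)
  define C where "C = sum_rate_min H1 H2 H3 H4 S1 S2"
  have S: "psd S1" "psd S2" "trace S1 \<le> P1" "trace S2 \<le> P2" using p(1) by (auto simp: pS)
  have max: "sum_rate_min H1 H2 H3 H4 T1 T2 \<le> C" if "psd T1" "psd T2" "trace T1 \<le> P1" "trace T2 \<le> P2" for T1 T2
    using p(2)[of "(T1, T2)"] that by (simp add: pS C_def)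
  have "sum_rate_capacity H1 H2 H3 H4 N P1 P2 = ereal C"
  proof (rule antisym)
    \<comment> \<open>The half-plane is closed, so the bound for achievable pairs survives the
      closure in the definition of the region.\<close>
    have "capacity_region H1 H2 H3 H4 N P1 P2 \<subseteq> {q. fst q + snd q \<le> C}"
      unfolding capacity_region_def
    proof (rule closure_minimal)
      show "{(R1, R2). achievable H1 H2 H3 H4 N P1 P2 R1 R2} \<subseteq> {q. fst q + snd q \<le> C}"
        using achievable_sum_le[OF assms(1,4-9) max] by auto
      show "closed {q :: real \<times> real. fst q + snd q \<le> C}"
        by (intro closed_Collect_le continuous_intros)
    qed
    then show "sum_rate_capacity H1 H2 H3 H4 N P1 P2 \<le> ereal C"
      unfolding sum_rate_capacity_def by (intro SUP_least) auto
    show "ereal C \<le> sum_rate_capacity H1 H2 H3 H4 N P1 P2"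
    proof (rule ereal_le_epsilon2)
      fix \<epsilon> :: real assume "0 < \<epsilon>"
      from achievable_near[where ?H1.0 = H1 and ?H2.0 = H2 and ?H3.0 = H3 and ?H4.0 = H4, OF assms(1-3) S this]
      obtain R1 R2 where R: "achievable H1 H2 H3 H4 N P1 P2 R1 R2" "C - \<epsilon> \<le> R1 + R2"
        unfolding C_def by (elim exE conjE)
      have "(R1, R2) \<in> capacity_region H1 H2 H3 H4 N P1 P2"
        unfolding capacity_region_def by (rule subsetD[OF closure_subset]) (simp add: R(1))
      then have "ereal (R1 + R2) \<le> sum_rate_capacity H1 H2 H3 H4 N P1 P2"
        unfolding sum_rate_capacity_def by (rule SUP_upper2) simp
      then have "ereal (R1 + R2) + ereal \<epsilon> \<le> sum_rate_capacity H1 H2 H3 H4 N P1 P2 + ereal \<epsilon>"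
        by (rule add_right_mono)
      moreover have "ereal C \<le> ereal (R1 + R2) + ereal \<epsilon>" using R(2) by simp
      ultimately show "ereal C \<le> sum_rate_capacity H1 H2 H3 H4 N P1 P2 + ereal \<epsilon>"
        by (rule order_trans[rotated])
    qed
  qed
  moreover have "C \<in> V" unfolding V_def C_def using S by blast
  moreover have "\<forall>v\<in>V. v \<le> C" unfolding V_def using max by blast
  ultimately show ?thesis by blast
qed

end
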